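(* Given a string $x$ of length $n$ over a fixed-sized (constant-size) ordered alphabet and a positive integer $m<n$, the \textsc{1-mappability} problem for $x$ and $m$ can be solved in $\mathcal{O}(\min \{mn, n\log^2 n \})$ time and $\mathcal{O}(n)$ space.
   Context: For strings $y,z$ of equal length, the Hamming distance $d_H(y,z)$ is the number of positions at which they differ. For a string $x=x[0]x[1]\cdots x[n-1]$, $x[i\,..\,j]=x[i]\cdots x[j]$ denotes a factor. The \textsc{1-mappability} problem: given a string $x$ of length $n$ and an integer $m$ with $1\le m<n$, output an integer array $C$ of size $n-m+1$ such that, for each $0\le i\le n-m$, $C[i]$ is the number of length-$m$ factors of $x$ (counted by starting position $j\in\{0,\ldots,n-m\}$) that are at Hamming distance exactly $1$ from $x[i\,..\,i+m-1]$. The model of computation is the standard word RAM. *)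

theory Defs
  imports Complex_Main "HOL-Library.Landau_Symbols"
begin

unbundle bit_operations_syntax

definition hamming_distance :: "'a list \<Rightarrow> 'a list \<Rightarrow> nat" where
  "hamming_distance y z = card {k. k < length y \<and> y ! k \<noteq> z ! k}"

definition factor :: "'a list \<Rightarrow> nat \<Rightarrow> nat \<Rightarrow> 'a list" where
  "factor x i m = take m (drop i x)"

definition one_mappability :: "'a list \<Rightarrow> nat \<Rightarrow> nat list" where
  "one_mappability x m =
     map (\<lambda>i. card {j. j \<le> length x - m \<and> hamming_distance (factor x i m) (factor x j m) = 1})
       [0..<length x - m + 1]"

text \<open>
  A machine with word length \<open>w\<close> has registers and memory cells holding numbers below \<open>2 ^ w\<close>.
  Since a program is a finite list of instructions, it mentions only constantly many registers;
  the memory is an array of explicit size, and an access beyond its end blocks the machine.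
  Every instruction has unit cost.
\<close>

datatype binop = Add | Sub | Mul | Quot | Rem | Bit_And | Bit_Or | Bit_Xor | Shift_Left | Shift_Right

type_synonym reg = nat

datatype instr =
    Const reg nat
  | Move reg reg
  | Op binop reg reg reg
  | Load reg reg
  | Store reg reg
  | Jump nat
  | Jump_Eq reg reg nat
  | Jump_Less reg reg nat
  | Halt

fun eval_binop :: "nat \<Rightarrow> binop \<Rightarrow> nat \<Rightarrow> nat \<Rightarrow> nat" where
  "eval_binop w Add a b = take_bit w (a + b)"
| "eval_binop w Sub a b = take_bit w (2 ^ w + a - b)"
| "eval_binop w Mul a b = take_bit w (a * b)"
| "eval_binop w Quot a b = a div b"
| "eval_binop w Rem a b = a mod b"
| "eval_binop w Bit_And a b = a AND b"
| "eval_binop w Bit_Or a b = a OR b"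
| "eval_binop w Bit_Xor a b = a XOR b"
| "eval_binop w Shift_Left a b = take_bit w (push_bit b a)"
| "eval_binop w Shift_Right a b = drop_bit b a"

text \<open>A configuration consists of program counter, register contents and memory.\<close>

type_synonym config = "nat \<times> (reg \<Rightarrow> nat) \<times> nat list"

fun exec_instr :: "nat \<Rightarrow> instr \<Rightarrow> config \<Rightarrow> config option" where
  "exec_instr w (Const r k) (pc, R, M) = Some (pc + 1, R(r := take_bit w k), M)"
| "exec_instr w (Move r s) (pc, R, M) = Some (pc + 1, R(r := R s), M)"
| "exec_instr w (Op f r s t) (pc, R, M) = Some (pc + 1, R(r := eval_binop w f (R s) (R t)), M)"
| "exec_instr w (Load r s) (pc, R, M) =
     (if R s < length M then Some (pc + 1, R(r := M ! R s), M) else None)"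
| "exec_instr w (Store r s) (pc, R, M) =
     (if R r < length M then Some (pc + 1, R, M[R r := R s]) else None)"
| "exec_instr w (Jump l) (pc, R, M) = Some (l, R, M)"
| "exec_instr w (Jump_Eq r s l) (pc, R, M) = Some (if R r = R s then l else pc + 1, R, M)"
| "exec_instr w (Jump_Less r s l) (pc, R, M) = Some (if R r < R s then l else pc + 1, R, M)"
| "exec_instr w Halt (pc, R, M) = None"

definition step :: "nat \<Rightarrow> instr list \<Rightarrow> config \<Rightarrow> config \<Rightarrow> bool" where
  "step w P c c' \<longleftrightarrow> fst c < length P \<and> exec_instr w (P ! fst c) c = Some c'"

definition halted :: "instr list \<Rightarrow> config \<Rightarrow> bool" where
  "halted P c \<longleftrightarrow> fst c < length P \<and> P ! fst c = Halt"

text \<open>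
  The program \<open>P\<close> starts with the numbers \<open>args\<close> in its first registers and the array \<open>inp\<close> at
  the beginning of a memory of \<open>s\<close> cells, everything else being zero. It has to halt within \<open>t\<close>
  steps, leaving the array \<open>out\<close> in memory at the address given by register 0.
\<close>

definition initial_config :: "nat list \<Rightarrow> nat list \<Rightarrow> nat \<Rightarrow> config" where
  "initial_config args inp s =
     (0, \<lambda>r. if r < length args then args ! r else 0, inp @ replicate (s - length inp) 0)"

definition computes_within ::
  "nat \<Rightarrow> instr list \<Rightarrow> nat list \<Rightarrow> nat list \<Rightarrow> nat list \<Rightarrow> nat \<Rightarrow> nat \<Rightarrow> bool" where
  "computes_within w P args inp out t s \<longleftrightarrow>
     s \<le> 2 ^ w \<and> length inp \<le> s \<and> (\<forall>a \<in> set args \<union> set inp. a < 2 ^ w) \<and>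
     (\<exists>k pc R M. k \<le> t \<and> (step w P ^^ k) (initial_config args inp s) (pc, R, M) \<and>
        halted P (pc, R, M) \<and>
        R 0 + length out \<le> length M \<and> take (length out) (drop (R 0) M) = out)"

text \<open>Letters are presented to the machine as their ranks \<open>0, \<dots>, |A| - 1\<close> in the alphabet.\<close>

definition letter_rank :: "'a::linorder set \<Rightarrow> 'a \<Rightarrow> nat" where
  "letter_rank A a = card {b \<in> A. b < a}"

text \<open>
  A single program has to work for all inputs and all word lengths \<open>w \<ge> log\<^sub>2 n + O(1)\<close>,
  the additive constant allowing a memory of \<open>O(n)\<close> cells to be addressed.
\<close>

definition solves_one_mappability ::
  "'a::linorder set \<Rightarrow> instr list \<Rightarrow> (nat \<Rightarrow> nat \<Rightarrow> nat) \<Rightarrow> (nat \<Rightarrow> nat \<Rightarrow> nat) \<Rightarrow> bool" where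
  "solves_one_mappability A P T S \<longleftrightarrow>
     (\<exists>K::nat. \<forall>x m w. set x \<subseteq> A \<and> 1 \<le> m \<and> m < length x \<and> K * length x \<le> 2 ^ w \<longrightarrow>
        computes_within w P [length x, m] (map (letter_rank A) x) (one_mappability x m)
          (T (length x) m) (S (length x) m))"

text \<open>
  With respect to this filter, \<open>O\<close> means a single constant for all admissible pairs \<open>(n, m)\<close>.
\<close>

definition admissible :: "(nat \<times> nat) filter" where
  "admissible = principal {(n, m). 1 \<le> m \<and> m < n}"

end

theory Submission
  imports Defs "HOL-Library.Discrete_Functions"
begin

text \<open>
  One window is kept for every distinct factor of length \<open>m\<close>, weighted by its number of occurrences.
  A task consists of a set of such windows that agree outside an interval of offsets; it is split by
  grouping the windows once by their right half of the interval (the mismatch is then in the left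
  half) and once by their left half. Groups with a single window are dropped, and for an interval
  of length one all pairs of the set are at distance one. Every level of the recursion visits a
  window at most once for every interval, which gives \<open>O(m n)\<close> in total; since the windows of a
  task are determined by their halves, subadditivity of entropy shows that \<open>N log N\<close>, summed over
  all tasks of a level, does not increase, which gives \<open>O(n log n log m)\<close>.

  Halves are compared by names of blocks of length \<open>2 ^ j\<close> (Karp, Miller and Rosenberg), two
  overlapping blocks covering a half. The names are ranks in the order of blocks, hence the name at
  level \<open>j\<close> is the predecessor of the name at the top level among the names of level \<open>j\<close>. Storing
  the latter as bit vectors of words of \<open>log n\<close> bits takes linear space for all levels together and
  constant time per query.
\<close>

section \<open>A while language compiled to the word RAM\<close>

text \<open>The program never tests which of the two time bounds is smaller. Each task carries a
  potential with a rate \<open>\<omega>\<close> per element that stays open until the end, and two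
  instances of \<open>valid_rate\<close> analyse the same run. The obstacle is linear space: neither
  the names of all levels nor copies of the window sets can be kept. The sets are therefore ranges
  of one array that is permuted in place. Since a half is covered by two blocks, it takes two
  groupings, so a task passes through phases \<open>0\<close> to \<open>3\<close>; these four
  groupings are the factor \<open>4\<close> in the rates. The counters of a grouping are indexed by
  names below \<open>n\<close> and return to zero during the distribution, so a grouping costs time
  linear in its set and not in \<open>n\<close>. Blocks are read circularly because a shift then
  permutes the positions and preserves ranks; the windows that are compared never wrap around.
  Programs are written over unbounded numbers, with side conditions that exclude overflow, and the
  recursion is an explicit stack because the machine has no calls.\<close>

datatype exp = Cnst nat | Var nat | Bin binop exp exp | Arr nat exp

datatype bexp = Lt exp exp | Equ exp exp

datatype com = Skip | Assign nat exp | Put nat exp exp | Seq com com (infixr ";;" 60)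
  | Cond bexp com com | While bexp com

type_synonym regs = "nat \<Rightarrow> nat"
type_synonym arrs = "nat \<Rightarrow> nat \<Rightarrow> nat"

fun eval_op :: "binop \<Rightarrow> nat \<Rightarrow> nat \<Rightarrow> nat" where
  "eval_op Add x y = x + y"
| "eval_op Sub x y = x - y"
| "eval_op Mul x y = x * y"
| "eval_op Quot x y = x div y"
| "eval_op Rem x y = x mod y"
| "eval_op Bit_And x y = x AND y"
| "eval_op Bit_Or x y = x OR y"
| "eval_op Bit_Xor x y = x XOR y"
| "eval_op Shift_Left x y = push_bit y x"
| "eval_op Shift_Right x y = drop_bit y x"

fun eval_exp :: "regs \<Rightarrow> arrs \<Rightarrow> exp \<Rightarrow> nat" where
  "eval_exp r a (Cnst k) = k"
| "eval_exp r a (Var v) = r v"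
| "eval_exp r a (Bin f d e) = eval_op f (eval_exp r a d) (eval_exp r a e)"
| "eval_exp r a (Arr k e) = a k (eval_exp r a e)"

fun eval_bexp :: "regs \<Rightarrow> arrs \<Rightarrow> bexp \<Rightarrow> bool" where
  "eval_bexp r a (Lt d e) \<longleftrightarrow> eval_exp r a d < eval_exp r a e"
| "eval_bexp r a (Equ d e) \<longleftrightarrow> eval_exp r a d = eval_exp r a e"

fun written_vars :: "com \<Rightarrow> nat set" where
  "written_vars Skip = {}"
| "written_vars (Assign v e) = {v}"
| "written_vars (Put k d e) = {}"
| "written_vars (c ;; d) = written_vars c \<union> written_vars d"
| "written_vars (Cond b c d) = written_vars c \<union> written_vars d"
| "written_vars (While b c) = written_vars c"

fun written_arrs :: "com \<Rightarrow> nat set" where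
  "written_arrs Skip = {}"
| "written_arrs (Assign v e) = {}"
| "written_arrs (Put k d e) = {k}"
| "written_arrs (c ;; d) = written_arrs c \<union> written_arrs d"
| "written_arrs (Cond b c d) = written_arrs c \<union> written_arrs d"
| "written_arrs (While b c) = written_arrs c"

text \<open>The rules of the program logic hand this fact to their postconditions, so an invariant
  has to mention only what its code changes.\<close>

definition frame :: "com \<Rightarrow> regs \<Rightarrow> arrs \<Rightarrow> regs \<Rightarrow> arrs \<Rightarrow> bool" where
  "frame c r a r' a' \<longleftrightarrow> (\<forall>v. v \<notin> written_vars c \<longrightarrow> r' v = r v) \<and> (\<forall>k. k \<notin> written_arrs c \<longrightarrow> a' k = a k)"

text \<open>
  Expressions are evaluated on a stack of registers starting at \<open>64\<close>, and array \<open>k\<close> occupies the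
  \<open>8 n\<close> cells from address \<open>8 k n\<close> on, where \<open>n\<close> is read from register \<open>0\<close>.
\<close>

fun compile_exp :: "exp \<Rightarrow> nat \<Rightarrow> instr list" where
  "compile_exp (Cnst k) t = [Const t k]"
| "compile_exp (Var v) t = [Move t v]"
| "compile_exp (Bin f d e) t = compile_exp d t @ compile_exp e (t + 1) @ [Op f t t (t + 1)]"
| "compile_exp (Arr k e) t = compile_exp e t @
     [Const (t + 1) (8 * k), Op Mul (t + 1) (t + 1) 0, Op Add t t (t + 1), Load t t]"

fun exp_size :: "exp \<Rightarrow> nat" where
  "exp_size (Cnst k) = 1"
| "exp_size (Var v) = 1"
| "exp_size (Bin f d e) = exp_size d + exp_size e + 1"
| "exp_size (Arr k e) = exp_size e + 4"

fun bexp_size :: "bexp \<Rightarrow> nat" where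
  "bexp_size (Lt d e) = exp_size d + exp_size e"
| "bexp_size (Equ d e) = exp_size d + exp_size e"

fun com_size :: "com \<Rightarrow> nat" where
  "com_size Skip = 0"
| "com_size (Assign v e) = exp_size e + 1"
| "com_size (Put k d e) = exp_size d + exp_size e + 4"
| "com_size (c ;; d) = com_size c + com_size d"
| "com_size (Cond b c d) = bexp_size b + com_size c + com_size d + 2"
| "com_size (While b c) = bexp_size b + com_size c + 3"

fun compile_test :: "bexp \<Rightarrow> nat \<Rightarrow> instr list" where
  "compile_test (Lt d e) l = compile_exp d 64 @ compile_exp e 65 @ [Jump_Less 64 65 l]"
| "compile_test (Equ d e) l = compile_exp d 64 @ compile_exp e 65 @ [Jump_Eq 64 65 l]"

text \<open>The argument \<open>p\<close> is the absolute address of the first instruction, as the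
  jumps of the machine are absolute. A test jumps when it holds, so the else branch directly follows
  it and the then branch comes last.\<close>

fun compile :: "com \<Rightarrow> nat \<Rightarrow> instr list" where
  "compile Skip p = []"
| "compile (Assign v e) p = compile_exp e 64 @ [Move v 64]"
| "compile (Put k d e) p = compile_exp d 64 @
     [Const 65 (8 * k), Op Mul 65 65 0, Op Add 64 64 65] @ compile_exp e 65 @ [Store 64 65]"
| "compile (c ;; d) p = compile c p @ compile d (p + com_size c)"
| "compile (Cond b c d) p = compile_test b (p + bexp_size b + com_size d + 2) @ compile d (p + bexp_size b + 1) @
     [Jump (p + bexp_size b + com_size d + com_size c + 2)] @ compile c (p + bexp_size b + com_size d + 2)"
| "compile (While b c) p = compile_test b (p + bexp_size b + 2) @ [Jump (p + bexp_size b + com_size c + 3)] @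
     compile c (p + bexp_size b + 2) @ [Jump p]"

lemma length_cexp [simp]: "length (compile_exp e t) = exp_size e"
  by (induction e arbitrary: t) auto

lemma length_ctest [simp]: "length (compile_test b l) = bexp_size b + 1"
  by (cases b) auto

lemma length_comp [simp]: "length (compile c p) = com_size c"
  by (induction c arbitrary: p) auto

text \<open>Variables stay below the evaluation stack, which begins at register 64, and 24 arrays of
  \<open>8 * n\<close> cells fill a memory of \<open>192 * n\<close> cells. In \<open>wf_com\<close>
  register 0 is never assigned, because all array addresses are computed from the \<open>n\<close>
  it holds.\<close>

fun wf_exp :: "exp \<Rightarrow> bool" where
  "wf_exp (Cnst k) \<longleftrightarrow> True"
| "wf_exp (Var v) \<longleftrightarrow> v < 64"
| "wf_exp (Bin f d e) \<longleftrightarrow> wf_exp d \<and> wf_exp e"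
| "wf_exp (Arr k e) \<longleftrightarrow> k < 24 \<and> wf_exp e"

fun wf_bexp :: "bexp \<Rightarrow> bool" where
  "wf_bexp (Lt d e) \<longleftrightarrow> wf_exp d \<and> wf_exp e"
| "wf_bexp (Equ d e) \<longleftrightarrow> wf_exp d \<and> wf_exp e"

fun wf_com :: "com \<Rightarrow> bool" where
  "wf_com Skip \<longleftrightarrow> True"
| "wf_com (Assign v e) \<longleftrightarrow> 0 < v \<and> v < 64 \<and> wf_exp e"
| "wf_com (Put k d e) \<longleftrightarrow> k < 24 \<and> wf_exp d \<and> wf_exp e"
| "wf_com (c ;; d) \<longleftrightarrow> wf_com c \<and> wf_com d"
| "wf_com (Cond b c d) \<longleftrightarrow> wf_bexp b \<and> wf_com c \<and> wf_com d"
| "wf_com (While b c) \<longleftrightarrow> wf_bexp b \<and> wf_com c"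

section \<open>Correctness of the compiler\<close>

definition code_at :: "instr list \<Rightarrow> nat \<Rightarrow> instr list \<Rightarrow> bool" where
  "code_at P p xs \<longleftrightarrow> (\<forall>i<length xs. p + i < length P \<and> P ! (p + i) = xs ! i)"

lemma code_at_Nil [simp]: "code_at P p []"
  by (simp add: code_at_def)

lemma code_at_append [simp]:
  "code_at P p (xs @ ys) \<longleftrightarrow> code_at P p xs \<and> code_at P (p + length xs) ys"
proof (intro iffI conjI)
  assume h: "code_at P p (xs @ ys)"
  show "code_at P p xs" using h unfolding code_at_def
    by (metis length_append nth_append trans_less_add1)
  show "code_at P (p + length xs) ys" unfolding code_at_def
  proof (intro allI impI)
    fix i assume "i < length ys"
    then have "length xs + i < length (xs @ ys)" by simp
    with h have "p + (length xs + i) < length P \<and> P ! (p + (length xs + i)) = (xs @ ys) ! (length xs + i)"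
      unfolding code_at_def by blast
    then show "p + length xs + i < length P \<and> P ! (p + length xs + i) = ys ! i"
      by (simp add: add.assoc)
  qed
next
  assume h: "code_at P p xs \<and> code_at P (p + length xs) ys"
  show "code_at P p (xs @ ys)" unfolding code_at_def
  proof (intro allI impI)
    fix i assume i: "i < length (xs @ ys)"
    show "p + i < length P \<and> P ! (p + i) = (xs @ ys) ! i"
    proof (cases "i < length xs")
      case True then show ?thesis using h by (simp add: code_at_def nth_append)
    next
      case False
      then have "i - length xs < length ys" using i by simp
      then have "p + length xs + (i - length xs) < length P \<and>
         P ! (p + length xs + (i - length xs)) = ys ! (i - length xs)"
        using h unfolding code_at_def by blast
      moreover have "p + length xs + (i - length xs) = p + i" using False by simp
      ultimately show ?thesis using False by (simp add: nth_append)
    qed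
  qed
qed

lemma code_at_Cons [simp]:
  "code_at P p (x # xs) \<longleftrightarrow> p < length P \<and> P ! p = x \<and> code_at P (Suc p) xs"
  using code_at_append[of P p "[x]" xs] by (simp add: code_at_def)

definition steps :: "nat \<Rightarrow> instr list \<Rightarrow> config \<Rightarrow> nat \<Rightarrow> config \<Rightarrow> bool" where
  "steps w P c k c' \<longleftrightarrow> (step w P ^^ k) c c'"

lemma steps_0 [simp]: "steps w P c 0 c"
  by (simp add: steps_def)

lemma steps_trans [trans]: "steps w P c k c' \<Longrightarrow> steps w P c' l c'' \<Longrightarrow> steps w P c (k + l) c''"
  unfolding steps_def relpowp_add by blast

lemma steps_1: "fst c < length P \<Longrightarrow> exec_instr w (P ! fst c) c = Some c' \<Longrightarrow> steps w P c 1 c'"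
  unfolding steps_def by (auto simp: step_def)

lemma steps_Suc:
  assumes "fst c < length P" "exec_instr w (P ! fst c) c = Some c'" "steps w P c' k c''"
  shows "steps w P c (Suc k) c''"
  using steps_trans[OF steps_1[OF assms(1,2)] assms(3)] by simp

text \<open>The constant is 24 arrays times 8: words can then address the whole memory, and every
  number up to \<open>100 * n\<close> that the algorithm forms fits into a word.\<close>

locale wram =
  fixes w n :: nat
  assumes n2: "2 \<le> n" and big: "192 * n \<le> 2 ^ w"
begin

text \<open>These conditions make evaluation over unbounded numbers agree with machine words:
  results fit into a word, constants are not truncated, subtraction neither wraps around nor is cut
  off at zero, and array indices stay within their \<open>8 * n\<close> cells.\<close>

fun ok :: "regs \<Rightarrow> arrs \<Rightarrow> exp \<Rightarrow> bool" where
  "ok r a (Cnst k) \<longleftrightarrow> k < 2 ^ w"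
| "ok r a (Var v) \<longleftrightarrow> True"
| "ok r a (Bin f d e) \<longleftrightarrow> ok r a d \<and> ok r a e \<and> eval_op f (eval_exp r a d) (eval_exp r a e) < 2 ^ w \<and>
     (f = Sub \<longrightarrow> eval_exp r a e \<le> eval_exp r a d)"
| "ok r a (Arr k e) \<longleftrightarrow> ok r a e \<and> eval_exp r a e < 8 * n"

fun ok_bexp :: "regs \<Rightarrow> arrs \<Rightarrow> bexp \<Rightarrow> bool" where
  "ok_bexp r a (Lt d e) \<longleftrightarrow> ok r a d \<and> ok r a e"
| "ok_bexp r a (Equ d e) \<longleftrightarrow> ok r a d \<and> ok r a e"

text \<open>A derivation exists only for terminating runs that satisfy the side conditions, so total
  correctness needs no separate treatment of blocked or overflowing runs. In conditionals and loops
  the \<open>2\<close> stands for the conditional jump and one unconditional jump.\<close>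

inductive exec :: "com \<Rightarrow> regs \<Rightarrow> arrs \<Rightarrow> nat \<Rightarrow> regs \<Rightarrow> arrs \<Rightarrow> bool" where
  skip: "exec Skip r a 0 r a"
| assign: "ok r a e \<Longrightarrow> exec (Assign v e) r a (exp_size e + 1) (r(v := eval_exp r a e)) a"
| put: "ok r a d \<Longrightarrow> ok r a e \<Longrightarrow> eval_exp r a d < 8 * n \<Longrightarrow>
    exec (Put k d e) r a (exp_size d + exp_size e + 4) r (a(k := (a k)(eval_exp r a d := eval_exp r a e)))"
| seq: "exec c r a s r' a' \<Longrightarrow> exec d r' a' t r'' a'' \<Longrightarrow> exec (c ;; d) r a (s + t) r'' a''"
| cond1: "ok_bexp r a b \<Longrightarrow> eval_bexp r a b \<Longrightarrow> exec c r a t r' a' \<Longrightarrow>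
    exec (Cond b c d) r a (bexp_size b + 2 + t) r' a'"
| cond2: "ok_bexp r a b \<Longrightarrow> \<not> eval_bexp r a b \<Longrightarrow> exec d r a t r' a' \<Longrightarrow>
    exec (Cond b c d) r a (bexp_size b + 2 + t) r' a'"
| while1: "ok_bexp r a b \<Longrightarrow> eval_bexp r a b \<Longrightarrow> exec c r a s r' a' \<Longrightarrow> exec (While b c) r' a' t r'' a'' \<Longrightarrow>
    exec (While b c) r a (bexp_size b + 2 + s + t) r'' a''"
| while2: "ok_bexp r a b \<Longrightarrow> \<not> eval_bexp r a b \<Longrightarrow> exec (While b c) r a (bexp_size b + 2) r a"

lemma exec_fr: "exec c r a t r' a' \<Longrightarrow> frame c r a r' a'"
  by (induction rule: exec.induct) (auto simp: frame_def)

definition represents :: "regs \<Rightarrow> arrs \<Rightarrow> regs \<Rightarrow> nat list \<Rightarrow> bool" where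
  "represents r a R M \<longleftrightarrow> (\<forall>v<64. R v = r v) \<and> r 0 = n \<and> length M = 192 * n \<and>
     (\<forall>k<24. \<forall>i<8 * n. M ! (8 * k * n + i) = a k i)"

lemma eval_bop:
  assumes "eval_op f x y < 2 ^ w" "f = Sub \<longrightarrow> y \<le> x"
  shows "eval_binop w f x y = eval_op f x y"
proof (cases f)
  case Sub
  then have "2 ^ w + x - y = (x - y) + 2 ^ w" using assms by simp
  moreover have "x - y < 2 ^ w" using assms Sub by simp
  ultimately have "(2 ^ w + x - y) mod 2 ^ w = x - y" by (metis mod_add_self2 mod_less)
  then show ?thesis using Sub by (simp add: take_bit_eq_mod)
qed (use assms in \<open>auto simp: take_bit_eq_mod\<close>)

lemma const_small:
  fixes k :: nat
  assumes "k \<le> 192"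
  shows "k < 2 ^ w"
proof -
  have "192 * 2 \<le> (2::nat) ^ w" using n2 big by linarith
  then have "192 < (2::nat) ^ w" by linarith
  then show ?thesis using assms by (rule le_less_trans[rotated])
qed

lemma addr_less:
  assumes "k < 24" "i < 8 * n"
  shows "8 * k * n + i < 192 * n"
proof -
  have "k * n \<le> 23 * n" using assms by (intro mult_right_mono) auto
  then show ?thesis using assms by linarith
qed

text \<open>Evaluation at stack height \<open>t\<close> leaves the registers below \<open>t\<close>
  alone. Hence a left operand survives the evaluation of the right one, and the variables below 64
  keep representing the state.\<close>

lemma exp_correct:
  assumes "code_at P p (compile_exp e t)" "represents r a R M" "wf_exp e" "ok r a e" "64 \<le> t"
  shows "\<exists>R'. steps w P (p, R, M) (exp_size e) (p + exp_size e, R', M) \<and> R' t = eval_exp r a e \<and>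
    (\<forall>v<t. R' v = R v)"
  using assms
proof (induction e arbitrary: p t R)
  case (Cnst k)
  have "steps w P (p, R, M) 1 (p + 1, R(t := k), M)"
    using Cnst by (intro steps_1) (auto simp: take_bit_eq_mod)
  then show ?case by (intro exI[of _ "R(t := k)"]) (simp add: fun_upd_def)
next
  case (Var v)
  then have v: "R v = r v" by (simp add: represents_def)
  have "steps w P (p, R, M) 1 (p + 1, R(t := r v), M)"
    using Var v by (intro steps_1) auto
  then show ?case by (intro exI[of _ "R(t := r v)"]) (simp add: fun_upd_def)
next
  case (Bin f d e)
  from Bin.IH(1)[of p t R] Bin.prems obtain R1 where
    1: "steps w P (p, R, M) (exp_size d) (p + exp_size d, R1, M)" "R1 t = eval_exp r a d" "\<forall>v<t. R1 v = R v"
    by auto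
  have "represents r a R1 M" using Bin.prems 1 by (auto simp: represents_def)
  with Bin.IH(2)[of "p + exp_size d" "t + 1" R1] Bin.prems obtain R2 where
    2: "steps w P (p + exp_size d, R1, M) (exp_size e) (p + exp_size d + exp_size e, R2, M)"
      "R2 (t + 1) = eval_exp r a e" "\<forall>v<t+1. R2 v = R1 v"
    by auto
  let ?R = "R2(t := eval_op f (eval_exp r a d) (eval_exp r a e))"
  have "steps w P (p + exp_size d + exp_size e, R2, M) 1 (p + exp_size d + exp_size e + 1, ?R, M)"
    using Bin.prems 1 2 eval_bop[of f "eval_exp r a d" "eval_exp r a e"]
    by (intro steps_1) (auto simp: add.assoc)
  from steps_trans[OF steps_trans[OF 1(1) 2(1)] this]
  show ?case using 1 2 by (intro exI[of _ ?R]) (simp add: add.assoc fun_upd_def)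
next
  case (Arr k e)
  from Arr.IH[of p t R] Arr.prems obtain R1 where
    1: "steps w P (p, R, M) (exp_size e) (p + exp_size e, R1, M)" "R1 t = eval_exp r a e" "\<forall>v<t. R1 v = R v"
    by auto
  let ?R2 = "R1(t+1 := 8 * k)"
  let ?R3 = "?R2(t+1 := 8 * k * n)"
  let ?R4 = "?R3(t := 8 * k * n + eval_exp r a e)"
  let ?R5 = "?R4(t := a k (eval_exp r a e))"
  have k: "k < 24" and e: "eval_exp r a e < 8 * n" and R0: "R 0 = n" and t0: "0 < t"
    using Arr.prems by (auto simp: represents_def)
  note ad = addr_less[OF k e]
  have c: "8 * k < 2 ^ w" using const_small[of "8 * k"] k by simp
  have 2: "steps w P (p + exp_size e, R1, M) k4 (p + exp_size e + 4, ?R5, M)"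
    if "k4 = Suc (Suc (Suc (Suc 0)))" for k4
    unfolding that
    apply (rule steps_Suc[where c' = "(p + exp_size e + 1, ?R2, M)"])
    using Arr.prems c apply (simp, simp add: take_bit_eq_mod)
    apply (rule steps_Suc[where c' = "(p + exp_size e + 2, ?R3, M)"])
    using Arr.prems ad big R0 1(3) t0 apply (simp, simp add: take_bit_eq_mod)
    apply (rule steps_Suc[where c' = "(p + exp_size e + 3, ?R4, M)"])
    using Arr.prems ad big 1(2) apply (simp, simp add: take_bit_eq_mod)
    apply (subst add.commute, simp)
    apply (rule steps_Suc[where c' = "(p + exp_size e + 4, ?R5, M)"])
    using Arr.prems ad apply (simp add: numeral_3_eq_3, simp add: represents_def numeral_3_eq_3)
    apply (rule steps_0)
    done
  have "steps w P (p + exp_size e, R1, M) 4 (p + exp_size e + 4, ?R5, M)" by (rule 2) simp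
  from steps_trans[OF 1(1) this]
  show ?case using 1 by (intro exI[of _ ?R5]) (simp add: add.assoc fun_upd_def)
qed

lemma test_correct:
  assumes "code_at P p (compile_test b l)" "represents r a R M" "wf_bexp b" "ok_bexp r a b"
  shows "\<exists>R'. steps w P (p, R, M) (bexp_size b + 1) (if eval_bexp r a b then l else p + bexp_size b + 1, R', M) \<and>
    represents r a R' M"
proof -
  obtain d e where b: "b = Lt d e \<or> b = Equ d e" by (cases b) auto
  have c: "code_at P p (compile_exp d 64)" "code_at P (p + exp_size d) (compile_exp e 65)"
    "wf_exp d" "wf_exp e" "ok r a d" "ok r a e"
    using assms b by auto
  from exp_correct[OF c(1) assms(2) c(3,5)] obtain R1 where
    1: "steps w P (p, R, M) (exp_size d) (p + exp_size d, R1, M)" "R1 64 = eval_exp r a d" "\<forall>v<64. R1 v = R v"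
    by auto
  have "represents r a R1 M" using assms 1 by (auto simp: represents_def)
  from exp_correct[OF c(2) this c(4,6)] obtain R2 where
    2: "steps w P (p + exp_size d, R1, M) (exp_size e) (p + exp_size d + exp_size e, R2, M)"
      "R2 65 = eval_exp r a e" "\<forall>v<65. R2 v = R1 v"
    by auto
  have "steps w P (p + exp_size d + exp_size e, R2, M) 1
    (if eval_bexp r a b then l else p + exp_size d + exp_size e + 1, R2, M)"
    using assms(1) b 1 2 by (intro steps_1) auto
  from steps_trans[OF steps_trans[OF 1(1) 2(1)] this]
  show ?thesis using b 1 2 assms(2) by (intro exI[of _ R2]) (auto simp: represents_def add.assoc)
qed

lemma rel_put:
  assumes "represents r a R M" "k < 24" "i < 8 * n"
  shows "represents r (a(k := (a k)(i := x))) R (M[8 * k * n + i := x])"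
proof -
  have "M[8 * k * n + i := x] ! (8 * k' * n + i') = (a(k := (a k)(i := x))) k' i'"
    if "k' < 24" "i' < 8 * n" for k' i'
  proof (cases "k = k' \<and> i = i'")
    case True
    then show ?thesis using addr_less[OF assms(2,3)] assms by (simp add: represents_def)
  next
    case False
    have "8 * k * n + i \<noteq> 8 * k' * n + i'"
    proof
      assume eq: "8 * k * n + i = 8 * k' * n + i'"
      \<comment> \<open>Division by \<open>8 * n\<close> recovers the array from an address, so
        different arrays never share a cell.\<close>
      have "(8 * k * n + i) div (8 * n) = k" "(8 * k' * n + i') div (8 * n) = k'"
        using assms that n2 by (simp_all add: div_add1_eq mult.commute mult.left_commute)
      then have "k = k'" using eq by simp
      then show False using eq False by simp
    qed
    then show ?thesis using False that assms by (auto simp: represents_def)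
  qed
  then show ?thesis using assms by (simp add: represents_def)
qed

text \<open>The step count is only an upper bound: \<open>exec\<close> charges both branches of a
  conditional for the jump over the then branch, which only the else branch executes.\<close>

lemma comp_correct:
  assumes "exec c r a t r' a'" "code_at P p (compile c p)" "represents r a R M" "wf_com c"
  shows "\<exists>R' M' t'. t' \<le> t \<and> steps w P (p, R, M) t' (p + com_size c, R', M') \<and> represents r' a' R' M'"
  using assms
proof (induction arbitrary: p R M rule: exec.induct)
  case (skip r a)
  then show ?case by force
next
  case (assign r a e v)
  from assign exp_correct[of P p e 64 r a R M] obtain R1 where
    1: "steps w P (p, R, M) (exp_size e) (p + exp_size e, R1, M)" "R1 64 = eval_exp r a e" "\<forall>v<64. R1 v = R v"
    by auto
  have "steps w P (p + exp_size e, R1, M) 1 (p + exp_size e + 1, R1(v := eval_exp r a e), M)"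
    using assign 1 by (intro steps_1) auto
  from steps_trans[OF 1(1) this] have s: "steps w P (p, R, M) (exp_size e + 1) (p + com_size (Assign v e), R1(v := eval_exp r a e), M)"
    by simp
  have "represents (r(v := eval_exp r a e)) a (R1(v := eval_exp r a e)) M"
    using assign.prems 1 by (auto simp: represents_def)
  with s show ?case by blast
next
  case (put r a d e k)
  from put exp_correct[of P p d 64 r a R M] obtain R1 where
    1: "steps w P (p, R, M) (exp_size d) (p + exp_size d, R1, M)" "R1 64 = eval_exp r a d" "\<forall>v<64. R1 v = R v"
    by auto
  let ?R2 = "R1(65 := 8 * k)"
  let ?R3 = "?R2(65 := 8 * k * n)"
  let ?R4 = "?R3(64 := 8 * k * n + eval_exp r a d)"
  have k: "k < 24" and R0: "R1 0 = n"
    using put.prems 1 by (auto simp: represents_def)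
  note ad = addr_less[OF k put.hyps(3)]
  have c: "8 * k < 2 ^ w" using const_small[of "8 * k"] k by simp
  have 2: "steps w P (p + exp_size d, R1, M) k3 (p + exp_size d + 3, ?R4, M)"
    if "k3 = Suc (Suc (Suc 0))" for k3
    unfolding that
    apply (rule steps_Suc[where c' = "(p + exp_size d + 1, ?R2, M)"])
    using put.prems c apply (simp, simp add: take_bit_eq_mod)
    apply (rule steps_Suc[where c' = "(p + exp_size d + 2, ?R3, M)"])
    using put.prems ad big R0 apply (simp, simp add: take_bit_eq_mod)
    apply (rule steps_Suc[where c' = "(p + exp_size d + 3, ?R4, M)"])
    using put.prems ad big 1(2) apply (simp, simp add: take_bit_eq_mod)
    apply (subst add.commute, simp)
    apply (rule steps_0)
    done
  have 2: "steps w P (p + exp_size d, R1, M) 3 (p + exp_size d + 3, ?R4, M)" by (rule 2) simp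
  have "represents r a ?R4 M" using put.prems 1 by (auto simp: represents_def)
  from exp_correct[OF _ this, of P "p + exp_size d + 3" e 65] put obtain R5 where
    3: "steps w P (p + exp_size d + 3, ?R4, M) (exp_size e) (p + exp_size d + 3 + exp_size e, R5, M)"
       "R5 65 = eval_exp r a e" "\<forall>v<65. R5 v = ?R4 v"
    by (auto simp: add.assoc numeral_eq_Suc)
  let ?M = "M[8 * k * n + eval_exp r a d := eval_exp r a e]"
  have l: "length M = 192 * n" using put.prems by (simp add: represents_def)
  have "steps w P (p + exp_size d + 3 + exp_size e, R5, M) 1 (p + exp_size d + 3 + exp_size e + 1, R5, ?M)"
    using put.prems 3 ad l by (intro steps_1) (auto simp: add_ac numeral_eq_Suc)
  from steps_trans[OF steps_trans[OF steps_trans[OF 1(1) 2] 3(1)] this]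
  have s: "steps w P (p, R, M) (exp_size d + exp_size e + 4) (p + com_size (Put k d e), R5, ?M)"
    by (simp add: add_ac)
  have "represents r a R5 M" using put.prems 1 3 by (auto simp: represents_def)
  from rel_put[OF this k put.hyps(3)] s show ?case by blast
next
  case (seq c r a s r' a' d t r'' a'')
  from seq.IH(1)[of p R M] seq.prems obtain R1 M1 t1 where
    1: "t1 \<le> s" "steps w P (p, R, M) t1 (p + com_size c, R1, M1)" "represents r' a' R1 M1" by auto
  from seq.IH(2)[of "p + com_size c" R1 M1] seq.prems 1 obtain R2 M2 t2 where
    2: "t2 \<le> t" "steps w P (p + com_size c, R1, M1) t2 (p + com_size c + com_size d, R2, M2)" "represents r'' a'' R2 M2"
    by auto
  show ?case using steps_trans[OF 1(2) 2(2)] 1 2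
    by (intro exI[of _ R2] exI[of _ M2] exI[of _ "t1 + t2"]) (auto simp: add.assoc)
next
  case (cond1 r a b c t r' a' d)
  from test_correct[of P p b "p + bexp_size b + com_size d + 2" r a R M] cond1 obtain R1 where
    1: "steps w P (p, R, M) (bexp_size b + 1) (p + bexp_size b + com_size d + 2, R1, M)" "represents r a R1 M"
    by auto
  from cond1.IH[of "p + bexp_size b + com_size d + 2" R1 M] cond1.prems 1 obtain R2 M2 t2 where
    2: "t2 \<le> t" "steps w P (p + bexp_size b + com_size d + 2, R1, M) t2 (p + bexp_size b + com_size d + 2 + com_size c, R2, M2)"
      "represents r' a' R2 M2" by (auto simp: add_ac)
  show ?case using steps_trans[OF 1(1) 2(2)] 2
    by (intro exI[of _ R2] exI[of _ M2] exI[of _ "bexp_size b + 1 + t2"]) (auto simp: add_ac)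
next
  case (cond2 r a b d t r' a' c)
  from test_correct[of P p b "p + bexp_size b + com_size d + 2" r a R M] cond2 obtain R1 where
    1: "steps w P (p, R, M) (bexp_size b + 1) (p + bexp_size b + 1, R1, M)" "represents r a R1 M"
    by auto
  from cond2.IH[of "p + bexp_size b + 1" R1 M] cond2.prems 1 obtain R2 M2 t2 where
    2: "t2 \<le> t" "steps w P (p + bexp_size b + 1, R1, M) t2 (p + bexp_size b + 1 + com_size d, R2, M2)"
      "represents r' a' R2 M2" by (auto simp: add_ac)
  have "steps w P (p + bexp_size b + 1 + com_size d, R2, M2) 1 (p + bexp_size b + com_size d + com_size c + 2, R2, M2)"
    using cond2.prems by (intro steps_1) (auto simp: add_ac)
  from steps_trans[OF steps_trans[OF 1(1) 2(2)] this] 2 show ?case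
    by (intro exI[of _ R2] exI[of _ M2] exI[of _ "bexp_size b + 1 + t2 + 1"]) (auto simp: add_ac)
next
  case (while1 r a b c s r' a' t r'' a'')
  from test_correct[of P p b "p + bexp_size b + 2" r a R M] while1 obtain R1 where
    1: "steps w P (p, R, M) (bexp_size b + 1) (p + bexp_size b + 2, R1, M)" "represents r a R1 M"
    by auto
  from while1.IH(1)[of "p + bexp_size b + 2" R1 M] while1.prems 1 obtain R2 M2 t2 where
    2: "t2 \<le> s" "steps w P (p + bexp_size b + 2, R1, M) t2 (p + bexp_size b + 2 + com_size c, R2, M2)"
      "represents r' a' R2 M2" by (auto simp: add_ac)
  have 3: "steps w P (p + bexp_size b + 2 + com_size c, R2, M2) 1 (p, R2, M2)"
    using while1.prems by (intro steps_1) (auto simp: add_ac)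
  from while1.IH(2)[of p R2 M2] while1.prems 2 obtain R3 M3 t3 where
    4: "t3 \<le> t" "steps w P (p, R2, M2) t3 (p + com_size (While b c), R3, M3)" "represents r'' a'' R3 M3"
    by auto
  from steps_trans[OF steps_trans[OF steps_trans[OF 1(1) 2(2)] 3] 4(2)] 2 4 show ?case
    by (intro exI[of _ R3] exI[of _ M3] exI[of _ "bexp_size b + 1 + t2 + 1 + t3"]) (auto simp: add_ac)
next
  case (while2 r a b c)
  from test_correct[of P p b "p + bexp_size b + 2" r a R M] while2 obtain R1 where
    1: "steps w P (p, R, M) (bexp_size b + 1) (p + bexp_size b + 1, R1, M)" "represents r a R1 M"
    by auto
  have "steps w P (p + bexp_size b + 1, R1, M) 1 (p + bexp_size b + com_size c + 3, R1, M)"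
    using while2.prems by (intro steps_1) (auto simp: add_ac)
  from steps_trans[OF 1(1) this] 1 show ?case
    by (intro exI[of _ R1] exI[of _ M] exI[of _ "bexp_size b + 1 + 1"]) (auto simp: add_ac)
qed

section \<open>A logic for total correctness with time bounds\<close>

definition run :: "com \<Rightarrow> regs \<Rightarrow> arrs \<Rightarrow> nat \<Rightarrow> (regs \<Rightarrow> arrs \<Rightarrow> bool) \<Rightarrow> bool" where
  "run c r a t Q \<longleftrightarrow> (\<exists>t' r' a'. t' \<le> t \<and> exec c r a t' r' a' \<and> Q r' a')"

lemma run_mono:
  assumes "run c r a s Q" "s \<le> t" "\<And>r' a'. frame c r a r' a' \<Longrightarrow> Q r' a' \<Longrightarrow> Q' r' a'"
  shows "run c r a t Q'"
  using assms exec_fr unfolding run_def by (meson order_trans)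

lemma run_seq:
  assumes "run c r a s P" "\<And>r' a'. frame c r a r' a' \<Longrightarrow> P r' a' \<Longrightarrow> run d r' a' t Q" "s + t \<le> u"
  shows "run (c ;; d) r a u Q"
proof -
  obtain s' r' a' where 1: "s' \<le> s" "exec c r a s' r' a'" "P r' a'" using assms(1) by (auto simp: run_def)
  then obtain t' r'' a'' where 2: "t' \<le> t" "exec d r' a' t' r'' a''" "Q r'' a''"
    using assms(2)[OF exec_fr[OF 1(2)] 1(3)] by (auto simp: run_def)
  have "s' + t' \<le> u" using 1 2 assms(3) by linarith
  then show ?thesis using exec.seq[OF 1(2) 2(2)] 2(3) unfolding run_def by blast
qed

lemma run_cond:
  assumes "ok_bexp r a b" "eval_bexp r a b \<Longrightarrow> run c r a t Q" "\<not> eval_bexp r a b \<Longrightarrow> run d r a t Q"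
    "bexp_size b + 2 + t \<le> u"
  shows "run (Cond b c d) r a u Q"
proof (cases "eval_bexp r a b")
  case True
  then obtain t' r' a' where 1: "t' \<le> t" "exec c r a t' r' a'" "Q r' a'"
    using assms(2) by (auto simp: run_def)
  have "bexp_size b + 2 + t' \<le> u" using 1 assms(4) by linarith
  then show ?thesis using exec.cond1[OF assms(1) True 1(2)] 1(3) unfolding run_def by blast
next
  case False
  then obtain t' r' a' where 1: "t' \<le> t" "exec d r a t' r' a'" "Q r' a'"
    using assms(3) by (auto simp: run_def)
  have "bexp_size b + 2 + t' \<le> u" using 1 assms(4) by linarith
  then show ?thesis using exec.cond2[OF assms(1) False 1(2)] 1(3) unfolding run_def by blast
qed

text \<open>Only loop-free code is covered. A loop gets the precondition \<open>False\<close>, which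
  forces it through \<open>run_while\<close> or \<open>run_For\<close>.\<close>

fun wp :: "com \<Rightarrow> (regs \<Rightarrow> arrs \<Rightarrow> bool) \<Rightarrow> regs \<Rightarrow> arrs \<Rightarrow> bool" where
  "wp Skip Q r a \<longleftrightarrow> Q r a"
| "wp (Assign v e) Q r a \<longleftrightarrow> ok r a e \<and> Q (r(v := eval_exp r a e)) a"
| "wp (Put k d e) Q r a \<longleftrightarrow> ok r a d \<and> ok r a e \<and> eval_exp r a d < 8 * n \<and>
     Q r (a(k := (a k)(eval_exp r a d := eval_exp r a e)))"
| "wp (c ;; d) Q r a \<longleftrightarrow> wp c (wp d Q) r a"
| "wp (Cond b c d) Q r a \<longleftrightarrow> ok_bexp r a b \<and> (if eval_bexp r a b then wp c Q r a else wp d Q r a)"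
| "wp (While b c) Q r a \<longleftrightarrow> False"

text \<open>Loop-free code executes each of its instructions at most once, so its size bounds its
  time.\<close>

lemma run_wp_csz: "wp c Q r a \<Longrightarrow> run c r a (com_size c) Q"
proof (induction c arbitrary: Q r a)
  case Skip then show ?case using exec.skip by (fastforce simp: run_def)
next
  case (Assign v e) then show ?case using exec.assign[of r a e v] by (fastforce simp: run_def)
next
  case (Put k d e) then show ?case using exec.put[of r a d e k] by (fastforce simp: run_def)
next
  case (Seq c d)
  then show ?case by (intro run_seq[where P = "wp d Q"]) auto
next
  case (Cond b c d)
  show ?case
  proof (rule run_cond[where t = "com_size c + com_size d"])
    show "run c r a (com_size c + com_size d) Q" if "eval_bexp r a b"
      using Cond that by (intro run_mono[OF Cond.IH(1)]) auto
    show "run d r a (com_size c + com_size d) Q" if "\<not> eval_bexp r a b"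
      using Cond that by (intro run_mono[OF Cond.IH(2)]) auto
  qed (use Cond in auto)
qed auto

lemma run_wp:
  assumes "wp c Q r a" "com_size c \<le> t"
  shows "run c r a t Q"
  using run_mono[OF run_wp_csz[OF assms(1)] assms(2)] by blast

lemma fr_refl: "frame c r a r a"
  by (simp add: frame_def)

lemma fr_trans: "frame c r a r' a' \<Longrightarrow> frame c r' a' r'' a'' \<Longrightarrow> frame c r a r'' a''"
  by (simp add: frame_def)

text \<open>Amortised analysis: a round may take any time \<open>s\<close>, depending on the state,
  as long as \<open>s\<close> and the cost of the test are paid by a drop of the potential. The
  potential is real-valued to allow logarithmic rates later.\<close>

lemma run_while:
  fixes \<Psi> :: "regs \<Rightarrow> arrs \<Rightarrow> real"
  assumes I: "I r a"
    and step: "\<And>r' a'. frame c r a r' a' \<Longrightarrow> I r' a' \<Longrightarrow> ok_bexp r' a' b \<and> 0 \<le> \<Psi> r' a' \<and>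
      (eval_bexp r' a' b \<longrightarrow> (\<exists>s. run c r' a' s
         (\<lambda>r'' a''. I r'' a'' \<and> \<Psi> r'' a'' + real (s + bexp_size b + 2) \<le> \<Psi> r' a')))"
    and Q: "\<And>r' a'. frame c r a r' a' \<Longrightarrow> I r' a' \<Longrightarrow> \<not> eval_bexp r' a' b \<Longrightarrow> Q r' a'"
    and t: "\<Psi> r a + real (bexp_size b + 2) \<le> real t"
  shows "run (While b c) r a t Q"
proof -
  have "\<exists>t' r'' a''. exec (While b c) r' a' t' r'' a'' \<and> Q r'' a'' \<and> real t' \<le> \<Psi> r' a' + real (bexp_size b + 2)"
    if "frame c r a r' a'" "I r' a'" "\<Psi> r' a' \<le> real k" for r' a' k
    using that
  proof (induction k arbitrary: r' a' rule: less_induct)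
    case (less k)
    note s = step[OF less.prems(1,2)]
    show ?case
    proof (cases "eval_bexp r' a' b")
      case False
      then show ?thesis using exec.while2[of r' a' b c] s Q[OF less.prems(1,2)] by fastforce
    next
      case True
      then obtain s1 where "run c r' a' s1
         (\<lambda>r'' a''. I r'' a'' \<and> \<Psi> r'' a'' + real (s1 + bexp_size b + 2) \<le> \<Psi> r' a')" using s by blast
      then obtain t1 r1 a1 where 1: "t1 \<le> s1" "exec c r' a' t1 r1 a1" "I r1 a1"
        "\<Psi> r1 a1 + real (s1 + bexp_size b + 2) \<le> \<Psi> r' a'" by (auto simp: run_def)
      have f: "frame c r a r1 a1" using less.prems(1) exec_fr[OF 1(2)] fr_trans by blast
      have "0 \<le> \<Psi> r1 a1" using step[OF f 1(3)] by blast
      \<comment> \<open>A round costs at least \<open>2\<close>, so the potential, being nonnegative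
        after the round, was at least \<open>2\<close> before it. This makes the induction on a
        natural number bounding the potential well-founded.\<close>
      then have k: "k \<ge> 2" "\<Psi> r1 a1 \<le> real (k - 2)" using 1(4) less.prems(3) by linarith+
      then obtain t2 r2 a2 where 2: "exec (While b c) r1 a1 t2 r2 a2" "Q r2 a2"
        "real t2 \<le> \<Psi> r1 a1 + real (bexp_size b + 2)"
        using less.IH[of "k - 2" r1 a1] f 1(3) by auto
      show ?thesis using exec.while1[OF conjunct1[OF s] True 1(2) 2(1)] 2 1(1,4) by fastforce
    qed
  qed
  from this[OF fr_refl I] obtain t' r'' a'' where "exec (While b c) r a t' r'' a''" "Q r'' a''"
    "real t' \<le> \<Psi> r a + real (bexp_size b + 2)"
    by (metis real_arch_simple)
  then show ?thesis using t unfolding run_def by (metis of_nat_le_iff order_trans)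
qed

end

definition For :: "nat \<Rightarrow> exp \<Rightarrow> com \<Rightarrow> com" where
  "For v e c = While (Lt (Var v) e) (c ;; Assign v (Bin Add (Var v) (Cnst 1)))"

lemma wv_For [simp]: "written_vars (For v e c) = insert v (written_vars c)"
  by (auto simp: For_def)

lemma wa_For [simp]: "written_arrs (For v e c) = written_arrs c"
  by (auto simp: For_def)

context wram
begin

text \<open>Besides the body a round costs \<open>4\<close> for the increment and
  \<open>exp_size e + 3\<close> for the test; the final failing test costs
  \<open>exp_size e + 3\<close> once more.\<close>

lemma run_For:
  assumes I: "I (r v) r a" and le: "r v \<le> hi" and v: "v \<notin> written_vars c" and hi: "hi < 2 ^ w"
    and step: "\<And>i r' a'. frame (For v e c) r a r' a' \<Longrightarrow> r v \<le> i \<Longrightarrow> i \<le> hi \<Longrightarrow> r' v = i \<Longrightarrow> I i r' a' \<Longrightarrow>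
      ok r' a' e \<and> eval_exp r' a' e = hi \<and>
      (i < hi \<longrightarrow> run c r' a' s (\<lambda>r'' a''. I (Suc i) (r''(v := Suc i)) a''))"
    and Q: "\<And>r' a'. frame (For v e c) r a r' a' \<Longrightarrow> I hi r' a' \<Longrightarrow> r' v = hi \<Longrightarrow> Q r' a'"
    and t: "(hi - r v) * (s + exp_size e + 7) + exp_size e + 3 \<le> t"
  shows "run (For v e c) r a t Q"
  unfolding For_def
proof (rule run_while[where I = "\<lambda>r' a'. r v \<le> r' v \<and> r' v \<le> hi \<and> I (r' v) r' a'"
        and \<Psi> = "\<lambda>r' a'. real ((hi - r' v) * (s + exp_size e + 7))"])
  show "r v \<le> r v \<and> r v \<le> hi \<and> I (r v) r a" using I le by simp
next
  fix r' a' assume f: "frame (c ;; Assign v (Bin Add (Var v) (Cnst 1))) r a r' a'"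
    and J: "r v \<le> r' v \<and> r' v \<le> hi \<and> I (r' v) r' a'"
  then have f: "frame (For v e c) r a r' a'" by (auto simp: frame_def)
  from step[OF f _ _ refl] J have s: "ok r' a' e" "eval_exp r' a' e = hi"
      "r' v < hi \<Longrightarrow> run c r' a' s (\<lambda>r'' a''. I (Suc (r' v)) (r''(v := Suc (r' v))) a'')" by auto
  let ?P = "\<lambda>r'' a''. (r v \<le> r'' v \<and> r'' v \<le> hi \<and> I (r'' v) r'' a'') \<and>
      real ((hi - r'' v) * (s + exp_size e + 7)) + real (s + 4 + bexp_size (Lt (Var v) e) + 2)
        \<le> real ((hi - r' v) * (s + exp_size e + 7))"
  have "run (c ;; Assign v (Bin Add (Var v) (Cnst 1))) r' a' (s + 4) ?P" if l: "r' v < hi"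
  proof (rule run_seq[OF s(3)[OF l]])
    fix r1 a1 assume f1: "frame c r' a' r1 a1" and I1: "I (Suc (r' v)) (r1(v := Suc (r' v))) a1"
    have r1: "r1 v = r' v" using f1 v by (simp add: frame_def)
    have *: "hi - r' v = Suc (hi - Suc (r' v))" using l by simp
    show "run (Assign v (Bin Add (Var v) (Cnst 1))) r1 a1 4 ?P"
      using l J I1 r1 hi const_small[of 1]
      by (intro run_wp) (auto simp: *)
  qed simp
  then show "ok_bexp r' a' (Lt (Var v) e) \<and> 0 \<le> real ((hi - r' v) * (s + exp_size e + 7)) \<and>
    (eval_bexp r' a' (Lt (Var v) e) \<longrightarrow>
       (\<exists>sa. run (c ;; Assign v (Bin Add (Var v) (Cnst 1))) r' a' sa
         (\<lambda>r'' a''. (r v \<le> r'' v \<and> r'' v \<le> hi \<and> I (r'' v) r'' a'') \<and>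
      real ((hi - r'' v) * (s + exp_size e + 7)) + real (sa + bexp_size (Lt (Var v) e) + 2)
        \<le> real ((hi - r' v) * (s + exp_size e + 7)))))"
    using s(1,2) by (auto intro!: exI[of _ "s + 4"])
next
  fix r' a' assume f: "frame (c ;; Assign v (Bin Add (Var v) (Cnst 1))) r a r' a'"
    and J: "r v \<le> r' v \<and> r' v \<le> hi \<and> I (r' v) r' a'" and nb: "\<not> eval_bexp r' a' (Lt (Var v) e)"
  then have f: "frame (For v e c) r a r' a'" by (auto simp: frame_def)
  from step[OF f _ _ refl] J have "eval_exp r' a' e = hi" by auto
  then have "r' v = hi" using nb J by simp
  then show "Q r' a'" using Q[OF f] J by simp
next
  show "real ((hi - r v) * (s + exp_size e + 7)) + real (bexp_size (Lt (Var v) e) + 2) \<le> real t"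
    using t by (simp flip: of_nat_add of_nat_mult)
qed

end

section \<open>Refining ranks by bucket sort\<close>

text \<open>Ranks with gaps: a class of \<open>c\<close> equal elements uses one value and leaves
  the next \<open>c - 1\<close> values free. Refining a class stays inside its gap, and a rank is at
  the same time the start of the bucket of its class in sorted order, so bucket sort needs no prefix
  sums.\<close>

definition sparse_rank :: "nat \<Rightarrow> (nat \<Rightarrow> nat) \<Rightarrow> bool" where
  "sparse_rank n f \<longleftrightarrow> (\<forall>i<n. f i = card {j. j < n \<and> f j < f i})"

definition refine_rank :: "nat \<Rightarrow> (nat \<Rightarrow> nat) \<Rightarrow> (nat \<Rightarrow> nat) \<Rightarrow> nat \<Rightarrow> nat" where
  "refine_rank n f g i = f i + card {j. j < n \<and> f j = f i \<and> g j < g i}"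

text \<open>Wrapping modulo \<open>n\<close> makes the shift a permutation of the positions; cutting
  off at the end would not preserve \<open>sparse_rank\<close>.\<close>

definition shift :: "nat \<Rightarrow> nat \<Rightarrow> (nat \<Rightarrow> nat) \<Rightarrow> nat \<Rightarrow> nat" where
  "shift n d f i = f ((i + d) mod n)"

lemma card_psubset_less:
  fixes S T :: "nat set"
  assumes "S \<subseteq> T" "x \<in> T" "x \<notin> S" "finite T"
  shows "card S < card T"
  using assms by (intro psubset_card_mono) auto

lemma rk_less:
  assumes "sparse_rank n f" "i < n"
  shows "f i < n"
proof -
  have "card {j. j < n \<and> f j < f i} < card {..<n}"
    using assms by (intro card_psubset_less[where x = i]) auto
  then show ?thesis using assms by (simp add: sparse_rank_def)
qed

lemma shift_bij:
  assumes "0 < (n::nat)"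
  shows "inj_on (\<lambda>j. (j + d) mod n) {..<n}" "(\<lambda>j. (j + d) mod n) ` {..<n} = {..<n}"
proof -
  have *: "i = j" if "(i + d) mod n = (j + d) mod n" "j \<le> i" "i < n" for i j
  proof -
    have "n dvd (i + d) - (j + d)" using that mod_eq_dvd_iff_nat[of "j + d" "i + d" n] by simp
    then have "n dvd i - j" by simp
    then show ?thesis using that by (metis diff_is_0_eq dvd_imp_le le_antisym less_imp_diff_less
          linorder_not_le neq0_conv)
  qed
  show i: "inj_on (\<lambda>j. (j + d) mod n) {..<n}"
    unfolding inj_on_def using * by (metis lessThan_iff nle_le)
  show "(\<lambda>j. (j + d) mod n) ` {..<n} = {..<n}"
    by (intro endo_inj_surj i) (use assms in auto)
qed

text \<open>The shift permutes the positions, and counting smaller elements is invariant under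
  permutations.\<close>

lemma rk_sh:
  assumes "sparse_rank n f" "0 < n"
  shows "sparse_rank n (shift n d f)"
  unfolding sparse_rank_def
proof (intro allI impI)
  fix i assume "i < n"
  let ?h = "\<lambda>j. (j + d) mod n"
  have "bij_betw ?h {j. j < n \<and> shift n d f j < shift n d f i} {j. j < n \<and> f j < f (?h i)}"
    unfolding bij_betw_def
  proof
    show "inj_on ?h {j. j < n \<and> shift n d f j < shift n d f i}"
      by (rule inj_on_subset[OF shift_bij(1)[OF assms(2)]]) auto
    show "?h ` {j. j < n \<and> shift n d f j < shift n d f i} = {j. j < n \<and> f j < f (?h i)}"
    proof (intro equalityI subsetI)
      fix y assume y: "y \<in> {j. j < n \<and> f j < f (?h i)}"
      then have "y \<in> ?h ` {..<n}" using shift_bij(2)[OF assms(2)] by simp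
      then obtain j where "j < n" "y = ?h j" by auto
      then show "y \<in> ?h ` {j. j < n \<and> shift n d f j < shift n d f i}" using y by (auto simp: shift_def)
    qed (use assms(2) in \<open>auto simp: shift_def\<close>)
  qed
  then have "card {j. j < n \<and> shift n d f j < shift n d f i} = card {j. j < n \<and> f j < f (?h i)}"
    by (rule bij_betw_same_card)
  also have "\<dots> = f (?h i)" using assms by (simp add: sparse_rank_def)
  finally show "shift n d f i = card {j. j < n \<and> shift n d f j < shift n d f i}" by (simp add: shift_def)
qed

text \<open>Everything counted by the rank of \<open>i\<close>, together with the whole class of
  \<open>i\<close>, is counted by the rank of \<open>j\<close>.\<close>

lemma rk_gap:
  assumes "sparse_rank n f" "i < n" "j < n" "f i < f j"
  shows "f i + card {k. k < n \<and> f k = f i} \<le> f j"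
proof -
  have "card ({k. k < n \<and> f k < f i} \<union> {k. k < n \<and> f k = f i}) \<le> card {k. k < n \<and> f k < f j}"
    using assms by (intro card_mono) auto
  moreover have "card ({k. k < n \<and> f k < f i} \<union> {k. k < n \<and> f k = f i}) =
     card {k. k < n \<and> f k < f i} + card {k. k < n \<and> f k = f i}"
    by (intro card_Un_disjoint) auto
  ultimately show ?thesis using assms by (simp add: sparse_rank_def)
qed

lemma pr_le_gap:
  assumes "i < n"
  shows "refine_rank n f g i < f i + card {k. k < n \<and> f k = f i}"
proof -
  have "card {j. j < n \<and> f j = f i \<and> g j < g i} < card {k. k < n \<and> f k = f i}"
    using assms by (intro card_psubset_less[where x = i]) auto
  then show ?thesis by (simp add: refine_rank_def)
qed

lemma pr_less1:
  assumes "sparse_rank n f" "i < n" "j < n" "f i < f j"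
  shows "refine_rank n f g i < refine_rank n f g j"
  using rk_gap[OF assms] pr_le_gap[OF assms(2), of f g] by (simp add: refine_rank_def)

lemma pr_less2:
  assumes "i < n" "j < n" "f i = f j" "g i < g j"
  shows "refine_rank n f g i < refine_rank n f g j"
proof -
  have "card {k. k < n \<and> f k = f i \<and> g k < g i} < card {k. k < n \<and> f k = f j \<and> g k < g j}"
    using assms by (intro card_psubset_less[where x = i]) auto
  then show ?thesis using assms by (simp add: refine_rank_def)
qed

lemma pr_less_iff:
  assumes "sparse_rank n f" "i < n" "j < n"
  shows "refine_rank n f g i < refine_rank n f g j \<longleftrightarrow> f i < f j \<or> f i = f j \<and> g i < g j"
proof -
  have "refine_rank n f g i = refine_rank n f g j" if "f i = f j" "g i = g j" using that by (simp add: refine_rank_def)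
  then show ?thesis
    using pr_less1[OF assms, of g] pr_less1[OF assms(1,3,2), of g] pr_less2[OF assms(2,3), of f g]
      pr_less2[OF assms(3,2), of f g] by (metis less_irrefl less_trans linorder_neqE_nat)
qed

lemma pr_eq_iff:
  assumes "sparse_rank n f" "i < n" "j < n"
  shows "refine_rank n f g i = refine_rank n f g j \<longleftrightarrow> f i = f j \<and> g i = g j"
  using pr_less_iff[OF assms] pr_less_iff[OF assms(1,3,2)]
  by (metis less_irrefl linorder_neqE_nat)

lemma rk_pr:
  assumes "sparse_rank n f"
  shows "sparse_rank n (refine_rank n f g)"
  unfolding sparse_rank_def
proof (intro allI impI)
  fix i assume i: "i < n"
  have "{j. j < n \<and> refine_rank n f g j < refine_rank n f g i} =
    {j. j < n \<and> f j < f i} \<union> {j. j < n \<and> f j = f i \<and> g j < g i}"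
    using pr_less_iff[OF assms _ i] by auto
  moreover have "card ({j. j < n \<and> f j < f i} \<union> {j. j < n \<and> f j = f i \<and> g j < g i}) =
    card {j. j < n \<and> f j < f i} + card {j. j < n \<and> f j = f i \<and> g j < g i}"
    by (intro card_Un_disjoint) auto
  ultimately show "refine_rank n f g i = card {j. j < n \<and> refine_rank n f g j < refine_rank n f g i}"
    using assms i by (simp add: sparse_rank_def refine_rank_def)
qed

text \<open>The position of \<open>i\<close> when the indices are sorted stably by \<open>g\<close>.\<close>

definition pos :: "(nat \<Rightarrow> nat) \<Rightarrow> nat \<Rightarrow> nat" where
  "pos g i = g i + card {j. j < i \<and> g j = g i}"

lemma pos_alt:
  assumes "sparse_rank n g" "i < n"
  shows "pos g i = card {j. j < n \<and> (g j < g i \<or> g j = g i \<and> j < i)}"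
proof -
  have "{j. j < n \<and> (g j < g i \<or> g j = g i \<and> j < i)} =
    {j. j < n \<and> g j < g i} \<union> {j. j < i \<and> g j = g i}" using assms by auto
  moreover have "card ({j. j < n \<and> g j < g i} \<union> {j. j < i \<and> g j = g i}) =
    card {j. j < n \<and> g j < g i} + card {j. j < i \<and> g j = g i}"
    by (intro card_Un_disjoint) auto
  ultimately show ?thesis using assms by (simp add: pos_def sparse_rank_def)
qed

lemma pos_less:
  assumes "sparse_rank n g" "i < n" "j < n" "g i < g j \<or> g i = g j \<and> i < j"
  shows "pos g i < pos g j"
  unfolding pos_alt[OF assms(1,2)] pos_alt[OF assms(1,3)]
  using assms by (intro card_psubset_less[where x = i]) auto

lemma pos_bound:
  assumes "sparse_rank n g" "i < n"
  shows "pos g i < n"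
proof -
  have "pos g i < card {..<n}"
    unfolding pos_alt[OF assms] using assms by (intro card_psubset_less[where x = i]) auto
  then show ?thesis by simp
qed

lemma pos_inj:
  assumes "sparse_rank n g" "i < n" "j < n" "pos g i = pos g j"
  shows "i = j"
  using pos_less[OF assms(1-3)] pos_less[OF assms(1,3,2)] assms(4)
  by (metis less_irrefl linorder_neqE_nat)

lemma pos_mono:
  assumes "sparse_rank n g" "i < n" "j < n" "pos g i \<le> pos g j"
  shows "g i \<le> g j"
  using pos_less[OF assms(1,3,2)] assms(4) by fastforce

lemma pos_surj:
  assumes "sparse_rank n g" "p < n"
  obtains i where "i < n" "pos g i = p"
proof -
  have "pos g ` {..<n} = {..<n}"
    by (intro endo_inj_surj) (auto simp: inj_on_def intro: pos_bound[OF assms(1)] pos_inj[OF assms(1)])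
  then have "p \<in> pos g ` {..<n}" using assms by simp
  then show ?thesis using that by auto
qed

lemma card_less_Suc_filter:
  "card {j. j < Suc i \<and> P j} = card {j. j < i \<and> P j} + (if P i then 1 else 0)"
proof -
  have "{j. j < Suc i \<and> P j} = (if P i then insert i {j. j < i \<and> P j} else {j. j < i \<and> P j})"
    by (auto simp: less_Suc_eq)
  then show ?thesis by simp
qed

text \<open>Array 15 holds the names, register 10 the shift, and array 6 receives the refined names.
  The second loop sorts the positions stably by the shifted name into array 2. The last loop scans
  them in this order: array 3 counts the members of each class met so far, array 4 holds one more
  than the shifted name met last in the class, with 0 for none, and array 5 the count at the start
  of that run of equal shifted names.\<close>

definition pairname :: com where
  "pairname =
    Assign 11 (Cnst 0) ;; For 11 (Var 0) (Put 3 (Var 11) (Cnst 0)) ;;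
    Assign 11 (Cnst 0) ;; For 11 (Var 0)
      (Assign 12 (Arr 15 (Bin Rem (Bin Add (Var 11) (Var 10)) (Var 0))) ;;
       Put 2 (Bin Add (Var 12) (Arr 3 (Var 12))) (Var 11) ;;
       Put 3 (Var 12) (Bin Add (Arr 3 (Var 12)) (Cnst 1))) ;;
    Assign 11 (Cnst 0) ;; For 11 (Var 0) (Put 3 (Var 11) (Cnst 0) ;; Put 4 (Var 11) (Cnst 0)) ;;
    Assign 11 (Cnst 0) ;; For 11 (Var 0)
      (Assign 15 (Arr 2 (Var 11)) ;;
       Assign 12 (Arr 15 (Bin Rem (Bin Add (Var 15) (Var 10)) (Var 0))) ;;
       Assign 13 (Arr 15 (Var 15)) ;;
       Cond (Equ (Arr 4 (Var 13)) (Bin Add (Var 12) (Cnst 1))) Skip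
         (Put 4 (Var 13) (Bin Add (Var 12) (Cnst 1)) ;; Put 5 (Var 13) (Arr 3 (Var 13))) ;;
       Put 6 (Var 15) (Bin Add (Var 13) (Arr 5 (Var 13))) ;;
       Put 3 (Var 13) (Bin Add (Arr 3 (Var 13)) (Cnst 1)))"

context wram
begin

lemma less_W: "x \<le> 100 * n \<Longrightarrow> x < 2 ^ w"
  using n2 big by linarith

lemmas W_bounds = const_small[of 0, simplified] const_small[of 1, simplified] less_W

lemma run_set: "Q (r(v := k)) a \<Longrightarrow> k \<le> 100 * n \<Longrightarrow> 2 \<le> t \<Longrightarrow> run (Assign v (Cnst k)) r a t Q"
  using W_bounds(3)[of k] by (intro run_wp) auto

lemma run_le: "run c r a s Q \<Longrightarrow> s \<le> t \<Longrightarrow> run c r a t Q"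
  using run_mono by blast

lemma run_seq':
  assumes "run c r a s P" "\<And>r' a'. frame c r a r' a' \<Longrightarrow> P r' a' \<Longrightarrow> run d r' a' t Q"
  shows "run (c ;; d) r a (s + t) Q"
  using run_seq[OF assms] by blast

lemma run_For':
  assumes "I (r v) r a" "r v \<le> hi" "v \<notin> written_vars c" "hi < 2 ^ w"
    and "\<And>i r' a'. frame (For v e c) r a r' a' \<Longrightarrow> r v \<le> i \<Longrightarrow> i \<le> hi \<Longrightarrow> r' v = i \<Longrightarrow> I i r' a' \<Longrightarrow>
      ok r' a' e \<and> eval_exp r' a' e = hi \<and>
      (i < hi \<longrightarrow> run c r' a' s (\<lambda>r'' a''. I (Suc i) (r''(v := Suc i)) a''))"
    and "\<And>r' a'. frame (For v e c) r a r' a' \<Longrightarrow> I hi r' a' \<Longrightarrow> r' v = hi \<Longrightarrow> Q r' a'"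
  shows "run (For v e c) r a (hi * (s + exp_size e + 7) + exp_size e + 3) Q"
proof (rule run_le[OF run_For[where I = I and hi = hi and s = s, OF _ _ _ _ _ _ order_refl]])
  show "(hi - r v) * (s + exp_size e + 7) + exp_size e + 3 \<le> hi * (s + exp_size e + 7) + exp_size e + 3"
    by (intro add_mono mult_le_mono) auto
qed (use assms in blast)+

lemma run_set0: "run (Assign v (Cnst 0)) r a 2 (\<lambda>r' a'. r' v = 0 \<and> a' = a)"
  by (rule run_set) auto

lemma pairname_sort:
  assumes "r 0 = n" "sparse_rank n (a 15)" "r 10 \<le> n" "r 11 = 0" "\<forall>k<n. a 3 k = 0"
  defines "g \<equiv> shift n (r 10) (a 15)"
  shows "run (For 11 (Var 0)
      (Assign 12 (Arr 15 (Bin Rem (Bin Add (Var 11) (Var 10)) (Var 0))) ;;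
       Put 2 (Bin Add (Var 12) (Arr 3 (Var 12))) (Var 11) ;;
       Put 3 (Var 12) (Bin Add (Arr 3 (Var 12)) (Cnst 1)))) r a (60 * n + 10)
     (\<lambda>r' a'. \<forall>i<n. a' 2 (pos g i) = i)"
proof -
  have g: "sparse_rank n g" using rk_sh[OF assms(2)] n2 g_def by simp
  show ?thesis
  proof (rule run_For[where hi = n and s = 50 and
        I = "\<lambda>i r' a'. (\<forall>k<n. a' 3 k = card {j. j < i \<and> g j = k}) \<and> (\<forall>j<i. a' 2 (pos g j) = j)"],
        goal_cases)
    case (5 i r' a')
    then have v: "r' 0 = n" "r' 10 = r 10" "a' 15 = a 15" "r' 11 = i"
      and I: "\<And>k. k < n \<Longrightarrow> a' 3 k = card {j. j < i \<and> g j = k}" "\<And>j. j < i \<Longrightarrow> a' 2 (pos g j) = j"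
      using assms by (auto simp: frame_def)
    show ?case
    proof (intro conjI impI run_wp)
      assume i: "i < n"
      have gi: "a 15 ((i + r 10) mod n) = g i" by (simp add: g_def shift_def)
      have gn: "g i < n" using rk_less[OF g i] .
      have c: "a' 3 (g i) = card {j. j < i \<and> g j = g i}" using I(1)[OF gn] .
      have "pos g i < n" using pos_bound[OF g i] .
      then have pi: "g i + card {j. j < i \<and> g j = g i} = pos g i" "pos g i < 8 * n" "pos g i < 2 ^ w"
        by (auto simp: pos_def intro: less_W)
      have "(i + r 10) mod n < n" using n2 by simp
      then have m: "(i + r 10) mod n < 8 * n" "i + r 10 < 2 ^ w" "(i + r 10) mod n < 2 ^ w"
        using i assms(3) by (linarith, intro less_W, linarith, intro less_W, linarith)
      have "card {j. j < i \<and> g j = g i} \<le> n" using \<open>pos g i < n\<close> by (simp add: pos_def)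
      then have cw: "Suc (card {j. j < i \<and> g j = g i}) < 2 ^ w" using n2 by (intro less_W) simp
      have neq: "pos g j \<noteq> pos g i" if "j < i" for j using pos_inj[OF g _ i, of j] that i by auto
      show "wp (Assign 12 (Arr 15 (Bin Rem (Bin Add (Var 11) (Var 10)) (Var 0))) ;;
       Put 2 (Bin Add (Var 12) (Arr 3 (Var 12))) (Var 11) ;;
       Put 3 (Var 12) (Bin Add (Arr 3 (Var 12)) (Cnst 1))) (\<lambda>r'' a''.
         (\<forall>k<n. a'' 3 k = card {j. j < Suc i \<and> g j = k}) \<and> (\<forall>j<Suc i. a'' 2 (pos g j) = j)) r' a'"
        using gn m i pi W_bounds(1,2) cw
        by (simp add: v gi c I card_less_Suc_filter All_less_Suc neq)
    qed (use v in \<open>auto\<close>)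
  next
    case (6 r' a') then show ?case by simp
  qed (use assms W_bounds in auto)
qed

text \<open>Positions arrive with nondecreasing shifted names. When a new one appears in a class,
  the members counted so far are exactly those with a smaller shifted name, and their number is the
  increment that \<open>refine_rank\<close> adds.\<close>

lemma pairname_merge:
  assumes "r 0 = n" "sparse_rank n (a 15)" "r 10 \<le> n" "r 11 = 0" "\<forall>k<n. a 3 k = 0" "\<forall>k<n. a 4 k = 0"
  defines "f \<equiv> a 15" and "g \<equiv> shift n (r 10) (a 15)"
  assumes ord: "\<forall>i<n. a 2 (pos g i) = i"
  shows "run (For 11 (Var 0)
      (Assign 15 (Arr 2 (Var 11)) ;;
       Assign 12 (Arr 15 (Bin Rem (Bin Add (Var 15) (Var 10)) (Var 0))) ;;
       Assign 13 (Arr 15 (Var 15)) ;;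
       Cond (Equ (Arr 4 (Var 13)) (Bin Add (Var 12) (Cnst 1))) Skip
         (Put 4 (Var 13) (Bin Add (Var 12) (Cnst 1)) ;; Put 5 (Var 13) (Arr 3 (Var 13))) ;;
       Put 6 (Var 15) (Bin Add (Var 13) (Arr 5 (Var 13))) ;;
       Put 3 (Var 13) (Bin Add (Arr 3 (Var 13)) (Cnst 1)))) r a (110 * n + 10)
     (\<lambda>r' a'. \<forall>i<n. a' 6 i = refine_rank n f g i)"
proof -
  have g: "sparse_rank n g" using rk_sh[OF assms(2)] n2 g_def by simp
  have f: "sparse_rank n f" using assms by simp
  define I where "I = (\<lambda>p (r'::regs) (a'::arrs).
     (\<forall>k<n. a' 3 k = card {i. i < n \<and> pos g i < p \<and> f i = k}) \<and>
     (\<forall>i<n. pos g i < p \<longrightarrow> a' 6 i = refine_rank n f g i \<and> g i + 1 \<le> a' 4 (f i)) \<and>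
     (\<forall>k<n. a' 4 k = 0 \<or> (\<exists>i<n. pos g i < p \<and> f i = k \<and> a' 4 k = g i + 1 \<and>
         a' 5 k = card {j. j < n \<and> f j = k \<and> g j < g i})))"
  show ?thesis
  proof (rule run_For[where hi = n and s = 100 and I = I], goal_cases)
    case (5 p r' a')
    then have v: "r' 0 = n" "r' 10 = r 10" "a' 15 = f" "r' 11 = p" "a' 2 = a 2"
      and I: "\<And>k. k < n \<Longrightarrow> a' 3 k = card {i. i < n \<and> pos g i < p \<and> f i = k}"
       "\<And>i. i < n \<Longrightarrow> pos g i < p \<Longrightarrow> a' 6 i = refine_rank n f g i"
       "\<And>i. i < n \<Longrightarrow> pos g i < p \<Longrightarrow> g i + 1 \<le> a' 4 (f i)"
       "\<And>k. k < n \<Longrightarrow> a' 4 k = 0 \<or> (\<exists>i<n. pos g i < p \<and> f i = k \<and> a' 4 k = g i + 1 \<and>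
         a' 5 k = card {j. j < n \<and> f j = k \<and> g j < g i})"
      using assms by (auto simp: frame_def I_def)
    show ?case
    proof (intro conjI impI run_wp)
      assume p: "p < n"
      obtain i where i: "i < n" "pos g i = p" using pos_surj[OF g p] .
      have a2: "a 2 p = i" using ord i by auto
      have gi: "f ((i + r 10) mod n) = g i" by (simp add: g_def f_def shift_def)
      have "(i + r 10) mod n < n" using n2 by simp
      then have m: "(i + r 10) mod n < 8 * n" "i + r 10 < 2 ^ w" "(i + r 10) mod n < 2 ^ w"
          "p < 8 * n" "i < 8 * n"
        using i p assms(3) by (linarith, intro less_W, linarith, intro less_W, linarith+)
      have b: "f i < n" "g i < n" "refine_rank n f g i < n"
        using rk_less[OF f i(1)] rk_less[OF g i(1)] rk_less[OF rk_pr[OF f] i(1)] by auto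
      have "card {ia. ia < n \<and> pos g ia < p \<and> f ia = f i} \<le> n"
        using card_mono[of "{..<n}" "{ia. ia < n \<and> pos g ia < p \<and> f ia = f i}"] by auto
      then have c3: "Suc (card {ia. ia < n \<and> pos g ia < p \<and> f ia = f i}) < 2 ^ w"
        "f i < 8 * n" "g i < 8 * n" "Suc (g i) < 2 ^ w" "refine_rank n f g i < 2 ^ w"
        using b n2 by (auto intro: less_W)
      have le: "g j \<le> g i" if "j < n" "pos g j < p" for j using pos_mono[OF g that(1) i(1)] that i by simp
      have le': "g j \<le> g i" if "j < n" "pos g j < Suc p" for j
        using pos_mono[OF g that(1) i(1)] that i by simp
      have less: "pos g j < p" if "j < n" "g j < g i" for j using pos_less[OF g that(1) i(1)] that i by simp
      have old: "j < n \<Longrightarrow> pos g j < Suc p \<Longrightarrow> j \<noteq> i \<Longrightarrow> pos g j < p" for j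
        using i pos_inj[OF g _ i(1), of j] by (auto simp: less_Suc_eq)
      have cnt: "card {ia. ia < n \<and> pos g ia < Suc p \<and> f ia = k} =
         card {ia. ia < n \<and> pos g ia < p \<and> f ia = k} + (if f i = k then 1 else 0)" for k
      proof -
        have "{ia. ia < n \<and> pos g ia < Suc p \<and> f ia = k} =
          {ia. ia < n \<and> pos g ia < p \<and> f ia = k} \<union> (if f i = k then {i} else {})"
          using i old by auto
        then show ?thesis using i by (auto simp: card_insert_if)
      qed
      have st1: "f i + a' 5 (f i) = refine_rank n f g i" if "a' 4 (f i) = g i + 1"
        using I(4)[OF b(1)] that by (auto simp: refine_rank_def)
      \<comment> \<open>If the stored value is not \<open>g i + 1\<close>, no earlier member of the
        class shares the shifted name of \<open>i\<close>: it would have stored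
        \<open>g i + 1\<close>, and later values cannot exceed that in sorted order.\<close>
      have st2: "{ia. ia < n \<and> pos g ia < p \<and> f ia = f i} = {j. j < n \<and> f j = f i \<and> g j < g i}"
        if ne: "a' 4 (f i) \<noteq> g i + 1"
      proof -
        have "g j < g i" if j: "j < n" "pos g j < p" "f j = f i" for j
        proof (rule ccontr)
          assume "\<not> ?thesis"
          then have "g j = g i" using le[OF j(1,2)] by simp
          then have "g i + 1 \<le> a' 4 (f i)" using I(3)[OF j(1,2)] j by simp
          moreover obtain i' where "i' < n" "pos g i' < p" "a' 4 (f i) = g i' + 1"
            using I(4)[OF b(1)] calculation by auto
          ultimately show False using le[of i'] ne by simp
        qed
        then show ?thesis using less by auto
      qed
      have I4': "a'' 4 k = 0 \<or> (\<exists>i<n. pos g i < Suc p \<and> f i = k \<and> a'' 4 k = Suc (g i) \<and>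
         a'' 5 k = card {j. j < n \<and> f j = k \<and> g j < g i})"
        if "k < n" "a'' 4 k = a' 4 k" "a'' 5 k = a' 5 k" for k and a'' :: arrs
        using I(4)[OF that(1)] that less_SucI by fastforce
      show "wp (Assign 15 (Arr 2 (Var 11)) ;;
       Assign 12 (Arr 15 (Bin Rem (Bin Add (Var 15) (Var 10)) (Var 0))) ;;
       Assign 13 (Arr 15 (Var 15)) ;;
       Cond (Equ (Arr 4 (Var 13)) (Bin Add (Var 12) (Cnst 1))) Skip
         (Put 4 (Var 13) (Bin Add (Var 12) (Cnst 1)) ;; Put 5 (Var 13) (Arr 3 (Var 13))) ;;
       Put 6 (Var 15) (Bin Add (Var 13) (Arr 5 (Var 13))) ;;
       Put 3 (Var 13) (Bin Add (Arr 3 (Var 13)) (Cnst 1)))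
        (\<lambda>r'' a''. I (Suc p) (r''(11 := Suc p)) a'') r' a'"
      proof (cases "a' 4 (f i) = g i + 1")
        case True
        show ?thesis
          using b(1) m i c3 st1[OF True] W_bounds(1,2) True
          apply (simp add: v a2 gi I(1) I_def cnt)
          apply (intro conjI allI impI)
          subgoal for j by (cases "j = i") (use old I(2) in auto)
          subgoal for j by (cases "j = i") (use old I(3) in auto)
          subgoal for k by (rule I4'[of k a', simplified]) auto
          done
      next
        case False
        have pre: "f i + card {j. j < n \<and> f j = f i \<and> g j < g i} = refine_rank n f g i" by (simp add: refine_rank_def)
        show ?thesis
          using b(1) m i c3 pre W_bounds(1,2) False c3(1)[unfolded st2[OF False]]
          apply (simp add: v a2 gi I(1) I_def cnt st2[OF False])
          apply (intro conjI allI impI)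
          subgoal for j using I(2)[of j] old[of j] by auto
          subgoal for j using le' by auto
          subgoal for j using I(2)[of j] old[of j] by auto
          subgoal for j using I(3)[of j] old[of j] by auto
          subgoal by (rule exI[of _ i]) auto
          subgoal for k using I(4)[of k] less_SucI by fastforce
          done
      qed
    qed (use v in auto)
  next
    case 1 then show ?case using assms(4-6) by (simp add: I_def)
  next
    case (6 r' a') then show ?case using pos_bound[OF g] by (auto simp: I_def)
  next
    case 4 then show ?case using W_bounds by simp
  qed (use assms(4) in auto)
qed

lemma run_zero:
  assumes "r 0 = n" "r v = 0" "v \<noteq> 0"
  shows "run (For v (Var 0) (Put k (Var v) (Cnst 0))) r a (20 * n + 10) (\<lambda>r' a'. \<forall>i<n. a' k i = 0)"
proof (rule run_For[where hi = n and s = 10 and I = "\<lambda>i r' a'. \<forall>j<i. a' k j = 0"], goal_cases)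
  case (5 i r' a')
  then have "r' 0 = n" "i \<le> n" using assms by (auto simp: frame_def)
  with 5 show ?case
    by (intro conjI impI run_wp) (auto simp: less_Suc_eq W_bounds)
qed (use assms W_bounds in auto)

lemma run_zero2:
  assumes "r 0 = n" "r v = 0" "v \<noteq> 0" "k \<noteq> k'"
  shows "run (For v (Var 0) (Put k (Var v) (Cnst 0) ;; Put k' (Var v) (Cnst 0))) r a (30 * n + 10)
    (\<lambda>r' a'. \<forall>i<n. a' k i = 0 \<and> a' k' i = 0)"
proof (rule run_For[where hi = n and s = 20 and I = "\<lambda>i r' a'. \<forall>j<i. a' k j = 0 \<and> a' k' j = 0"], goal_cases)
  case (5 i r' a')
  then have "r' 0 = n" "i \<le> n" using assms by (auto simp: frame_def)
  with 5 show ?case using assms(4)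
    by (intro conjI impI run_wp) (auto simp: less_Suc_eq W_bounds)
qed (use assms W_bounds in auto)

lemma run_pairname:
  assumes "r 0 = n" "sparse_rank n (a 15)" "r 10 \<le> n"
  shows "run pairname r a (220 * n + 50)
    (\<lambda>r' a'. \<forall>i<n. a' 6 i = refine_rank n (a 15) (shift n (r 10) (a 15)) i)"
  unfolding pairname_def
  apply (rule run_le)
   apply (rule run_seq'[OF run_set0])
   apply (rule run_seq'[OF run_zero])
      apply (use assms in \<open>simp_all add: frame_def\<close>)[3]
   apply (rule run_seq'[OF run_set0])
   apply (rule run_seq'[OF pairname_sort])
        apply (use assms in \<open>simp_all add: frame_def\<close>)[5]
   apply (rule run_seq'[OF run_set0])
   apply (rule run_seq'[OF run_zero2])
       apply (use assms in \<open>simp_all add: frame_def\<close>)[4]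
   apply (rule run_seq'[OF run_set0])
   apply (rule run_mono[OF pairname_merge order_refl])
           apply (use assms in \<open>simp_all add: frame_def\<close>)
  done

end

section \<open>Names of circular blocks and their bit-packed storage\<close>

lemma pr_cong:
  assumes "\<And>i. i < n \<Longrightarrow> f i = f' i" "\<And>i. i < n \<Longrightarrow> g i = g' i" "i < n"
  shows "refine_rank n f g i = refine_rank n f' g' i"
proof -
  have "{j. j < n \<and> f j = f i \<and> g j < g i} = {j. j < n \<and> f' j = f' i \<and> g' j < g' i}"
    using assms by auto
  then show ?thesis using assms by (simp add: refine_rank_def)
qed

lemma rk_cong:
  assumes "\<And>i. i < n \<Longrightarrow> f i = f' i" "sparse_rank n f"
  shows "sparse_rank n f'"
proof -
  have "{j. j < n \<and> f j < f i} = {j. j < n \<and> f' j < f' i}" if "i < n" for i using assms that by auto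
  then show ?thesis using assms by (simp add: sparse_rank_def)
qed

text \<open>\<open>block_name n x j i\<close> counts the blocks of length \<open>2 ^ j\<close> of the circular string \<open>x\<close> of length \<open>n\<close>
  that are smaller than the one at position \<open>i\<close>.\<close>

fun block_name :: "nat \<Rightarrow> (nat \<Rightarrow> nat) \<Rightarrow> nat \<Rightarrow> nat \<Rightarrow> nat" where
  "block_name n x 0 = (\<lambda>i. card {j. j < n \<and> x j < x i})"
| "block_name n x (Suc j) = refine_rank n (block_name n x j) (shift n (2 ^ j) (block_name n x j))"

text \<open>A window is covered by two overlapping blocks of length \<open>2 ^ floor_log m\<close>,
  one at each end, so one more pairing names it. These names serve as indices for weights and
  results.\<close>

definition window_name :: "nat \<Rightarrow> (nat \<Rightarrow> nat) \<Rightarrow> nat \<Rightarrow> nat \<Rightarrow> nat" where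
  "window_name n x m = refine_rank n (block_name n x (floor_log m)) (shift n (m - 2 ^ floor_log m) (block_name n x (floor_log m)))"

lemma nm0_less: "i < n \<Longrightarrow> x i < x j \<Longrightarrow> block_name n x 0 i < block_name n x 0 j"
  by (auto intro!: card_psubset_less[where x = i])

lemma nm0_less_iff: "i < n \<Longrightarrow> j < n \<Longrightarrow> block_name n x 0 i < block_name n x 0 j \<longleftrightarrow> x i < x j"
  using nm0_less[of i n x j] nm0_less[of j n x i] by (cases "x i" "x j" rule: linorder_cases) auto

lemma rk_nm: "0 < n \<Longrightarrow> sparse_rank n (block_name n x j)"
proof (induction j)
  case 0
  have "{k. k < n \<and> block_name n x 0 k < block_name n x 0 i} = {k. k < n \<and> x k < x i}" if "i < n" for i
    using nm0_less_iff[OF _ that, of _ x] by auto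
  then show ?case by (simp add: sparse_rank_def)
next
  case (Suc j) then show ?case by (simp add: rk_pr)
qed

lemma nm_less: "0 < n \<Longrightarrow> i < n \<Longrightarrow> block_name n x j i < n"
  using rk_less[OF rk_nm] .

lemma nm_eq_iff:
  assumes "0 < n" "i < n" "i' < n"
  shows "block_name n x j i = block_name n x j i' \<longleftrightarrow> (\<forall>t<2 ^ j. x ((i + t) mod n) = x ((i' + t) mod n))"
  using assms
proof (induction j arbitrary: i i')
  case 0
  then show ?case using nm0_less[of i n x i'] nm0_less[of i' n x i]
    by (cases "x i" "x i'" rule: linorder_cases) auto
next
  case (Suc j)
  have "block_name n x (Suc j) i = block_name n x (Suc j) i' \<longleftrightarrow> block_name n x j i = block_name n x j i' \<and>
     block_name n x j ((i + 2 ^ j) mod n) = block_name n x j ((i' + 2 ^ j) mod n)"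
    using Suc pr_eq_iff[OF rk_nm] by (simp add: shift_def)
  also have "\<dots> \<longleftrightarrow> (\<forall>t<2 ^ j. x ((i + t) mod n) = x ((i' + t) mod n)) \<and>
     (\<forall>t<2 ^ j. x ((i + (2 ^ j + t)) mod n) = x ((i' + (2 ^ j + t)) mod n))"
    using Suc by (simp add: mod_add_left_eq add.assoc)
  also have "\<dots> \<longleftrightarrow> (\<forall>t<2 ^ Suc j. x ((i + t) mod n) = x ((i' + t) mod n))"
  proof (intro iffI allI impI)
    fix t :: nat assume h: "(\<forall>t<2 ^ j. x ((i + t) mod n) = x ((i' + t) mod n)) \<and>
     (\<forall>t<2 ^ j. x ((i + (2 ^ j + t)) mod n) = x ((i' + (2 ^ j + t)) mod n))" and t: "t < 2 ^ Suc j"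
    show "x ((i + t) mod n) = x ((i' + t) mod n)"
    proof (cases "t < 2 ^ j")
      case False
      then have "t - 2 ^ j < 2 ^ j" using t by auto
      then show ?thesis using h False by (metis le_add_diff_inverse linorder_not_less)
    qed (use h in blast)
  qed auto
  finally show ?case .
qed

text \<open>Refinement orders lexicographically with the old name first, so a strict comparison is
  never reversed by longer blocks.\<close>

lemma nm_refine:
  assumes "0 < n" "i < n" "i' < n" "j \<le> k" "block_name n x j i < block_name n x j i'"
  shows "block_name n x k i < block_name n x k i'"
  using assms(4)
proof (induction rule: dec_induct)
  case (step k)
  then show ?case using pr_less_iff[OF rk_nm[OF assms(1)] assms(2,3)] by simp
qed (fact assms(5))

text \<open>Since \<open>m < 2 * 2 ^ floor_log m\<close>, the two blocks leave no position of the
  window uncovered.\<close>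

lemma full_eq_iff:
  assumes "0 < n" "i < n" "i' < n" "0 < m"
  shows "window_name n x m i = window_name n x m i' \<longleftrightarrow> (\<forall>t<m. x ((i + t) mod n) = x ((i' + t) mod n))"
proof -
  let ?h = "2 ^ floor_log m"
  have m: "?h \<le> m" "m < 2 * ?h" using floor_log_exp2_le[OF assms(4)] floor_log_exp2_gt[of m] by auto
  have "window_name n x m i = window_name n x m i' \<longleftrightarrow> (\<forall>t<?h. x ((i + t) mod n) = x ((i' + t) mod n)) \<and>
     (\<forall>t<?h. x ((i + (m - ?h + t)) mod n) = x ((i' + (m - ?h + t)) mod n))"
    unfolding window_name_def using assms
    by (simp add: pr_eq_iff[OF rk_nm] shift_def nm_eq_iff mod_add_left_eq add.assoc)
  also have "\<dots> \<longleftrightarrow> (\<forall>t<m. x ((i + t) mod n) = x ((i' + t) mod n))"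
  proof (intro iffI allI impI)
    fix t :: nat assume h: "(\<forall>t<?h. x ((i + t) mod n) = x ((i' + t) mod n)) \<and>
     (\<forall>t<?h. x ((i + (m - ?h + t)) mod n) = x ((i' + (m - ?h + t)) mod n))" and t: "t < m"
    show "x ((i + t) mod n) = x ((i' + t) mod n)"
    proof (cases "t < ?h")
      case False
      then have "m - ?h + (t - (m - ?h)) = t" "t - (m - ?h) < ?h" using t m by auto
      then show ?thesis using h by metis
    qed (use h in blast)
  next
    have less: "m - ?h + t < m" if "t < ?h" for t using that m by linarith
    assume h: "\<forall>t<m. x ((i + t) mod n) = x ((i' + t) mod n)"
    then show "(\<forall>t<?h. x ((i + t) mod n) = x ((i' + t) mod n)) \<and>
     (\<forall>t<?h. x ((i + (m - ?h + t)) mod n) = x ((i' + (m - ?h + t)) mod n))"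
      using h m less by (metis order_less_le_trans)
  qed
  finally show ?thesis .
qed

lemma full_less: "0 < n \<Longrightarrow> i < n \<Longrightarrow> window_name n x m i < n"
  unfolding window_name_def by (intro rk_less[OF rk_pr[OF rk_nm]])

text \<open>The predecessor of \<open>b\<close> in \<open>S\<close>, for sets containing \<open>0\<close>.\<close>

definition pred_in :: "nat set \<Rightarrow> nat \<Rightarrow> nat" where
  "pred_in S b = Max (insert 0 {q \<in> S. q < b})"

lemma mx_eqI:
  assumes "y \<in> S" "y < b" "\<And>q. q \<in> S \<Longrightarrow> q < b \<Longrightarrow> q \<le> y"
  shows "pred_in S b = y"
  unfolding pred_in_def using assms
  by (intro Max_eqI) (auto intro: finite_subset[of _ "{..<b}"])

text \<open>Passing from level \<open>j\<close> to level \<open>k\<close>, a class spreads only over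
  its own gap. A larger name of level \<open>j\<close> counts \<open>i\<close> and everything below
  \<open>i\<close> at level \<open>k\<close>, hence exceeds the name of \<open>i\<close> at level
  \<open>k\<close>. So nothing lies between the two names of \<open>i\<close> in the set of level
  \<open>j\<close>.\<close>

lemma mx_nm:
  assumes "0 < n" "i < n" "j \<le> k"
  shows "pred_in (block_name n x j ` {..<n}) (Suc (block_name n x k i)) = block_name n x j i"
proof (rule mx_eqI)
  have *: "block_name n x k i' \<le> block_name n x k i \<Longrightarrow> block_name n x j i' \<le> block_name n x j i" if "i' < n" for i'
    using nm_refine[OF assms(1,2) that assms(3), of x] by fastforce
  have "block_name n x j i \<le> block_name n x k i"
    using assms(3)
  proof (induction rule: dec_induct)
    case (step k) then show ?case by (simp add: refine_rank_def)
  qed simp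
  then show "block_name n x j i < Suc (block_name n x k i)" by simp
  fix q assume "q \<in> block_name n x j ` {..<n}" "q < Suc (block_name n x k i)"
  then obtain i' where i': "i' < n" "q = block_name n x j i'" "q \<le> block_name n x k i" by auto
  show "q \<le> block_name n x j i"
  proof (rule ccontr)
    assume n: "\<not> ?thesis"
    have "{i''. i'' < n \<and> block_name n x k i'' < block_name n x k i} \<union> {i} \<subseteq> {i''. i'' < n \<and> block_name n x j i'' < block_name n x j i'}"
      using * n i' assms(2) by fastforce
    then have "card ({i''. i'' < n \<and> block_name n x k i'' < block_name n x k i} \<union> {i}) \<le>
      card {i''. i'' < n \<and> block_name n x j i'' < block_name n x j i'}" by (intro card_mono) auto
    then have "Suc (block_name n x k i) \<le> block_name n x j i'"
      using rk_nm[OF assms(1), of x k] rk_nm[OF assms(1), of x j] assms(2) i'(1) by (simp add: sparse_rank_def)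
    then show False using i' by simp
  qed
qed (use assms in auto)

section \<open>Predecessor queries in bit vectors\<close>

lemma bit_imp_le: "bit v r \<Longrightarrow> 2 ^ r \<le> (v::nat)"
  unfolding bit_iff_odd by (metis div_less even_zero linorder_not_less)

lemma bits_less:
  assumes "\<And>r. bit (v::nat) r \<Longrightarrow> r < b"
  shows "v < 2 ^ b"
proof -
  have "take_bit b v = v" by (rule bit_eqI) (use assms in \<open>auto simp: bit_take_bit_iff\<close>)
  then show ?thesis by (metis take_bit_nat_less_exp)
qed

lemma bit_floor_log: "0 < v \<Longrightarrow> bit v (floor_log v)"
proof -
  assume v: "0 < v"
  have "2 ^ floor_log v \<le> v" "v < 2 * 2 ^ floor_log v"
    using floor_log_exp2_le[OF v] floor_log_exp2_gt[of v] by auto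
  then have "v div 2 ^ floor_log v = 1" by (simp add: div_nat_eqI)
  then show ?thesis by (simp add: bit_iff_odd)
qed

lemma bit_le_floor_log: "bit v r \<Longrightarrow> r \<le> floor_log v"
  using bit_imp_le floor_log_power floor_log_mono by (metis monoD)

text \<open>The word holds the part of \<open>S\<close> between \<open>u\<close> and
  \<open>u + b\<close>. Its highest bit is the largest element there, and if the word is empty, the
  predecessor lies before \<open>u\<close>.\<close>

lemma mx_word:
  assumes "\<And>r. bit v r \<longleftrightarrow> r < b \<and> u + r \<in> S"
  shows "pred_in S (u + b) = (if v = 0 then pred_in S u else u + floor_log v)"
proof (cases "v = 0")
  case True
  then have "{q \<in> S. q < u + b} = {q \<in> S. q < u}"
    using assms by (auto, metis add_less_cancel_left bit_0_eq bot_apply le_add_diff_inverse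
        linorder_not_less bot_bool_def)
  then show ?thesis using True by (simp add: pred_in_def)
next
  case False
  have "pred_in S (u + b) = u + floor_log v"
  proof (rule mx_eqI)
    show "u + floor_log v \<in> S" "u + floor_log v < u + b" using assms bit_floor_log False by auto
    fix q assume q: "q \<in> S" "q < u + b"
    show "q \<le> u + floor_log v"
    proof (cases "u \<le> q")
      case True
      then have "bit v (q - u)" using assms q by auto
      then show ?thesis using bit_le_floor_log by fastforce
    qed auto
  qed
  then show ?thesis using False by simp
qed

text \<open>With \<open>b = floor_log n\<close> bits a word has a value below \<open>2 ^ b\<close>,
  hence at most \<open>n\<close>, so its highest bit can be read from a table of linear
  size.\<close>

definition level :: "arrs \<Rightarrow> nat \<Rightarrow> nat \<Rightarrow> nat \<Rightarrow> nat set \<Rightarrow> bool" where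
  "level a b W j S \<longleftrightarrow> (\<forall>u<W. (\<forall>r. bit (a 7 (j * W + u)) r \<longleftrightarrow> r < b \<and> u * b + r \<in> S) \<and>
     a 8 (j * W + u) = pred_in S (u * b))"

text \<open>The remainder modulo \<open>2 ^ (p mod b + 1)\<close> keeps the bit of \<open>p\<close>
  itself and those before it in its word. The query is for \<open>Suc p\<close> because
  \<open>pred_in\<close> is strict and \<open>p\<close> may be the answer.\<close>

lemma level_query:
  assumes "level a b W j S" "p div b < W" "0 < b"
  shows "pred_in S (Suc p) = (if a 7 (j * W + p div b) mod 2 ^ (p mod b + 1) = 0 then a 8 (j * W + p div b)
     else p div b * b + floor_log (a 7 (j * W + p div b) mod 2 ^ (p mod b + 1)))"
proof -
  let ?v = "a 7 (j * W + p div b) mod 2 ^ (p mod b + 1)"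
  have pb: "r < b" if "r < p mod b + 1" for r
    using that mod_less_divisor[OF assms(3), of p] by linarith
  have "bit ?v r \<longleftrightarrow> r < p mod b + 1 \<and> p div b * b + r \<in> S" for r
    unfolding take_bit_eq_mod[symmetric] bit_take_bit_iff using assms pb by (auto simp: level_def)
  from mx_word[OF this] show ?thesis
    using assms by (simp add: level_def add.assoc[symmetric])
qed

lemma level_cong:
  assumes "level a b W j S" "\<And>u. u < W \<Longrightarrow> a' 7 (j * W + u) = a 7 (j * W + u)"
    "\<And>u. u < W \<Longrightarrow> a' 8 (j * W + u) = a 8 (j * W + u)"
  shows "level a' b W j S"
  using assms by (simp add: level_def)

text \<open>Registers: 0 holds \<open>n\<close>, 7 the window length, 2 the current level \<open>j\<close>, 3 its block length \<open>2 ^ j\<close>,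
  4 the number of bits per word, 5 the number of words per level. Arrays: 0 holds the input, 15 the
  names of the current level, 7 the bit vectors of all levels, 8 the last set bit before each of their
  words, 9 the table of \<open>floor_log\<close>.\<close>

definition letter_names :: "nat \<Rightarrow> com" where
  "letter_names \<sigma> = Assign 10 (Cnst 0) ;; Assign 13 (Cnst 0) ;; For 10 (Cnst \<sigma>)
    (Assign 14 (Var 13) ;; Assign 11 (Cnst 0) ;; For 11 (Var 0)
      (Cond (Equ (Arr 0 (Var 11)) (Var 10))
        (Put 15 (Var 11) (Var 14) ;; Assign 13 (Bin Add (Var 13) (Cnst 1))) Skip))"

definition msb_table :: com where
  "msb_table = Assign 11 (Cnst 2) ;; For 11 (Bin Add (Var 0) (Cnst 1))
     (Put 9 (Var 11) (Bin Add (Arr 9 (Bin Quot (Var 11) (Cnst 2))) (Cnst 1))) ;;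
   Assign 4 (Arr 9 (Var 0)) ;; Assign 5 (Bin Add (Bin Quot (Var 0) (Var 4)) (Cnst 1))"

definition record_level :: com where
  "record_level = Assign 11 (Cnst 0) ;; For 11 (Var 0)
     (Assign 12 (Arr 15 (Var 11)) ;;
      Assign 13 (Bin Add (Bin Mul (Var 2) (Var 5)) (Bin Quot (Var 12) (Var 4))) ;;
      Put 7 (Var 13) (Bin Bit_Or (Arr 7 (Var 13))
        (Bin Shift_Left (Cnst 1) (Bin Rem (Var 12) (Var 4))))) ;;
   Assign 11 (Cnst 0) ;; Assign 14 (Cnst 0) ;; For 11 (Var 5)
     (Assign 13 (Bin Add (Bin Mul (Var 2) (Var 5)) (Var 11)) ;;
      Put 8 (Var 13) (Var 14) ;;
      Assign 12 (Arr 7 (Var 13)) ;;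
      Cond (Lt (Cnst 0) (Var 12))
        (Assign 14 (Bin Add (Bin Mul (Var 11) (Var 4)) (Arr 9 (Var 12)))) Skip)"

context wram
begin

lemma n0: "0 < n" using n2 by simp

text \<open>One pass over the string for each letter is linear only because the alphabet is fixed.
  Register 14 keeps the number of positions with smaller letters, which is the name, while register
  13 goes on counting.\<close>

lemma run_initnames:
  assumes "r 0 = n" "\<forall>i<n. a 0 i < \<sigma>" "\<sigma> < 2 ^ w"
  shows "run (letter_names \<sigma>) r a ((\<sigma> + 1) * (100 * n)) (\<lambda>r' a'. \<forall>i<n. a' 15 i = block_name n (a 0) 0 i)"
proof -
  let ?x = "a 0"
  let ?I = "\<lambda>e r' a'. r' 13 = card {j. j < n \<and> ?x j < e} \<and>
     (\<forall>i<n. ?x i < e \<longrightarrow> a' 15 i = block_name n ?x 0 i)"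
  have card_le: "card {j. j < k \<and> P j} \<le> k" for k :: nat and P
    using card_mono[of "{..<k}" "{j. j < k \<and> P j}"] by auto
  show ?thesis
    unfolding letter_names_def
    apply (rule run_le)
     apply (rule run_seq'[OF run_set0])
     apply (rule run_seq'[OF run_set0])
     apply (rule run_For'[where hi = \<sigma> and I = ?I and s = "40 * n + 20"])
          prefer 5
  proof goal_cases
    case (1 r1 a1 r2 a2 e r3 a3)
    then have v: "r3 0 = n" "a3 0 = a 0" "r3 10 = e" using assms by (auto simp: frame_def)
    note I = 1(9)
    let ?b = "card {j. j < n \<and> ?x j < e}"
    let ?J = "\<lambda>i r' a'. r' 13 = ?b + card {j. j < i \<and> ?x j = e} \<and>
       (\<forall>j<n. ?x j < e \<longrightarrow> a' 15 j = block_name n ?x 0 j) \<and> (\<forall>j<i. ?x j = e \<longrightarrow> a' 15 j = ?b)"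
    have "run (Assign 14 (Var 13) ;; Assign 11 (Cnst 0) ;; For 11 (Var 0)
      (Cond (Equ (Arr 0 (Var 11)) (Var 10))
        (Put 15 (Var 11) (Var 14) ;; Assign 13 (Bin Add (Var 13) (Cnst 1))) Skip)) r3 a3 (40 * n + 20)
      (\<lambda>r' a'. ?I (Suc e) (r'(10 := Suc e)) a')" if e: "e < \<sigma>"
      apply (rule run_le)
       apply (rule run_seq'[OF run_wp[where Q = "\<lambda>r' a'. r' 13 = ?b \<and> r' 14 = ?b \<and> a' = a3", OF _ order_refl]])
        apply (use I in simp)
       apply (rule run_seq'[OF run_set0])
       apply (rule run_For'[where hi = n and I = ?J and s = "30"])
            prefer 5
    proof goal_cases
      case (1 r4 a4 r5 a5 i r6 a6)
      then have v: "r6 0 = n" "a6 0 = a 0" "r6 10 = e" "r6 11 = i" "r6 14 = ?b" "i \<le> n"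
        using v by (auto simp: frame_def)
      have J: "?J i r6 a6" using 1 by simp
      have b: "?b < 2 ^ w" "?b + card {j. j < i \<and> ?x j = e} + 1 < 2 ^ w"
        using card_le[of n "\<lambda>j. ?x j < e"] card_le[of i "\<lambda>j. ?x j = e"] v(6) n2
        by (intro less_W; linarith)+
      show ?case
      proof (intro conjI impI run_wp)
        assume "i < n"
        then show "wp (Cond (Equ (Arr 0 (Var 11)) (Var 10))
        (Put 15 (Var 11) (Var 14) ;; Assign 13 (Bin Add (Var 13) (Cnst 1))) Skip)
         (\<lambda>r'' a''. ?J (Suc i) (r''(11 := Suc i)) a'') r6 a6"
          using J b W_bounds(2) v by (auto simp: v card_less_Suc_filter All_less_Suc)
      qed (use v in auto)
    next
      case (2 r4 a4 r5 a5)
      then show ?case using I v by (auto simp: frame_def)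
    next
      case (6 r4 a4 r5 a5 r6 a6)
      have "{j. j < n \<and> ?x j < Suc e} = {j. j < n \<and> ?x j < e} \<union> {j. j < n \<and> ?x j = e}" by auto
      moreover have "card ({j. j < n \<and> ?x j < e} \<union> {j. j < n \<and> ?x j = e}) =
        ?b + card {j. j < n \<and> ?x j = e}" by (rule card_Un_disjoint) auto
      ultimately show ?case using 6 by (auto simp: less_Suc_eq)
    next
      case (5 r4 a4 r5 a5) then show ?case using less_W[of n] by simp
    qed (use v in auto)
    then show ?case using 1 assms v by auto
  next
    case (6 r1 a1 r2 a2) then show ?case using assms by simp
  next
    case 7
    have "\<sigma> * 28 \<le> \<sigma> * (60 * n)" using n2 by (intro mult_left_mono) auto
    moreover have "(\<sigma> + 1) * (100 * n) = \<sigma> * (40 * n) + \<sigma> * (60 * n) + 100 * n" by (simp add: algebra_simps)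
    ultimately show ?case using n2 by (simp only: exp_size.simps distrib_left)
  qed (use assms in \<open>auto simp: frame_def\<close>)
qed

lemma run_bits:
  assumes "r 0 = n" "r 4 = floor_log n" "r 5 = n div floor_log n + 1" "r 2 \<le> floor_log n"
    and v9: "\<forall>v\<le>n. a 9 v = floor_log v" and a15: "\<forall>i<n. a 15 i < n"
    and fresh: "\<forall>u<r 5. a 7 (r 2 * r 5 + u) = 0" and S: "S = a 15 ` {..<n}"
  shows "run record_level r a (200 * n) (\<lambda>r' a'. level a' (r 4) (r 5) (r 2) S \<and>
    (\<forall>i. i < r 2 * r 5 \<or> (r 2 + 1) * r 5 \<le> i \<longrightarrow> a' 7 i = a 7 i \<and> a' 8 i = a 8 i))"
proof -
  let ?b = "floor_log n" and ?J = "r 2"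
  define W where "W = n div floor_log n + 1"
  have r5: "r 5 = W" using assms by (simp add: W_def)
  have b0: "0 < ?b" using floor_log_rec[OF n2] by linarith
  have bn: "2 ^ ?b \<le> n" using floor_log_exp2_le n2 by simp
  have bn': "?b \<le> n" using bn less_exp[of ?b] by linarith
  have Wn: "W \<le> n + 1" by (simp add: W_def)
  \<comment> \<open>At most \<open>B\<close> earlier levels with \<open>n div B + 1\<close> words
    each take at most \<open>n + B\<close> cells, so all levels together fit into one linear
    array.\<close>
  have WJ: "?J * W + u < 8 * n" "?J * W + u < 2 ^ w" "?J * W < 2 ^ w" if "u < W" for u
  proof -
    have "?J * W \<le> ?b * W" using assms by (intro mult_right_mono) auto
    also have "\<dots> = ?b * (n div ?b) + ?b" by (simp add: W_def)
    also have "\<dots> \<le> n + n" using bn' by (intro add_mono) (auto simp: mult.commute div_times_less_eq_dividend)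
    finally have "?J * W + u \<le> 3 * n + 1" using that Wn by linarith
    then show "?J * W + u < 8 * n" "?J * W + u < 2 ^ w" "?J * W < 2 ^ w"
      using n2 by (auto intro!: less_W)
  qed
  have divW: "p div ?b < W" if "p < n" for p
    using that by (simp add: W_def div_le_mono less_Suc_eq_le)
  have wordb: "v < 2 ^ w" "v < 8 * n" "v \<le> n" if "\<And>r. bit (v::nat) r \<Longrightarrow> r < ?b" for v
  proof -
    have "v < 2 ^ ?b" using bits_less[of v ?b] that by blast
    then show "v < 2 ^ w" "v < 8 * n" "v \<le> n" using bn n2 by (auto intro!: less_W)
  qed
  let ?I = "\<lambda>i r' a'. (\<forall>u<W. \<forall>k. bit (a' 7 (?J * W + u)) k \<longleftrightarrow> k < ?b \<and> u * ?b + k \<in> a 15 ` {..<i}) \<and>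
     (\<forall>i. i < ?J * W \<or> (?J + 1) * W \<le> i \<longrightarrow> a' 7 i = a 7 i)"
  let ?I' = "\<lambda>u r' a'. r' 14 = pred_in S (u * ?b) \<and> (\<forall>u'<u. a' 8 (?J * W + u') = pred_in S (u' * ?b)) \<and>
     (\<forall>i. i < ?J * W \<or> (?J + 1) * W \<le> i \<longrightarrow> a' 8 i = a 8 i)"
  show ?thesis
    unfolding record_level_def
    apply (rule run_le)
     apply (rule run_seq'[OF run_set0])
     apply (rule run_seq'[where t = "70 * W + 30", OF run_For'[where hi = n and I = ?I and s = "50" and Q = "\<lambda>r' a'. ?I n r' a'"]])
           prefer 5
  proof goal_cases
    case (1 r1 a1 i r2 a2)
    then have v: "r2 0 = n" "r2 11 = i" "r2 4 = ?b" "r2 5 = W" "r2 2 = ?J" "a2 15 = a 15"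
      using assms r5 by (auto simp: frame_def)
    have I: "?I i r2 a2" using 1 by simp
    show ?case
    proof (intro conjI impI run_wp)
      assume i: "i < n"
      let ?q = "a 15 i"
      let ?u = "?q div ?b" and ?k = "?q mod ?b"
      let ?v = "a2 7 (?J * W + ?u) OR 2 ^ ?k"
      have q: "?q < n" using a15 i by simp
      have u: "?u < W" using divW[OF q] .
      have k: "?k < ?b" using b0 by simp
      have qq: "?u * ?b + ?k = ?q" by simp
      have vb: "bit ?v l \<longleftrightarrow> l < ?b \<and> ?u * ?b + l \<in> a 15 ` {..<Suc i}" for l
      proof -
        have "bit ?v l \<longleftrightarrow> (l < ?b \<and> ?u * ?b + l \<in> a 15 ` {..<i}) \<or> l = ?k"
          using I u by (auto simp: bit_or_iff bit_exp_iff)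
        moreover have "?u * ?b + l = ?q \<longleftrightarrow> l = ?k" by (metis add_left_cancel qq)
        ultimately show ?thesis using k by (auto simp: lessThan_Suc)
      qed
      have vW: "?v < 2 ^ w" using wordb(1)[of ?v] vb by blast
      have pW: "(2::nat) ^ ?k < 2 ^ w"
        by (rule wordb(1)) (use k in \<open>auto simp: bit_exp_iff\<close>)
      have other: "u * ?b + l \<noteq> ?q" if "u \<noteq> ?u" "l < ?b" for u l
        using that b0 by (metis add.commute div_less div_mult_self3 add_0_right less_not_refl)
      have "?k < n" using k bn' by simp
      then have sm: "?q < 2 ^ w" "?u < 2 ^ w" "?k < 2 ^ w"
        using q u Wn n2 by (intro less_W; linarith)+
      have c1: "\<forall>u<W. \<forall>k. bit (if u = ?u then ?v else a2 7 (?J * W + u)) k \<longleftrightarrow>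
          k < ?b \<and> u * ?b + k \<in> a 15 ` {..<Suc i}"
        using vb I other by (auto simp: lessThan_Suc)
      have c2: "\<forall>i'. i' < ?J * W \<or> (?J + 1) * W \<le> i' \<longrightarrow>
          (if i' = ?J * W + ?u then ?v else a2 7 i') = a 7 i'"
        using I u by auto
      show "wp (Assign 12 (Arr 15 (Var 11)) ;;
      Assign 13 (Bin Add (Bin Mul (Var 2) (Var 5)) (Bin Quot (Var 12) (Var 4))) ;;
      Put 7 (Var 13) (Bin Bit_Or (Arr 7 (Var 13))
        (Bin Shift_Left (Cnst 1) (Bin Rem (Var 12) (Var 4)))))
         (\<lambda>r'' a''. ?I (Suc i) (r''(11 := Suc i)) a'') r2 a2"
        using i sm WJ[OF u] pW vW W_bounds(2) c1 c2 by (auto simp: v)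
    qed (use v in auto)
  next
    case (6 r1 a1 r2 a2)
    then show ?case by simp
  next
    case (7 r1 a1 r2 a2)
    then have v: "r2 0 = n" "r2 4 = ?b" "r2 5 = W" "r2 2 = ?J" "a2 9 = a 9" "a2 8 = a 8"
      using assms r5 by (auto simp: frame_def)
    have I: "?I n r2 a2" using 7 by simp
    show ?case
      apply (rule run_le)
      apply (rule run_seq'[OF run_set0])
      apply (rule run_seq'[OF run_set0])
      apply (rule run_For'[where hi = W and I = ?I' and s = "60"])
          prefer 5
    proof goal_cases
      case (1 r3 a3 r4 a4 u r5 a5)
      then have v: "r5 0 = n" "r5 11 = u" "r5 4 = ?b" "r5 5 = W" "r5 2 = ?J" "a5 9 = a 9" "a5 7 = a2 7"
        using v by (auto simp: frame_def)
      have I': "?I' u r5 a5" using 1 by simp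
      show ?case
      proof (intro conjI impI run_wp)
        assume u: "u < W"
        let ?v = "a2 7 (?J * W + u)"
        have vb: "bit ?v l \<longleftrightarrow> l < ?b \<and> u * ?b + l \<in> S" for l using I u S by blast
        have vn: "?v < 2 ^ w" "?v < 8 * n" "?v \<le> n" using wordb[of ?v] vb by blast+
        have fl: "a 9 ?v = floor_log ?v" using v9 vn by simp
        have m: "pred_in S (?b + u * ?b) = (if ?v = 0 then pred_in S (u * ?b) else u * ?b + floor_log ?v)"
          using mx_word[OF vb] by (simp add: add.commute)
        have "u * ?b \<le> n div ?b * ?b" using u by (intro mult_le_mono1) (simp add: W_def)
        also have "\<dots> \<le> n" by simp
        finally have "u * ?b \<le> n" .
        moreover have "floor_log ?v \<le> n"
          using vb bit_floor_log[of ?v] bn' by (cases "?v = 0") fastforce+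
        ultimately have ub: "u * ?b < 2 ^ w" "u * ?b + floor_log ?v < 2 ^ w" "floor_log ?v < 2 ^ w"
          by (intro less_W; linarith)+
        show "wp (Assign 13 (Bin Add (Bin Mul (Var 2) (Var 5)) (Var 11)) ;;
      Put 8 (Var 13) (Var 14) ;;
      Assign 12 (Arr 7 (Var 13)) ;;
      Cond (Lt (Cnst 0) (Var 12))
        (Assign 14 (Bin Add (Bin Mul (Var 11) (Var 4)) (Arr 9 (Var 12)))) Skip)
          (\<lambda>r'' a''. ?I' (Suc u) (r''(11 := Suc u)) a'') r5 a5"
          using I' u WJ[OF u] vn W_bounds(1) ub m
          by (auto simp: v All_less_Suc fl)
      qed (use v in auto)
    next
      case (6 r3 a3 r4 a4 r5 a5)
      then have eq: "a5 7 = a2 7" by (auto simp: frame_def)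
      have I6: "?I' W r5 a5" using 6 by simp
      show ?case unfolding level_def r5 assms(2) eq S
        using I I6[unfolded S] by (intro conjI allI impI; blast)
    next
      case (2 r3 a3 r4 a4)
      then show ?case using v by (auto simp: frame_def pred_in_def)
    next
      case 5 then show ?case using n2 Wn by (intro less_W) linarith
    next
      case 7 then show ?case by simp
    qed (auto simp: frame_def)
  next
    case 8 then show ?case using Wn n2 by simp
  next
    case (2 r1 a1) then show ?case using fresh assms r5 by (auto simp: frame_def)
  next
    case 5 then show ?case using less_W by simp
  qed auto
qed

lemma run_msbtab:
  assumes "r 0 = n" "\<forall>i\<le>n. a 9 i = 0"
  shows "run msb_table r a (100 * n) (\<lambda>r' a'. (\<forall>v\<le>n. a' 9 v = floor_log v) \<and>
    r' 4 = floor_log n \<and> r' 5 = n div floor_log n + 1)"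
proof -
  let ?I = "\<lambda>i r' a'. (\<forall>v<i. a' 9 v = floor_log v)"
  have fl: "floor_log v \<le> n" if "v \<le> n" for v
    using that by (metis bit_floor_log bit_imp_le floor_log_zero le_trans less_exp less_or_eq_imp_le not_gr_zero)
  show ?thesis
    unfolding msb_table_def
    apply (rule run_le)
     apply (rule run_seq'[OF run_set[where Q = "\<lambda>r' a'. r' 11 = 2 \<and> a' = a" and t = 2]])
        apply (use n2 in simp_all)[3]
     apply (rule run_seq'[where t = 30, OF run_For'[where hi = "n + 1" and I = ?I and s = "20" and Q = "\<lambda>r' a'. ?I (n + 1) r' a'"]])
          prefer 5
  proof goal_cases
    case (1 r1 a1 i r2 a2)
    then have v: "r2 0 = n" "r2 11 = i" "i \<le> n + 1" "2 \<le> i" using assms by (auto simp: frame_def)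
    have b: "i < 2 ^ w" "n + 1 < 2 ^ w" "(2::nat) < 2 ^ w" "i div 2 < 2 ^ w" "Suc (floor_log i) < 2 ^ w" if "i \<le> n"
      using that fl[of i] n2 by (auto intro!: less_W)
    show ?case
    proof (intro conjI impI run_wp)
      assume i: "i < n + 1"
      have "floor_log i = floor_log (i div 2) + 1" using v(4) floor_log_rec by simp
      moreover have "i div 2 < i" using v by simp
      moreover have h: "a2 9 (i div 2) = floor_log (i div 2)" using 1 calculation by blast
      ultimately show "wp (Put 9 (Var 11) (Bin Add (Arr 9 (Bin Quot (Var 11) (Cnst 2))) (Cnst 1)))
        (\<lambda>r'' a''. ?I (Suc i) (r''(11 := Suc i)) a'') r2 a2"
        using 1 b i W_bounds(2) n2 by (auto simp: v h less_Suc_eq simp del: floor_log_half)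
    qed (use v b less_W[of "n+1"] n2 W_bounds(2) in auto)
  next
    case (7 r1 a1 r2 a2)
    then have v: "r2 0 = n" "a2 9 n = floor_log n" "\<forall>v\<le>n. a2 9 v = floor_log v"
      using assms by (auto simp: frame_def)
    have "n div floor_log n \<le> n" by simp
    then have "n div floor_log n < 2 ^ w" "Suc (n div floor_log n) < 2 ^ w"
      using n2 by (intro less_W; linarith)+
    then show ?case
      using n2 v W_bounds(2) by (intro run_wp) simp_all
  next
    case (2 r1 a1)
    have "v < 2 \<Longrightarrow> floor_log v = 0" for v by (simp add: floor_log.simps)
    then show ?case using 2 assms n2 by auto
  next
    case (5 r1 a1) then show ?case using n2 by (intro less_W) simp
  next
    case 8 show ?case using n2 by simp
  qed (use n2 in auto)
qed

end

section \<open>Names of all levels by repeated doubling\<close>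

definition double_step :: com where
  "double_step = Assign 10 (Var 3) ;; pairname ;;
     Assign 11 (Cnst 0) ;; For 11 (Var 0) (Put 15 (Var 11) (Arr 6 (Var 11))) ;;
     Assign 2 (Bin Add (Var 2) (Cnst 1)) ;; Assign 3 (Bin Mul (Var 3) (Cnst 2)) ;; record_level"

definition doubling :: com where
  "doubling = Assign 2 (Cnst 0) ;; Assign 3 (Cnst 1) ;; record_level ;;
     While (Lt (Bin Mul (Var 3) (Cnst 2)) (Bin Add (Var 7) (Cnst 1))) double_step ;;
     Assign 10 (Bin Sub (Var 7) (Var 3)) ;; pairname"

definition preprocess :: "nat \<Rightarrow> com" where
  "preprocess \<sigma> = Assign 7 (Var 1) ;; letter_names \<sigma> ;; msb_table ;; doubling"

lemma wv_bits: "written_vars record_level = {11, 12, 13, 14}" and wa_bits: "written_arrs record_level = {7, 8}"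
  by (auto simp: record_level_def)

lemma wv_pairname: "written_vars pairname = {11, 12, 13, 15}" and wa_pairname: "written_arrs pairname = {2, 3, 4, 5, 6}"
  by (auto simp: pairname_def)

lemma wv_double: "written_vars double_step = {2, 3, 10, 11, 12, 13, 14, 15}"
  and wa_double: "written_arrs double_step = {2, 3, 4, 5, 6, 7, 8, 15}"
  by (auto simp: double_step_def wv_bits wa_bits wv_pairname wa_pairname)

lemma wv_doubling: "written_vars doubling = {2, 3, 10, 11, 12, 13, 14, 15}"
  and wa_doubling: "written_arrs doubling = {2, 3, 4, 5, 6, 7, 8, 15}"
  by (auto simp: doubling_def wv_bits wa_bits wv_pairname wa_pairname wv_double wa_double)

lemma wv_initnames: "written_vars (letter_names \<sigma>) = {10, 11, 13, 14}" and wa_initnames: "written_arrs (letter_names \<sigma>) = {15}"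
  by (auto simp: letter_names_def)

lemma wv_msbtab: "written_vars msb_table = {4, 5, 11}" and wa_msbtab: "written_arrs msb_table = {9}"
  by (auto simp: msb_table_def)

lemmas written_preprocess = wv_bits wa_bits wv_pairname wa_pairname wv_double wa_double wv_doubling wa_doubling
  wv_initnames wa_initnames wv_msbtab wa_msbtab

context wram
begin

abbreviation "B \<equiv> floor_log n"
abbreviation "WD \<equiv> n div floor_log n + 1"

text \<open>The last conjunct keeps the words of levels not yet recorded at zero;
  \<open>record_level\<close> only adds bits and relies on it.\<close>

definition names_inv :: "(nat \<Rightarrow> nat) \<Rightarrow> nat \<Rightarrow> regs \<Rightarrow> arrs \<Rightarrow> bool" where
  "names_inv x m r a \<longleftrightarrow> r 0 = n \<and> r 4 = B \<and> r 5 = WD \<and> r 7 = m \<and> r 3 = 2 ^ r 2 \<and> 2 ^ r 2 \<le> m \<and>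
     (\<forall>v\<le>n. a 9 v = floor_log v) \<and> (\<forall>i<n. a 15 i = block_name n x (r 2) i) \<and>
     (\<forall>j\<le>r 2. level a B WD j (block_name n x j ` {..<n})) \<and> (\<forall>i. (r 2 + 1) * WD \<le> i \<longrightarrow> a 7 i = 0)"

lemma run_bits_dinv:
  assumes "r 0 = n" "r 4 = B" "r 5 = WD" "r 7 = m" "r 3 = 2 ^ r 2" "2 ^ r 2 \<le> m" "m < n"
     "\<forall>v\<le>n. a 9 v = floor_log v" "\<forall>i<n. a 15 i = block_name n x (r 2) i"
     "\<forall>j<r 2. level a B WD j (block_name n x j ` {..<n})" "\<forall>i. r 2 * WD \<le> i \<longrightarrow> a 7 i = 0"
  shows "run record_level r a (200 * n) (\<lambda>r' a'. names_inv x m r' a' \<and> r' 2 = r 2)"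
proof (rule run_mono[OF run_bits[OF assms(1-3), where S = "block_name n x (r 2) ` {..<n}"] order_refl])
  have "2 ^ r 2 \<le> n" using assms by linarith
  then show "r 2 \<le> B" using floor_log_power floor_log_mono by (metis monoD)
  show "\<forall>i<n. a 15 i < n" using assms nm_less[OF n0] by simp
  show "block_name n x (r 2) ` {..<n} = a 15 ` {..<n}" using assms by (intro image_cong) auto
  show "\<forall>u<r 5. a 7 (r 2 * r 5 + u) = 0" using assms by simp
  fix r' a' assume f: "frame record_level r a r' a'" and h: "level a' (r 4) (r 5) (r 2) (block_name n x (r 2) ` {..<n}) \<and>
    (\<forall>i. i < r 2 * r 5 \<or> (r 2 + 1) * r 5 \<le> i \<longrightarrow> a' 7 i = a 7 i \<and> a' 8 i = a 8 i)"
  have v: "r' 0 = n" "r' 4 = B" "r' 5 = WD" "r' 7 = m" "r' 3 = 2 ^ r 2" "r' 2 = r 2"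
    "a' 9 = a 9" "a' 15 = a 15"
    using f assms by (auto simp: frame_def written_preprocess)
  have "level a' B WD j (block_name n x j ` {..<n})" if j: "j \<le> r 2" for j
  proof (cases "j = r 2")
    case True then show ?thesis using h assms by simp
  next
    case False
    then have "j < r 2" using j by simp
    then have "(j + 1) * W \<le> r 2 * W" for W by (intro mult_right_mono) auto
    then have "j * W + u < r 2 * W" if "u < W" for u W
      using that by (metis add.commute add_less_cancel_right mult_Suc order_less_le_trans plus_1_eq_Suc)
    then have *: "a' 7 (j * WD + u) = a 7 (j * WD + u)" "a' 8 (j * WD + u) = a 8 (j * WD + u)"
      if "u < WD" for u
      using h that unfolding assms(3) by blast+
    have "level a B WD j (block_name n x j ` {..<n})" using assms(10) \<open>j < r 2\<close> by blast
    then show ?thesis by (rule level_cong) (use * in blast)+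
  qed
  moreover have "a' 7 i = 0" if "(r 2 + 1) * WD \<le> i" for i
    using h assms that by (metis add.commute le_trans le_add2 mult_Suc plus_1_eq_Suc)
  ultimately show "names_inv x m r' a' \<and> r' 2 = r 2" using assms v by (simp add: names_inv_def)
qed (use assms in auto)

lemma sh_cong:
  assumes "\<And>i. i < n \<Longrightarrow> f i = f' i"
  shows "shift n d f i = shift n d f' i"
  using assms n0 by (simp add: shift_def)

lemma run_double_step:
  assumes "names_inv x m r a" "2 * 2 ^ r 2 \<le> m" "m < n"
  shows "run double_step r a (550 * n) (\<lambda>r' a'. names_inv x m r' a' \<and> r' 2 = r 2 + 1)"
proof -
  note d = assms(1)[unfolded names_inv_def]
  have rk15: "sparse_rank n (a 15)" using rk_cong[of n "block_name n x (r 2)" "a 15"] rk_nm[OF n0] d by auto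
  have b: "r 2 + 1 < 2 ^ w" "2 ^ r 2 * 2 < (2::nat) ^ w" "2 < (2::nat) ^ w"
    using assms(2,3) less_exp[of "r 2"] n2 by (intro less_W; linarith)+
  let ?f = "refine_rank n (a 15) (shift n (r 3) (a 15))"
  show ?thesis
    unfolding double_step_def
    apply (rule run_le)
     apply (rule run_seq'[OF run_wp[where Q = "\<lambda>r' a'. r' 10 = r 3 \<and> a' = a", OF _ order_refl]])
      apply simp
     apply (rule run_seq'[OF run_pairname])
        apply (use d rk15 assms in \<open>auto simp: frame_def\<close>)[3]
     apply (rule run_seq'[OF run_set0])
     apply (rule run_seq'[where t = "200 * n + 50", OF run_For'[where hi = n and s = 20 and I = "\<lambda>i r' a'. \<forall>j<i. a' 15 j = ?f j"
           and Q = "\<lambda>r' a'. \<forall>j<n. a' 15 j = ?f j"]])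
           prefer 5
  proof goal_cases
    case (1 r1 a1 r2 a2 r3 a3 i r4 a4)
    then have v: "r4 0 = n" "r4 11 = i" "a4 6 = a2 6" "i \<le> n" "\<forall>j<n. a2 6 j = ?f j"
      using d by (auto simp: frame_def written_preprocess)
    show ?case
    proof (intro conjI impI run_wp)
      assume i: "i < n"
      have "?f i < n" using rk_less[OF rk_pr[OF rk15] i] .
      then have "?f i < 2 ^ w" by (intro less_W) simp
      then show "wp (Put 15 (Var 11) (Arr 6 (Var 11)))
         (\<lambda>r'' a''. \<forall>j<Suc i. a'' 15 j = ?f j) r4 a4"
        using i v 1 by (auto simp: All_less_Suc)
    qed (use v in auto)
  next
    case (7 r1 a1 r2 a2 r3 a3 r4 a4)
    then have v: "r4 0 = n" "r4 2 = r 2" "r4 3 = r 3" "r4 4 = r 4" "r4 5 = r 5" "r4 7 = r 7"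
      "a4 7 = a 7" "a4 8 = a 8" "a4 9 = a 9" "\<forall>j<n. a4 15 j = ?f j"
      using d by (auto simp: frame_def written_preprocess)
    have f: "?f i = block_name n x (Suc (r 2)) i" if "i < n" for i
      using d that pr_cong[of n "a 15" "block_name n x (r 2)" "shift n (2 ^ r 2) (a 15)" "shift n (2 ^ r 2) (block_name n x (r 2))" i]
        sh_cong[of "a 15" "block_name n x (r 2)"] by auto
    show ?case
    proof (rule run_le)
      show "run (Assign 2 (Bin Add (Var 2) (Cnst 1)) ;; Assign 3 (Bin Mul (Var 3) (Cnst 2)) ;; record_level) r4 a4
         (4 + (4 + 200 * n)) (\<lambda>r' a'. names_inv x m r' a' \<and> r' 2 = r 2 + 1)"
      proof (rule run_seq'[OF run_wp[where Q = "\<lambda>r' a'. r' = r4(2 := r 2 + 1) \<and> a' = a4"]],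
          (use v b W_bounds(2) in \<open>auto\<close>)[2],
          rule run_seq'[OF run_wp[where Q = "\<lambda>r' a'. r' = r4(2 := r 2 + 1, 3 := 2 ^ (r 2 + 1)) \<and> a' = a4"]],
          (use v b d in \<open>auto simp: mult.commute\<close>)[2], goal_cases)
        case (1 r5 a5 r6 a6)
        have lv: "level a4 B WD j (block_name n x j ` {..<n})" if "j \<le> r 2" for j
        proof -
          have "level a B WD j (block_name n x j ` {..<n})" using d that by blast
          then show ?thesis by (rule level_cong) (simp_all add: v)
        qed
        show ?case
          by (rule run_mono[OF run_bits_dinv order_refl]) (use 1 v d f assms lv in auto)
      qed
    qed (use n2 in auto)
  next
    case 8 show ?case using n2 by simp
  qed (use less_W[of n] in \<open>auto simp: frame_def\<close>)
qed

text \<open>The potential of the loop is the number of doublings left, times the cost of one. The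
  final naming of windows writes to array 6 and leaves array 15 alone, where later queries find the
  names of the top level.\<close>

lemma run_doubling:
  assumes "r 0 = n" "r 4 = B" "r 5 = WD" "r 7 = m" "0 < m" "m < n"
     "\<forall>v\<le>n. a 9 v = floor_log v" "\<forall>i<n. a 15 i = block_name n x 0 i" "\<forall>i. a 7 i = 0"
  shows "run doubling r a (700 * n * (floor_log m + 1)) (\<lambda>r' a'. names_inv x m r' a' \<and> r' 2 = floor_log m \<and>
    (\<forall>i<n. a' 6 i = window_name n x m i))"
proof -
  let ?L = "floor_log m"
  let ?I = "\<lambda>r' a'. names_inv x m r' a'"
  have L: "j \<le> ?L" if "2 ^ j \<le> m" for j
    using floor_log_power floor_log_mono that by (metis monoD)
  show ?thesis
    unfolding doubling_def
    apply (rule run_le)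
     apply (rule run_seq'[OF run_set0])
     apply (rule run_seq'[OF run_set[where t = 2 and Q = "\<lambda>r' a'. r' 3 = 1 \<and> a' = a"]])
        apply (use n2 in \<open>auto\<close>)[3]
     apply (rule run_seq'[OF run_mono[where Q' = ?I, OF run_bits_dinv[where m = m and x = x] order_refl]])
                 apply (use assms in \<open>auto simp: frame_def\<close>)[12]
     apply (rule run_seq'[where t = "220 * n + 60"])
      apply (rule run_while[where I = ?I and \<Psi> = "\<lambda>r' a'. real ((?L - r' 2) * (600 * n))" and
         t = "?L * (600 * n) + 20" and Q = "\<lambda>r' a'. names_inv x m r' a' \<and> r' 2 = ?L"])
  proof goal_cases
    case (2 r1 a1 r2 a2 r3 a3 r4 a4)
    note d = 2(8)
    note d' = d[unfolded names_inv_def]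
    have b: "2 ^ r4 2 * 2 < (2::nat) ^ w" "m + 1 < (2::nat) ^ w" "2 < (2::nat) ^ w"
      using d' assms(6) n2 by (intro less_W; linarith)+
    show ?case
    proof (intro conjI impI)
      assume "eval_bexp r4 a4 (Lt (Bin Mul (Var 3) (Cnst 2)) (Bin Add (Var 7) (Cnst 1)))"
      then have le: "2 * 2 ^ r4 2 \<le> m" using d' by simp
      then have "r4 2 < ?L" using L[of "Suc (r4 2)"] by simp
      then have *: "?L - r4 2 = Suc (?L - (r4 2 + 1))" by simp
      show "\<exists>s. run double_step r4 a4 s (\<lambda>r'' a''. names_inv x m r'' a'' \<and>
          real ((?L - r'' 2) * (600 * n)) +
          real (s + bexp_size (Lt (Bin Mul (Var 3) (Cnst 2)) (Bin Add (Var 7) (Cnst 1))) + 2)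
          \<le> real ((?L - r4 2) * (600 * n)))"
        unfolding *
        by (rule exI, rule run_mono[OF run_double_step[OF d le assms(6)] order_refl])
          (use n2 in \<open>simp flip: of_nat_add of_nat_mult\<close>)
    qed (use d' b W_bounds(2) in auto)
  next
    case (3 r1 a1 r2 a2 r3 a3 r4 a4)
    then have d': "names_inv x m r4 a4" "\<not> 2 * 2 ^ r4 2 \<le> m" by (auto simp: names_inv_def)
    then have "floor_log m = r4 2" using assms(5) by (intro floor_log_eqI) (auto simp: names_inv_def)
    then show ?case using d' by simp
  next
    case (4 r1 a1 r2 a2 r3 a3)
    have "(?L - r3 2) * (600 * n) \<le> ?L * (600 * n)" by (intro mult_right_mono) auto
    then have "real ((?L - r3 2) * (600 * n)) \<le> real (?L * (600 * n))" by (simp only: of_nat_le_iff)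
    then show ?case unfolding bexp_size.simps exp_size.simps of_nat_add by (simp only: of_nat_numeral of_nat_1)
  next
    case (5 r1 a1 r2 a2 r3 a3 r4 a4)
    then have d: "names_inv x m r4 a4" and L4: "r4 2 = ?L" by auto
    note d' = d[unfolded names_inv_def]
    have rk15: "sparse_rank n (a4 15)" using rk_cong[of n "block_name n x (r4 2)" "a4 15"] rk_nm[OF n0] d' by auto
    have b: "m - 2 ^ ?L < 2 ^ w" using assms by (intro less_W) simp
    have f: "refine_rank n (a4 15) (shift n (m - 2 ^ ?L) (a4 15)) i = window_name n x m i" if "i < n" for i
      unfolding window_name_def using d' that L4 sh_cong[of "a4 15" "block_name n x ?L"] by (intro pr_cong) auto
    show ?case
      apply (rule run_le)
       apply (rule run_seq'[OF run_wp[where Q = "\<lambda>r' a'. r' = r4(10 := m - 2 ^ ?L) \<and> a' = a4", OF _ order_refl]])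
        apply (use b d' L4 in simp)
       apply (rule run_mono[OF run_pairname order_refl])
          apply (use d' rk15 assms in \<open>auto\<close>)[3]
       subgoal premises p for r5 a5 r6 a6
       proof -
         have v: "r6 0 = n" "r6 2 = r4 2" "r6 3 = r4 3" "r6 4 = r4 4" "r6 5 = r4 5" "r6 7 = r4 7"
           "a6 7 = a4 7" "a6 8 = a4 8" "a6 9 = a4 9" "a6 15 = a4 15"
           using p d' by (auto simp: frame_def written_preprocess)
         have "level a6 B WD j (block_name n x j ` {..<n})" if "j \<le> r4 2" for j
         proof -
           have "level a4 B WD j (block_name n x j ` {..<n})" using d' that by blast
           then show ?thesis by (rule level_cong) (simp_all add: v)
         qed
         moreover have "a6 6 i = window_name n x m i" if "i < n" for i using p f[OF that] that by simp
         ultimately show ?thesis using d' L4 by (simp add: names_inv_def v)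
       qed
      apply simp
      done
  next
    case 6 show ?case using n2 by (simp add: algebra_simps)
  qed
qed

lemma run_prep:
  assumes "r 0 = n" "r 1 = m" "0 < m" "m < n" "\<forall>i<n. a 0 i < \<sigma>" "\<sigma> < 2 ^ w"
    "\<forall>k>0. \<forall>i. a k i = 0"
  shows "run (preprocess \<sigma>) r a ((1000 + 100 * \<sigma>) * n * (floor_log m + 1)) (\<lambda>r' a'. names_inv (a 0) m r' a' \<and>
    r' 2 = floor_log m \<and> (\<forall>i<n. a' 6 i = window_name n (a 0) m i))"
  unfolding preprocess_def
  apply (rule run_le)
   apply (rule run_seq'[OF run_wp[where Q = "\<lambda>r' a'. r' = r(7 := m) \<and> a' = a", OF _ order_refl]])
    apply (use assms in simp)
   apply (rule run_seq'[OF run_initnames])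
      apply (use assms in \<open>auto simp: frame_def\<close>)[3]
   apply (rule run_seq'[OF run_msbtab])
     apply (use assms in \<open>auto simp: frame_def written_preprocess\<close>)[2]
   apply (rule run_mono[OF run_doubling[where m = m and x = "a 0"] order_refl])
            apply (use assms in \<open>auto simp: frame_def written_preprocess\<close>)[9]
   apply (use assms in \<open>auto simp: frame_def written_preprocess\<close>)[1]
  apply (use n2 in \<open>simp add: algebra_simps trans_le_add1\<close>)
  done

end

section \<open>Grouping by keys in place\<close>

definition key_count :: "(nat \<Rightarrow> nat) \<Rightarrow> nat \<Rightarrow> nat \<Rightarrow> nat \<Rightarrow> nat" where
  "key_count K a p k = card {q. a \<le> q \<and> q < p \<and> K q = k}"

lemma cn_self [simp]: "key_count K a a k = 0"
  by (auto simp: key_count_def)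

lemma cn_Suc: "a \<le> p \<Longrightarrow> key_count K a (Suc p) k = key_count K a p k + (if K p = k then 1 else 0)"
proof -
  assume "a \<le> p"
  then have "{q. a \<le> q \<and> q < Suc p \<and> K q = k} =
    {q. a \<le> q \<and> q < p \<and> K q = k} \<union> (if K p = k then {p} else {})" by (auto simp: less_Suc_eq)
  then show ?thesis by (auto simp: key_count_def)
qed

lemma cn_less: "a \<le> q \<Longrightarrow> q < p \<Longrightarrow> key_count K a q (K q) < key_count K a p (K q)"
  unfolding key_count_def by (rule card_psubset_less[where x = q]) auto

lemma cn_pos: "a \<le> q \<Longrightarrow> q < b \<Longrightarrow> 0 < key_count K a b (K q)"
  using cn_less[of a q b K] by simp

lemma cn_eq_0: "(\<And>q. a \<le> q \<Longrightarrow> q < p \<Longrightarrow> K q \<noteq> k) \<Longrightarrow> key_count K a p k = 0"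
  by (auto simp: key_count_def)

type_synonym task = "nat \<times> nat \<times> nat \<times> nat \<times> nat"

text \<open>Positions \<open>a, \<dots>, b - 1\<close> with the keys \<open>K\<close> are distributed over consecutive blocks of \<open>T\<close>,
  the block of the key \<open>k\<close> being \<open>s k, \<dots>, s k + key_count K a b k - 1\<close>; the set \<open>Z\<close> contains the keys
  whose block has been reserved, and \<open>ks\<close> those for which a task has been pushed.\<close>

definition dist_inv_at :: "nat \<Rightarrow> nat \<Rightarrow> nat \<Rightarrow> (nat \<Rightarrow> nat) \<Rightarrow> (nat \<Rightarrow> nat) \<Rightarrow> nat \<Rightarrow> nat \<times> nat \<times> nat \<Rightarrow>
    nat set \<Rightarrow> nat \<Rightarrow> (nat \<Rightarrow> nat) \<Rightarrow> (nat \<Rightarrow> nat) \<Rightarrow> (nat \<Rightarrow> nat) \<Rightarrow> nat \<Rightarrow> nat \<Rightarrow> (nat \<Rightarrow> task) \<Rightarrow>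
    (nat \<Rightarrow> nat) \<Rightarrow> nat list \<Rightarrow> bool" where
  "dist_inv_at n a b K P sp0 g Z p C X T cur sp tk s ks \<longleftrightarrow>
     cur = a + card {q. a \<le> q \<and> q < b \<and> K q \<in> Z} \<and>
     (\<forall>k\<in>Z. a \<le> s k \<and> s k + key_count K a b k \<le> cur \<and> X k = s k + key_count K a p k) \<and>
     (\<forall>k\<in>Z. \<forall>k'\<in>Z. k \<noteq> k' \<longrightarrow> s k + key_count K a b k \<le> s k' \<or> s k' + key_count K a b k' \<le> s k) \<and>
     (\<forall>k<n. C k = (if k \<in> Z then 0 else key_count K a b k)) \<and>
     (\<forall>q. a \<le> q \<and> q < p \<longrightarrow> T (s (K q) + key_count K a q (K q)) = P q) \<and>
     distinct ks \<and> set ks = {k \<in> Z. 2 \<le> key_count K a b k} \<and> sp = sp0 + length ks \<and> length ks \<le> cur - a \<and>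
     (\<forall>t<length ks. tk (sp0 + t) = (s (ks ! t), s (ks ! t) + key_count K a b (ks ! t), g) \<and>
        t \<le> s (ks ! t) - a \<and> (\<forall>t'<t. s (ks ! t') + key_count K a b (ks ! t') \<le> s (ks ! t)))"

definition dist_inv :: "nat \<Rightarrow> nat \<Rightarrow> nat \<Rightarrow> (nat \<Rightarrow> nat) \<Rightarrow> (nat \<Rightarrow> nat) \<Rightarrow> nat \<Rightarrow> nat \<times> nat \<times> nat \<Rightarrow>
    nat set \<Rightarrow> nat \<Rightarrow> (nat \<Rightarrow> nat) \<Rightarrow> (nat \<Rightarrow> nat) \<Rightarrow> (nat \<Rightarrow> nat) \<Rightarrow> nat \<Rightarrow> nat \<Rightarrow> (nat \<Rightarrow> task) \<Rightarrow> bool" where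
  "dist_inv n a b K P sp0 g Z p C X T cur sp tk \<longleftrightarrow>
     (\<exists>s ks. dist_inv_at n a b K P sp0 g Z p C X T cur sp tk s ks)"

lemma ginv_bounds:
  assumes "dist_inv n a b K P sp0 g Z p C X T cur sp tk" "a \<le> b"
  shows "a \<le> cur" "cur \<le> b" "sp0 \<le> sp" "sp \<le> sp0 + (cur - a)"
proof -
  have "card {q. a \<le> q \<and> q < b \<and> K q \<in> Z} \<le> card {a..<b}" by (intro card_mono) auto
  then show "a \<le> cur" "cur \<le> b" "sp0 \<le> sp" "sp \<le> sp0 + (cur - a)" using assms by (auto simp: dist_inv_def dist_inv_at_def)
qed

lemma ginv_alloc_bound:
  assumes "dist_inv n a b K P sp0 g Z p C X T cur sp tk" "k \<notin> Z" "a \<le> b"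
  shows "cur + key_count K a b k \<le> b"
proof -
  have "card ({q. a \<le> q \<and> q < b \<and> K q \<in> Z} \<union> {q. a \<le> q \<and> q < b \<and> K q = k}) \<le> card {a..<b}"
    by (intro card_mono) auto
  moreover have "card ({q. a \<le> q \<and> q < b \<and> K q \<in> Z} \<union> {q. a \<le> q \<and> q < b \<and> K q = k}) =
     card {q. a \<le> q \<and> q < b \<and> K q \<in> Z} + key_count K a b k"
    unfolding key_count_def by (intro card_Un_disjoint) (use assms in auto)
  ultimately show ?thesis using assms by (auto simp: dist_inv_def dist_inv_at_def)
qed

text \<open>A block is reserved at \<open>cur\<close> when its key is first met. No element with
  that key has been placed yet, so earlier placements are unaffected, and the blocks stay disjoint
  because all reserved ones end by \<open>cur\<close>.\<close>

lemma ginv_alloc: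
  assumes "dist_inv n a b K P sp0 g Z p C X T cur sp tk" "k \<notin> Z" "k < n" "0 < key_count K a b k" "key_count K a p k = 0"
    "K ` {a..<p} \<subseteq> Z" "tk' = (if 1 < key_count K a b k then tk(sp := (cur, cur + key_count K a b k, g)) else tk)"
    "sp' = (if 1 < key_count K a b k then sp + 1 else sp)"
  shows "dist_inv n a b K P sp0 g (insert k Z) p (C(k := 0)) (X(k := cur)) T (cur + key_count K a b k) sp' tk'"
proof -
  obtain s ks where G: "dist_inv_at n a b K P sp0 g Z p C X T cur sp tk s ks"
    using assms(1) by (auto simp: dist_inv_def)
  from G have 1: "cur = a + card {q. a \<le> q \<and> q < b \<and> K q \<in> Z}"
     and 2: "\<And>k. k \<in> Z \<Longrightarrow> a \<le> s k \<and> s k + key_count K a b k \<le> cur \<and> X k = s k + key_count K a p k"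
     and 3: "\<And>k k'. k \<in> Z \<Longrightarrow> k' \<in> Z \<Longrightarrow> k \<noteq> k' \<Longrightarrow> s k + key_count K a b k \<le> s k' \<or> s k' + key_count K a b k' \<le> s k"
     and 4: "\<And>k. k < n \<Longrightarrow> C k = (if k \<in> Z then 0 else key_count K a b k)"
     and 5: "\<And>q. a \<le> q \<Longrightarrow> q < p \<Longrightarrow> T (s (K q) + key_count K a q (K q)) = P q"
     and 6: "distinct ks" "set ks = {k \<in> Z. 2 \<le> key_count K a b k}" "sp = sp0 + length ks" "length ks \<le> cur - a"
     and 7: "\<And>t. t < length ks \<Longrightarrow> tk (sp0 + t) = (s (ks ! t), s (ks ! t) + key_count K a b (ks ! t), g) \<and>
        t \<le> s (ks ! t) - a \<and> (\<forall>t'<t. s (ks ! t') + key_count K a b (ks ! t') \<le> s (ks ! t))"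
    unfolding dist_inv_at_def by blast+
  let ?s = "s(k := cur)" and ?c = "key_count K a b k"
  let ?ks = "if 1 < ?c then ks @ [k] else ks"
  have "card ({q. a \<le> q \<and> q < b \<and> K q \<in> Z} \<union> {q. a \<le> q \<and> q < b \<and> K q = k}) =
     card {q. a \<le> q \<and> q < b \<and> K q \<in> Z} + ?c"
    unfolding key_count_def by (intro card_Un_disjoint) (use assms in auto)
  moreover have "{q. a \<le> q \<and> q < b \<and> K q \<in> Z} \<union> {q. a \<le> q \<and> q < b \<and> K q = k} =
     {q. a \<le> q \<and> q < b \<and> K q \<in> insert k Z}" by auto
  ultimately have c1: "cur + ?c = a + card {q. a \<le> q \<and> q < b \<and> K q \<in> insert k Z}" using 1 by simp
  have nk: "ks ! t \<noteq> k" "ks ! t \<in> Z" if "t < length ks" for t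
    using nth_mem[OF that] 6(2) assms(2) by auto
  have Kq: "K q \<noteq> k" if "a \<le> q" "q < p" for q using that assms(2) subsetD[OF assms(6), of "K q"] by auto
  have "\<forall>t<length ?ks. tk' (sp0 + t) = (?s (?ks ! t), ?s (?ks ! t) + key_count K a b (?ks ! t), g) \<and>
        t \<le> ?s (?ks ! t) - a \<and> (\<forall>t'<t. ?s (?ks ! t') + key_count K a b (?ks ! t') \<le> ?s (?ks ! t))"
  proof (intro allI impI)
    fix t assume t: "t < length ?ks"
    show "tk' (sp0 + t) = (?s (?ks ! t), ?s (?ks ! t) + key_count K a b (?ks ! t), g) \<and>
        t \<le> ?s (?ks ! t) - a \<and> (\<forall>t'<t. ?s (?ks ! t') + key_count K a b (?ks ! t') \<le> ?s (?ks ! t))"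
    proof (cases "t < length ks")
      case True
      have "?ks ! t' = ks ! t'" if "t' \<le> t" for t' using True that by (simp add: nth_append)
      then show ?thesis using 7[OF True] nk True assms(7) 6(3) by auto
    next
      case False
      then have t: "t = length ks" "1 < ?c" using t by (auto split: if_splits)
      then show ?thesis using assms(7) 6 2 nk by (auto simp: nth_append)
    qed
  qed
  moreover have "\<forall>k'\<in>insert k Z. a \<le> ?s k' \<and> ?s k' + key_count K a b k' \<le> cur + ?c \<and>
     (X(k := cur)) k' = ?s k' + key_count K a p k'"
    using 1 2 assms(2,5) by (auto intro: trans_le_add1)
  moreover have "\<forall>k1\<in>insert k Z. \<forall>k2\<in>insert k Z. k1 \<noteq> k2 \<longrightarrow>
      ?s k1 + key_count K a b k1 \<le> ?s k2 \<or> ?s k2 + key_count K a b k2 \<le> ?s k1"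
    using 2 3 assms(2) by auto
  moreover have "\<forall>k'<n. (C(k := 0)) k' = (if k' \<in> insert k Z then 0 else key_count K a b k')"
    using 4 by auto
  moreover have "\<forall>q. a \<le> q \<and> q < p \<longrightarrow> T (?s (K q) + key_count K a q (K q)) = P q" using 5 Kq by auto
  moreover have "distinct ?ks \<and> set ?ks = {k' \<in> insert k Z. 2 \<le> key_count K a b k'} \<and> sp' = sp0 + length ?ks \<and>
     length ?ks \<le> cur + ?c - a"
  proof (cases "1 < ?c")
    case True
    have "length ks + 1 \<le> cur + ?c - a" using 6(4) True 1 by linarith
    moreover have "{k' \<in> insert k Z. 2 \<le> key_count K a b k'} = insert k (set ks)" unfolding 6(2) using True by auto
    moreover have "k \<notin> set ks" unfolding 6(2) using assms(2) by simp
    ultimately show ?thesis using True assms(8) 6(1,3) by simp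
  next
    case False
    have "length ks \<le> cur + ?c - a" using 6(4) by linarith
    moreover have "{k' \<in> insert k Z. 2 \<le> key_count K a b k'} = set ks" unfolding 6(2) using False by auto
    ultimately show ?thesis using False assms(8) 6(1,3) by simp
  qed
  ultimately show ?thesis unfolding dist_inv_def dist_inv_at_def using c1
    by (intro exI[of _ ?s] exI[of _ ?ks] conjI) blast+
qed

text \<open>The cell written is fresh: earlier elements with the same key have a smaller count
  within the block, and blocks of other keys are disjoint.\<close>

lemma ginv_place:
  assumes "dist_inv n a b K P sp0 g Z p C X T cur sp tk" "K p \<in> Z" "a \<le> p" "p < b" "K ` {a..<p} \<subseteq> Z"
  shows "dist_inv n a b K P sp0 g Z (Suc p) C (X(K p := X (K p) + 1)) (T(X (K p) := P p)) cur sp tk"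
    and "X (K p) < b" "a \<le> X (K p)"
proof -
  obtain s ks where G: "dist_inv_at n a b K P sp0 g Z p C X T cur sp tk s ks"
    using assms(1) by (auto simp: dist_inv_def)
  from G have 1: "cur = a + card {q. a \<le> q \<and> q < b \<and> K q \<in> Z}"
     and 2: "\<And>k. k \<in> Z \<Longrightarrow> a \<le> s k \<and> s k + key_count K a b k \<le> cur \<and> X k = s k + key_count K a p k"
     and 3: "\<And>k k'. k \<in> Z \<Longrightarrow> k' \<in> Z \<Longrightarrow> k \<noteq> k' \<Longrightarrow> s k + key_count K a b k \<le> s k' \<or> s k' + key_count K a b k' \<le> s k"
     and 4: "\<forall>k<n. C k = (if k \<in> Z then 0 else key_count K a b k)"
     and 5: "\<And>q. a \<le> q \<Longrightarrow> q < p \<Longrightarrow> T (s (K q) + key_count K a q (K q)) = P q"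
     and 6: "distinct ks \<and> set ks = {k \<in> Z. 2 \<le> key_count K a b k} \<and> sp = sp0 + length ks \<and> length ks \<le> cur - a \<and>
       (\<forall>t<length ks. tk (sp0 + t) = (s (ks ! t), s (ks ! t) + key_count K a b (ks ! t), g) \<and>
        t \<le> s (ks ! t) - a \<and> (\<forall>t'<t. s (ks ! t') + key_count K a b (ks ! t') \<le> s (ks ! t)))"
    unfolding dist_inv_at_def by blast+
  have l: "key_count K a p (K p) < key_count K a b (K p)" using cn_less[OF assms(3,4)] .
  have X: "X (K p) = s (K p) + key_count K a p (K p)" using 2[OF assms(2)] by simp
  show "X (K p) < b" "a \<le> X (K p)"
    using 2[OF assms(2)] l ginv_bounds(2)[OF assms(1)] assms(3,4) by auto
  have ne: "s (K q) + key_count K a q (K q) \<noteq> X (K p)" if q: "a \<le> q" "q < p" for q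
  proof (cases "K q = K p")
    case True then show ?thesis using cn_less[OF q, of K] X by simp
  next
    case False
    have "K q \<in> Z" using assms(5) q by auto
    moreover have "key_count K a q (K q) < key_count K a b (K q)" using cn_less[of a q b K] q assms(4) by simp
    ultimately show ?thesis using 3[of "K q" "K p"] assms(2) False X l by auto
  qed
  have "\<forall>k\<in>Z. a \<le> s k \<and> s k + key_count K a b k \<le> cur \<and> (X(K p := X (K p) + 1)) k = s k + key_count K a (Suc p) k"
    using 2 assms(3) by (auto simp: cn_Suc)
  moreover have "\<forall>q. a \<le> q \<and> q < Suc p \<longrightarrow> (T(X (K p) := P p)) (s (K q) + key_count K a q (K q)) = P q"
    using 5 ne X by (auto simp: less_Suc_eq)
  ultimately show "dist_inv n a b K P sp0 g Z (Suc p) C (X(K p := X (K p) + 1)) (T(X (K p) := P p)) cur sp tk"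
    unfolding dist_inv_def dist_inv_at_def using 1 3 4 6 by (intro exI[of _ s] exI[of _ ks] conjI) blast+
qed

text \<open>The clause \<open>t \<le> u t - a\<close> says that the number of groups pushed before
  is at most the number of positions to the left; it later bounds the height of the stack. The order
  of the ranges yields their disjointness.\<close>

definition grouped :: "nat \<Rightarrow> nat \<Rightarrow> nat \<Rightarrow> (nat \<Rightarrow> nat) \<Rightarrow> (nat \<Rightarrow> nat) \<Rightarrow> nat \<Rightarrow> nat \<times> nat \<times> nat \<Rightarrow>
    (nat \<Rightarrow> nat) \<Rightarrow> nat \<Rightarrow> (nat \<Rightarrow> task) \<Rightarrow> bool" where
  "grouped n a b K P sp0 g T sp tk \<longleftrightarrow> T ` {a..<b} = P ` {a..<b} \<and> (\<exists>ks u v.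
     distinct ks \<and> set ks = {k. 2 \<le> key_count K a b k} \<and> sp = sp0 + length ks \<and>
     (\<forall>t<length ks. tk (sp0 + t) = (u t, v t, g) \<and> a \<le> u t \<and> u t + 2 \<le> v t \<and> v t \<le> b \<and> t \<le> u t - a \<and>
        T ` {u t..<v t} = P ` {q \<in> {a..<b}. K q = ks ! t} \<and> (\<forall>t'<t. v t' \<le> u t)))"

text \<open>The target \<open>d q\<close> of an element maps the range injectively into itself, so
  it permutes it; within a block it is also onto.\<close>

lemma ginv_final:
  assumes "dist_inv n a b K P sp0 g (K ` {a..<b}) b C X T cur sp tk" "a \<le> b" "\<And>q. a \<le> q \<Longrightarrow> q < b \<Longrightarrow> K q < n"
  shows "grouped n a b K P sp0 g T sp tk" "\<forall>k<n. C k = 0"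
proof -
  let ?Z = "K ` {a..<b}"
  obtain s ks where G: "dist_inv_at n a b K P sp0 g ?Z b C X T cur sp tk s ks"
    using assms(1) by (auto simp: dist_inv_def)
  from G have 1: "cur = a + card {q. a \<le> q \<and> q < b \<and> K q \<in> ?Z}"
     and 2: "\<And>k. k \<in> ?Z \<Longrightarrow> a \<le> s k \<and> s k + key_count K a b k \<le> cur \<and> X k = s k + key_count K a b k"
     and 3: "\<And>k k'. k \<in> ?Z \<Longrightarrow> k' \<in> ?Z \<Longrightarrow> k \<noteq> k' \<Longrightarrow> s k + key_count K a b k \<le> s k' \<or> s k' + key_count K a b k' \<le> s k"
     and 4: "\<And>k. k < n \<Longrightarrow> C k = (if k \<in> ?Z then 0 else key_count K a b k)"
     and 5: "\<And>q. a \<le> q \<Longrightarrow> q < b \<Longrightarrow> T (s (K q) + key_count K a q (K q)) = P q"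
     and 6: "distinct ks" "set ks = {k \<in> ?Z. 2 \<le> key_count K a b k}" "sp = sp0 + length ks"
     and 7: "\<And>t. t < length ks \<Longrightarrow> tk (sp0 + t) = (s (ks ! t), s (ks ! t) + key_count K a b (ks ! t), g) \<and>
        t \<le> s (ks ! t) - a \<and> (\<forall>t'<t. s (ks ! t') + key_count K a b (ks ! t') \<le> s (ks ! t))"
    unfolding dist_inv_at_def by blast+
  have Z0: "key_count K a b k = 0" if "k \<notin> ?Z" for k using that by (intro cn_eq_0) auto
  show "\<forall>k<n. C k = 0" using 4 Z0 by auto
  have cur: "cur \<le> b" using ginv_bounds(2)[OF assms(1,2)] .
  define d where "d q = s (K q) + key_count K a q (K q)" for q
  have dl: "a \<le> d q" "d q < b" "s (K q) \<le> d q" "d q < s (K q) + key_count K a b (K q)" if "q \<in> {a..<b}" for q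
    using 2[of "K q"] cn_less[of a q b K] that cur by (auto simp: d_def)
  have inj: "inj_on d {a..<b}"
  proof (rule inj_onI)
    fix q q' assume q: "q \<in> {a..<b}" "q' \<in> {a..<b}" "d q = d q'"
    have "K q = K q'"
    proof (rule ccontr)
      assume "K q \<noteq> K q'"
      then show False using 3[of "K q" "K q'"] dl[OF q(1)] dl[OF q(2)] q by auto
    qed
    then have "key_count K a q (K q) = key_count K a q' (K q)" using q(3) by (simp add: d_def)
    then show "q = q'" using cn_less[of a q q' K] cn_less[of a q' q K] q \<open>K q = K q'\<close>
      by (cases q q' rule: linorder_cases) auto
  qed
  have im: "d ` {a..<b} = {a..<b}" using inj dl by (intro endo_inj_surj) auto
  have Td: "T (d q) = P q" if "q \<in> {a..<b}" for q using 5 that by (auto simp: d_def)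
  have imT: "T ` {a..<b} = P ` {a..<b}" 
  proof -
    have "T ` d ` {a..<b} = P ` {a..<b}" unfolding image_image by (intro image_cong) (auto simp: Td)
    then show ?thesis using im by simp
  qed
  have blk: "T ` {s k..<s k + key_count K a b k} = P ` {q \<in> {a..<b}. K q = k}" for k
  proof -
    have "d ` {q \<in> {a..<b}. K q = k} = {s k..<s k + key_count K a b k}"
    \<comment> \<open>The targets lie in the block, and by injectivity there are as many of them as
      the block has cells.\<close>
    proof (rule card_subset_eq)
      have "card (d ` {q \<in> {a..<b}. K q = k}) = card {q \<in> {a..<b}. K q = k}"
        by (rule card_image) (rule inj_on_subset[OF inj], auto)
      also have "{q \<in> {a..<b}. K q = k} = {q. a \<le> q \<and> q < b \<and> K q = k}" by auto
      finally show "card (d ` {q \<in> {a..<b}. K q = k}) = card {s k..<s k + key_count K a b k}" by (simp add: key_count_def)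
    qed (use dl in auto)
    moreover have "T ` d ` {q \<in> {a..<b}. K q = k} = P ` {q \<in> {a..<b}. K q = k}"
      unfolding image_image by (intro image_cong) (auto simp: Td)
    ultimately show ?thesis by simp
  qed
  have nk: "ks ! t \<in> ?Z" "2 \<le> key_count K a b (ks ! t)" if "t < length ks" for t
    using nth_mem[OF that] 6(2) by auto
  have bd: "a \<le> s (ks ! t)" "s (ks ! t) + key_count K a b (ks ! t) \<le> b" if "t < length ks" for t
    using 2[OF nk(1)[OF that]] cur by auto
  have "set ks = {k. 2 \<le> key_count K a b k}" using 6(2) Z0 by fastforce
  then show "grouped n a b K P sp0 g T sp tk"
    unfolding grouped_def using imT 6 7 blk nk bd
    by (intro conjI exI[of _ ks] exI[of _ "\<lambda>t. s (ks ! t)"] exI[of _ "\<lambda>t. s (ks ! t) + key_count K a b (ks ! t)"]) auto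
qed

section \<open>The grouping procedure\<close>

definition stack_task :: "arrs \<Rightarrow> nat \<Rightarrow> task" where
  "stack_task a q = (a 17 q, a 18 q, a 19 q, a 20 q, a 21 q)"

text \<open>This is the query of \<open>level_query\<close> for the level in register 26. Shifting
  \<open>2\<close> instead of \<open>1\<close> gives the modulus with exponent
  \<open>p mod b + 1\<close>.\<close>

definition key_step :: com where
  "key_step = Assign 33 (Arr 15 (Bin Add (Arr 10 (Var 32)) (Var 27))) ;;
   Assign 35 (Bin Add (Bin Mul (Var 26) (Var 5)) (Bin Quot (Var 33) (Var 4))) ;;
   Assign 36 (Bin Rem (Arr 7 (Var 35)) (Bin Shift_Left (Cnst 2) (Bin Rem (Var 33) (Var 4)))) ;;
   Cond (Equ (Var 36) (Cnst 0)) (Assign 37 (Arr 8 (Var 35)))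
     (Assign 37 (Bin Add (Bin Mul (Bin Quot (Var 33) (Var 4)) (Var 4)) (Arr 9 (Var 36)))) ;;
   Put 11 (Var 32) (Var 37) ;; Put 23 (Var 37) (Bin Add (Arr 23 (Var 37)) (Cnst 1))"

text \<open>A nonzero counter in array 23 means that the block of the key has not been reserved.
  Resetting it marks the key and at once restores the all-zero array for the next grouping, which
  saves a clearing pass over \<open>n\<close> cells.\<close>

definition alloc_step :: com where
  "alloc_step = Assign 33 (Arr 11 (Var 32)) ;;
   Cond (Lt (Cnst 0) (Arr 23 (Var 33)))
     (Assign 35 (Arr 23 (Var 33)) ;; Put 13 (Var 33) (Var 34) ;;
      Cond (Lt (Cnst 1) (Var 35))
        (Put 17 (Var 31) (Var 34) ;; Put 18 (Var 31) (Bin Add (Var 34) (Var 35)) ;;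
         Put 19 (Var 31) (Var 28) ;; Put 20 (Var 31) (Var 29) ;; Put 21 (Var 31) (Var 30) ;;
         Assign 31 (Bin Add (Var 31) (Cnst 1))) Skip ;;
      Assign 34 (Bin Add (Var 34) (Var 35)) ;; Put 23 (Var 33) (Cnst 0)) Skip"

definition place_step :: com where
  "place_step = Put 12 (Arr 13 (Var 33)) (Arr 10 (Var 32)) ;;
   Put 13 (Var 33) (Bin Add (Arr 13 (Var 33)) (Cnst 1))"

text \<open>The distribution reads array 10 in an order unrelated to the targets, so it writes to
  the scratch array 12 and a third pass copies the range back.\<close>

definition group :: com where
  "group = (Assign 32 (Var 20) ;; For 32 (Var 21) key_step) ;;
   (Assign 32 (Var 20) ;; Assign 34 (Var 20) ;; For 32 (Var 21) (alloc_step ;; place_step)) ;;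
   (Assign 32 (Var 20) ;; For 32 (Var 21) (Put 10 (Var 32) (Arr 12 (Var 32))))"

lemma wv_key: "written_vars key_step = {33, 35, 36, 37}" and wa_key: "written_arrs key_step = {11, 23}"
  by (auto simp: key_step_def)

lemma wv_alloc: "written_vars alloc_step = {31, 33, 34, 35}"
  and wa_alloc: "written_arrs alloc_step = {13, 17, 18, 19, 20, 21, 23}"
  by (auto simp: alloc_step_def)

lemma wv_place: "written_vars place_step = {}" and wa_place: "written_arrs place_step = {12, 13}"
  by (auto simp: place_step_def)

lemma wv_group: "written_vars group = {31, 32, 33, 34, 35, 36, 37}"
  and wa_group: "written_arrs group = {10, 11, 12, 13, 17, 18, 19, 20, 21, 23}"
  by (auto simp: group_def wv_key wa_key wv_alloc wa_alloc wv_place wa_place)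

lemmas written_group = wv_key wa_key wv_alloc wa_alloc wv_place wa_place wv_group wa_group

lemma grouped_cong:
  assumes "grouped n a b K P sp0 g T sp tk" "\<And>p. a \<le> p \<Longrightarrow> p < b \<Longrightarrow> T' p = T p"
  shows "grouped n a b K P sp0 g T' sp tk"
proof -
  have im: "T' ` A = T ` A" if "A \<subseteq> {a..<b}" for A
    using that assms(2) by (intro image_cong) auto
  obtain ks u v where 0: "T ` {a..<b} = P ` {a..<b}" and 1: "distinct ks" "set ks = {k. 2 \<le> key_count K a b k}"
     "sp = sp0 + length ks"
     and 2: "\<And>t. t < length ks \<Longrightarrow> tk (sp0 + t) = (u t, v t, g) \<and> a \<le> u t \<and> u t + 2 \<le> v t \<and> v t \<le> b \<and> t \<le> u t - a \<and>
        T ` {u t..<v t} = P ` {q \<in> {a..<b}. K q = ks ! t} \<and> (\<forall>t'<t. v t' \<le> u t)"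
    using assms(1) unfolding grouped_def by blast
  have "T' ` {u t..<v t} = T ` {u t..<v t}" if "t < length ks" for t
    using 2[OF that] by (intro im) auto
  then show ?thesis unfolding grouped_def using 0 1 2 im[OF order_refl]
    by (intro conjI exI[of _ ks] exI[of _ u] exI[of _ v]) auto
qed

context wram
begin

lemma B_pos: "0 < B"
  using floor_log_rec[OF n2] by linarith

lemma exp_B: "2 ^ B \<le> n"
  using floor_log_exp2_le n0 by simp

lemma B_le: "B \<le> n"
  using exp_B less_exp[of B] by linarith

lemma level_addr:
  assumes "j \<le> B" "u < WD"
  shows "j * WD + u \<le> 4 * n"
proof -
  have "j * WD \<le> B * WD" using assms by (intro mult_right_mono) auto
  also have "\<dots> = B * (n div B) + B" by simp
  also have "\<dots> \<le> n + n" using B_le by (intro add_mono) (auto simp: mult.commute div_times_less_eq_dividend)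
  finally show ?thesis using assms(2) n2 div_le_dividend[of n B] by linarith
qed

lemma dinv_J: "names_inv x m r a \<Longrightarrow> m < n \<Longrightarrow> r 2 \<le> B"
proof -
  assume "names_inv x m r a" "m < n"
  then have "2 ^ r 2 \<le> n" by (auto simp: names_inv_def)
  then show ?thesis using floor_log_power floor_log_mono by (metis monoD)
qed

lemma dinv_cong:
  assumes "names_inv x m r a" "\<And>v. v \<in> {0, 2, 3, 4, 5, 7} \<Longrightarrow> r' v = r v"
    "\<And>k. k \<in> {7, 8, 9, 15} \<Longrightarrow> a' k = a k"
  shows "names_inv x m r' a'"
proof -
  have v: "r' 0 = r 0" "r' 2 = r 2" "r' 3 = r 3" "r' 4 = r 4" "r' 5 = r 5" "r' 7 = r 7"
    "a' 7 = a 7" "a' 8 = a 8" "a' 9 = a 9" "a' 15 = a 15"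
    using assms by simp_all
  have "level a' B WD j S = level a B WD j S" for j S by (simp add: level_def v)
  then show ?thesis using assms(1) by (simp add: names_inv_def v)
qed

lemma query:
  assumes d: "names_inv x m r a" and m: "m < n" and j: "j \<le> r 2" and i: "i < n"
  defines "p \<equiv> a 15 i"
  defines "v \<equiv> a 7 (j * WD + p div B) mod (2 * 2 ^ (p mod B))"
  shows "block_name n x j i = (if v = 0 then a 8 (j * WD + p div B) else p div B * B + a 9 v)"
    and "p < n" "j * WD + p div B < 8 * n" "j * WD + p div B < 2 ^ w" "j * WD < 2 ^ w" "v < 8 * n" "v < 2 ^ w"
    "2 * 2 ^ (p mod B) < (2::nat) ^ w" "p div B * B + a 9 v < 2 ^ w" "p div B * B < 2 ^ w" "p mod B < 2 ^ w"
    "p div B < 2 ^ w"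
proof -
  note d' = d[unfolded names_inv_def]
  have p: "p = block_name n x (r 2) i" using d' i by (simp add: p_def)
  show pn: "p < n" using p nm_less[OF n0 i] by simp
  have u: "p div B < WD" using pn by (simp add: div_le_mono less_Suc_eq_le)
  have jB: "j \<le> B" using dinv_J[OF d m] j by simp
  note la = level_addr[OF jB u]
  show "j * WD + p div B < 8 * n" "j * WD + p div B < 2 ^ w" using la n2 by (linarith, intro less_W, linarith)
  then show "j * WD < 2 ^ w" by linarith
  have pB: "p mod B < B" using B_pos by simp
  then have "Suc (p mod B) \<le> B" by simp
  \<comment> \<open>The masked word stays at most \<open>n\<close>, so it is a valid index into the
    logarithm table.\<close>
  then have "(2::nat) ^ Suc (p mod B) \<le> 2 ^ B" by (intro power_increasing) auto
  then have 2: "2 * 2 ^ (p mod B) \<le> n" using exp_B by simp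
  have vl: "v < 2 * 2 ^ (p mod B)" unfolding v_def by simp
  show "v < 8 * n" "v < 2 ^ w" "2 * 2 ^ (p mod B) < (2::nat) ^ w" using 2 vl by (linarith, (intro less_W, linarith)+)
  have "level a B WD j (block_name n x j ` {..<n})" using d' j by blast
  from level_query[OF this u B_pos] mx_nm[OF n0 i j, of x] p
  have q: "block_name n x j i = (if v = 0 then a 8 (j * WD + p div B) else p div B * B + floor_log v)"
    by (simp add: v_def)
  have a9: "a 9 v = floor_log v" using d' 2 vl by simp
  show "block_name n x j i = (if v = 0 then a 8 (j * WD + p div B) else p div B * B + a 9 v)" using q a9 by simp
  have "floor_log v \<le> v" by (metis bit_floor_log bit_imp_le floor_log_zero le_trans less_exp less_or_eq_imp_le not_gr_zero)
  then have "floor_log v \<le> n" using 2 vl by linarith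
  moreover have "p div B * B \<le> p" by simp
  ultimately show "p div B * B + a 9 v < 2 ^ w" "p div B * B < 2 ^ w" using a9 pn by (intro less_W; linarith)+
  have "p mod B \<le> p" "p div B \<le> p" by simp_all
  then show "p mod B < 2 ^ w" "p div B < 2 ^ w" using pn by (intro less_W; linarith)+
qed

lemma run_keys:
  assumes d: "names_inv x m r a" and m: "m < n" and j: "r 26 \<le> r 2" and ab: "r 20 \<le> r 21" "r 21 \<le> n" "r 32 = r 20"
    and o: "\<And>p. r 20 \<le> p \<Longrightarrow> p < r 21 \<Longrightarrow> a 10 p + r 27 < n" and z: "\<forall>k<n. a 23 k = 0"
  defines "K \<equiv> \<lambda>p. block_name n x (r 26) (a 10 p + r 27)"
  shows "run (For 32 (Var 21) key_step) r a (110 * (r 21 - r 20) + 10) (\<lambda>r' a'.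
    (\<forall>p. r 20 \<le> p \<and> p < r 21 \<longrightarrow> a' 11 p = K p) \<and> (\<forall>k<n. a' 23 k = key_count K (r 20) (r 21) k))"
proof (rule run_For[where hi = "r 21" and s = 100 and I = "\<lambda>i r' a'. (\<forall>p. r 20 \<le> p \<and> p < i \<longrightarrow> a' 11 p = K p) \<and>
    (\<forall>k<n. a' 23 k = key_count K (r 20) i k)"], goal_cases)
  case (5 i r' a')
  then have v: "r' 0 = r 0" "r' 2 = r 2" "r' 3 = r 3" "r' 4 = r 4" "r' 5 = r 5" "r' 7 = r 7" "r' 20 = r 20"
    "r' 21 = r 21" "r' 26 = r 26" "r' 27 = r 27" "r' 32 = i" "a' 7 = a 7" "a' 8 = a 8" "a' 9 = a 9" "a' 15 = a 15"
    "a' 10 = a 10" "r 20 \<le> i" "i \<le> r 21"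
    using ab by (auto simp: frame_def written_group)
  have I: "\<And>p. r 20 \<le> p \<Longrightarrow> p < i \<Longrightarrow> a' 11 p = K p" "\<And>k. k < n \<Longrightarrow> a' 23 k = key_count K (r 20) i k" using 5 by auto
  show ?case
  proof (intro conjI impI run_wp)
    assume i: "i < r 21"
    let ?e = "a 10 i + r 27"
    have e: "?e < n" using o v i by simp
    define W where "W = WD"
    note q = query[OF d m j e, folded W_def]
    have B: "r 4 = B" "r 5 = W" using d by (auto simp: names_inv_def W_def)
    have K: "K i = block_name n x (r 26) ?e" by (simp add: K_def)
    have Kn: "K i < n" using nm_less[OF n0 e] K by simp
    have "key_count K (r 20) i (K i) \<le> card {..<i}" unfolding key_count_def by (intro card_mono) auto
    then have b: "Suc (key_count K (r 20) i (K i)) < 2 ^ w" "K i < 2 ^ w" "?e < 2 ^ w" "(2::nat) < 2 ^ w"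
        "?e < 8 * n" "K i < 8 * n" "i < 8 * n" "a 10 i < 2 ^ w" "Suc (Suc 0) < 2 ^ w"
      using Kn e i ab n2 by (auto intro!: less_W)
    define v' where "v' = a 7 (r 26 * W + a 15 ?e div B) mod (2 * 2 ^ (a 15 ?e mod B))"
    note q = q[folded v'_def]
    have push: "push_bit k (2::nat) = 2 * 2 ^ k" for k by (simp add: push_bit_eq_mult)
    have fin: "(\<forall>p. r 20 \<le> p \<and> p < Suc i \<longrightarrow> ((a' 11)(i := K i)) p = K p) \<and>
       (\<forall>k<n. ((a' 23)(K i := Suc (key_count K (r 20) i (K i)))) k = key_count K (r 20) (Suc i) k)"
      using I v by (auto simp: less_Suc_eq cn_Suc)
    show "wp key_step (\<lambda>r'' a''. (\<forall>p. r 20 \<le> p \<and> p < Suc i \<longrightarrow> a'' 11 p = K p) \<and>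
       (\<forall>k<n. a'' 23 k = key_count K (r 20) (Suc i) k)) r' a'"
    proof (cases "v' = 0")
      case True
      then have "a 8 (r 26 * W + a 15 ?e div B) = K i" using q(1) K by simp
      then show ?thesis unfolding key_step_def
        using q(2-) b True fin by (simp add: v B push I(2)[OF Kn] flip: v'_def)
    next
      case False
      then have "a 15 ?e div B * B + a 9 v' = K i" using q(1) K by simp
      then show ?thesis unfolding key_step_def
        using q(2-) b False fin by (simp add: v B push I(2)[OF Kn] flip: v'_def)
    qed
  qed (use v in \<open>auto simp: key_step_def\<close>)
next
  case 1 then show ?case using z ab by (auto simp: key_count_def)
next
  case 4 then show ?case using ab by (intro less_W) simp
qed (use ab in \<open>auto simp: written_group\<close>)

text \<open>The set of reserved keys is always the set of keys already scanned, so neither time nor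
  invariant depends on keys that do not occur in the range.\<close>

lemma run_dist:
  assumes ab: "r 20 \<le> r 21" "r 21 \<le> n" "r 32 = r 20" "r 34 = r 20"
    and K: "\<And>p. r 20 \<le> p \<Longrightarrow> p < r 21 \<Longrightarrow> a 11 p < n" and C: "\<forall>k<n. a 23 k = key_count (a 11) (r 20) (r 21) k"
    and sp: "r 31 + (r 21 - r 20) \<le> 4 * n"
  shows "run (For 32 (Var 21) (alloc_step ;; place_step)) r a (150 * (r 21 - r 20) + 10) (\<lambda>r' a'.
    grouped n (r 20) (r 21) (a 11) (a 10) (r 31) (r 28, r 29, r 30) (a' 12) (r' 31) (stack_task a') \<and>
    (\<forall>k<n. a' 23 k = 0) \<and> (\<forall>q<r 31. stack_task a' q = stack_task a q))"
proof -
  let ?G = "\<lambda>Z p r' a'. dist_inv n (r 20) (r 21) (a 11) (a 10) (r 31) (r 28, r 29, r 30) Z p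
     (a' 23) (a' 13) (a' 12) (r' 34) (r' 31) (stack_task a') \<and> (\<forall>q<r 31. stack_task a' q = stack_task a q)"
  show ?thesis
  proof (rule run_For[where hi = "r 21" and s = 140 and I = "\<lambda>p r' a'. ?G (a 11 ` {r 20..<p}) p r' a'"], goal_cases)
    case (5 p r' a')
    then have v: "r' 20 = r 20" "r' 21 = r 21" "r' 28 = r 28" "r' 29 = r 29" "r' 30 = r 30" "r' 32 = p"
      "a' 10 = a 10" "a' 11 = a 11" "r 20 \<le> p" "p \<le> r 21"
      using ab by (auto simp: frame_def written_group)
    have G: "?G (a 11 ` {r 20..<p}) p r' a'" using 5 by simp
    note gb = ginv_bounds[OF conjunct1[OF G] ab(1)]
    show ?case
    proof (intro conjI impI)
      assume p: "p < r 21"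
      let ?k = "a 11 p" and ?Z = "a 11 ` {r 20..<p}"
      let ?Z' = "insert ?k ?Z"
      let ?Q = "\<lambda>r'' a''. ?G ?Z' p r'' a'' \<and> r'' 33 = ?k"
      have k: "?k < n" using K v p by simp
      have C: "a' 23 ?k = (if ?k \<in> ?Z then 0 else key_count (a 11) (r 20) (r 21) ?k)"
        using G k unfolding dist_inv_def dist_inv_at_def by blast
      have b: "?k < 2 ^ w" "?k < 8 * n" "p < 8 * n" "p < 2 ^ w" "r' 34 < 2 ^ w" "r' 31 < 8 * n" "Suc (r' 31) < 2 ^ w"
         "0 < (2::nat) ^ w" "Suc 0 < (2::nat) ^ w"
        using k p ab gb sp n2 by (linarith | intro less_W; linarith)+
      have "run alloc_step r' a' 80 ?Q"
      proof (cases "?k \<in> ?Z")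
        case True
        then have "?Z' = ?Z" by auto
        then show ?thesis using True C G b unfolding alloc_step_def
          by (intro run_wp) (simp_all add: v)
      next
        case False
        let ?c = "key_count (a 11) (r 20) (r 21) ?k"
        have c0: "0 < ?c" using cn_pos[of "r 20" p "r 21" "a 11"] v p by simp
        have cp: "key_count (a 11) (r 20) p ?k = 0"
          using False by (intro cn_eq_0) (metis atLeastLessThan_iff imageI)
        have cb: "r' 34 + ?c \<le> r 21" using ginv_alloc_bound[OF conjunct1[OF G] False ab(1)] .
        then have b2: "r' 34 + ?c < 2 ^ w" "?c < 2 ^ w" using ab by (intro less_W; linarith)+
        let ?s = "r' 31"
        let ?Fin = "\<lambda>(r''::regs) (a''::arrs). r'' 33 = ?k \<and> r'' 34 = r' 34 + ?c \<and> r'' 31 = (if 1 < ?c then ?s + 1 else ?s) \<and>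
          a'' 23 = (a' 23)(?k := 0) \<and> a'' 13 = (a' 13)(?k := r' 34) \<and> a'' 12 = a' 12 \<and>
          a'' 17 = (if 1 < ?c then (a' 17)(?s := r' 34) else a' 17) \<and>
          a'' 18 = (if 1 < ?c then (a' 18)(?s := r' 34 + ?c) else a' 18) \<and>
          a'' 19 = (if 1 < ?c then (a' 19)(?s := r 28) else a' 19) \<and>
          a'' 20 = (if 1 < ?c then (a' 20)(?s := r 29) else a' 20) \<and>
          a'' 21 = (if 1 < ?c then (a' 21)(?s := r 30) else a' 21)"
        have R: "run alloc_step r' a' 80 ?Fin"
        proof (rule run_wp)
          show "wp alloc_step ?Fin r' a'"
            using False C b b2 c0 unfolding alloc_step_def by (simp add: v)
        qed (simp add: alloc_step_def)
        have W: "?Q r1 a1" if q: "?Fin r1 a1" for r1 :: regs and a1 :: arrs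
        proof -
          have t: "stack_task a1 = (if 1 < ?c then (stack_task a')(?s := (r' 34, r' 34 + ?c, r 28, r 29, r 30)) else stack_task a')"
            using q by (auto simp: stack_task_def fun_eq_iff)
          then have "\<forall>q<r 31. stack_task a1 q = stack_task a q" using G gb(3) by auto
          then show "?Q r1 a1"
            using ginv_alloc[OF conjunct1[OF G] False k c0 cp order_refl t refl] q by simp
        qed
        show ?thesis by (rule run_mono[OF R order_refl], rule W)
      qed
      then show "run (alloc_step ;; place_step) r' a' 140
         (\<lambda>r'' a''. ?G (a 11 ` {r 20..<Suc p}) (Suc p) (r''(32 := Suc p)) a'')"
      proof (rule run_seq[where t = 50])
        fix r1 a1 assume f: "frame alloc_step r' a' r1 a1" and Q: "?Q r1 a1"
        then have v1: "r1 32 = p" "a1 10 = a 10" "r1 33 = ?k" using v by (auto simp: frame_def written_group)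
        have "a 11 ` {r 20..<p} \<subseteq> ?Z'" by auto
        note pl = ginv_place[OF conjunct1[OF conjunct1[OF Q]] _ v(9) p this, simplified]
        have Zs: "a 11 ` {r 20..<Suc p} = ?Z'" using v(9) by (simp add: atLeastLessThanSuc)
        have b1: "Suc (a1 13 ?k) < 2 ^ w" "a1 13 ?k < 8 * n" using pl(2) ab n2 by (intro less_W, linarith, linarith)
        have t': "stack_task (a1(12 := X, 13 := Y)) = stack_task a1" for X Y by (auto simp: stack_task_def)
        show "run place_step r1 a1 50 (\<lambda>r'' a''. ?G (a 11 ` {r 20..<Suc p}) (Suc p) (r''(32 := Suc p)) a'')"
          unfolding place_step_def
          by (rule run_wp) (use b b1 pl Q in \<open>simp_all add: v1 Zs t'\<close>)
      qed simp
    qed (use v in auto)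
  next
    case 1
    show ?case using C by (auto simp: dist_inv_def dist_inv_at_def ab intro!: exI[of _ "[]"])
  next
    case (6 r' a')
    then show ?case using ginv_final[OF conjunct1[OF 6(2)] ab(1) K] by auto
  next
    case 4 then show ?case using ab by (intro less_W) simp
  qed (use ab in \<open>auto simp: written_group\<close>)
qed

lemma run_group:
  assumes d: "names_inv x m r a" and m: "m < n" and j: "r 26 \<le> r 2" and ab: "r 20 \<le> r 21" "r 21 \<le> n"
    and o: "\<And>p. r 20 \<le> p \<Longrightarrow> p < r 21 \<Longrightarrow> a 10 p + r 27 < n" and z: "\<forall>k<n. a 23 k = 0"
    and sp: "r 31 + (r 21 - r 20) \<le> 4 * n"
  defines "K \<equiv> \<lambda>p. block_name n x (r 26) (a 10 p + r 27)"
  shows "run group r a (300 * (r 21 - r 20) + 50) (\<lambda>r' a'.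
    grouped n (r 20) (r 21) K (a 10) (r 31) (r 28, r 29, r 30) (a' 10) (r' 31) (stack_task a') \<and>
    (\<forall>p. p < r 20 \<or> r 21 \<le> p \<longrightarrow> a' 10 p = a 10 p) \<and>
    (\<forall>k<n. a' 23 k = 0) \<and> (\<forall>q<r 31. stack_task a' q = stack_task a q))"
proof -
  let ?a = "r 20" and ?b = "r 21" and ?g = "(r 28, r 29, r 30)"
  let ?k = "\<lambda>r' a'. \<forall>p. ?a \<le> p \<and> p < ?b \<longrightarrow> a' 11 p = K p"
  let ?P1 = "\<lambda>r' a'. ?k r' a' \<and> (\<forall>k<n. a' 23 k = key_count K ?a ?b k)"
  let ?P2 = "\<lambda>r' a'. grouped n ?a ?b K (a 10) (r 31) ?g (a' 12) (r' 31) (stack_task a') \<and>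
    (\<forall>k<n. a' 23 k = 0) \<and> (\<forall>q<r 31. stack_task a' q = stack_task a q)"
  have Kn: "K p < n" if "?a \<le> p" "p < ?b" for p unfolding K_def using nm_less[OF n0 o[OF that]] .
  have set: "run (Assign v (Var 20)) r' a' 2 (\<lambda>r'' a''. r'' = r'(v := r' 20) \<and> a'' = a')" for v r' a'
    by (rule run_wp) auto
  have s1: "run (Assign 32 (Var 20) ;; For 32 (Var 21) key_step) r a (110 * (?b - ?a) + 12) ?P1"
  proof (rule run_seq[OF set])
    fix r' a' assume "r' = r(32 := r 20) \<and> a' = a"
    then have *: "r' = r(32 := r 20)" "a' = a" by auto
    have d': "names_inv x m r' a'" using * by (intro dinv_cong[OF d]) auto
    show "run (For 32 (Var 21) key_step) r' a' (110 * (?b - ?a) + 10) ?P1"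
      using run_keys[OF d' m, unfolded *] assms by (simp add: * K_def)
  qed simp
  have s2: "run (Assign 32 (Var 20) ;; Assign 34 (Var 20) ;; For 32 (Var 21) (alloc_step ;; place_step)) r' a'
      (150 * (?b - ?a) + 14) ?P2"
    if P1: "?P1 r' a'" and f: "frame (Assign 32 (Var 20) ;; For 32 (Var 21) key_step) r a r' a'" for r' a'
  proof (rule run_seq[OF set], rule run_seq[OF set])
    fix r1 a1 r2 a2
    assume h: "r1 = r'(32 := r' 20) \<and> a1 = a'" "r2 = r1(34 := r1 20) \<and> a2 = a1"
    then have v: "r2 20 = ?a" "r2 21 = ?b" "r2 28 = r 28" "r2 29 = r 29" "r2 30 = r 30" "r2 31 = r 31"
      "r2 32 = ?a" "r2 34 = ?a" "a2 10 = a 10" "a2 11 = a' 11" "a2 23 = a' 23" "stack_task a2 = stack_task a"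
      using f by (auto simp: frame_def written_group stack_task_def fun_eq_iff)
    have cnK: "key_count (a' 11) ?a p k = key_count K ?a p k" if "p \<le> ?b" for p k
      unfolding key_count_def using P1 that by (intro arg_cong[where f = card] Collect_cong) auto
    have Keq: "{q \<in> {?a..<?b}. a' 11 q = k} = {q \<in> {?a..<?b}. K q = k}" for k using P1 by auto
    have "run (For 32 (Var 21) (alloc_step ;; place_step)) r2 a2 (150 * (r2 21 - r2 20) + 10) (\<lambda>r' a'.
        grouped n (r2 20) (r2 21) (a2 11) (a2 10) (r2 31) (r2 28, r2 29, r2 30) (a' 12) (r' 31) (stack_task a') \<and>
        (\<forall>k<n. a' 23 k = 0) \<and> (\<forall>q<r2 31. stack_task a' q = stack_task a2 q))"
      by (rule run_dist) (use ab sp P1 cnK[OF order_refl] Kn in \<open>simp_all add: v\<close>)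
    then show "run (For 32 (Var 21) (alloc_step ;; place_step)) r2 a2 (150 * (?b - ?a) + 10) ?P2"
      unfolding v grouped_def cnK[OF order_refl] Keq .
  qed auto
  have s3: "run (Assign 32 (Var 20) ;; For 32 (Var 21) (Put 10 (Var 32) (Arr 12 (Var 32)))) r' a'
      (30 * (?b - ?a) + 12) (\<lambda>r'' a''. (\<forall>p. ?a \<le> p \<and> p < ?b \<longrightarrow> a'' 10 p = a' 12 p) \<and>
         (\<forall>p. p < ?a \<or> ?b \<le> p \<longrightarrow> a'' 10 p = a' 10 p))"
    if v: "r' 20 = ?a" "r' 21 = ?b" for r' a'
  proof (rule run_seq[OF set])
    fix r1 a1 assume h: "r1 = r'(32 := r' 20) \<and> a1 = a'"
    show "run (For 32 (Var 21) (Put 10 (Var 32) (Arr 12 (Var 32)))) r1 a1 (30 * (?b - ?a) + 10)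
      (\<lambda>r'' a''. (\<forall>p. ?a \<le> p \<and> p < ?b \<longrightarrow> a'' 10 p = a' 12 p) \<and> (\<forall>p. p < ?a \<or> ?b \<le> p \<longrightarrow> a'' 10 p = a' 10 p))"
    proof (rule run_For[where hi = ?b and s = 20 and I = "\<lambda>i r'' a''. (\<forall>p. ?a \<le> p \<and> p < i \<longrightarrow> a'' 10 p = a' 12 p) \<and>
         (\<forall>p. p < ?a \<or> i \<le> p \<longrightarrow> a'' 10 p = a' 10 p)"], goal_cases)
      case (5 i r2 a2)
      then have v2: "r2 21 = ?b" "r2 32 = i" "a2 12 = a' 12" "i \<le> ?b" "?a \<le> i" using h v by (auto simp: frame_def)
      have I: "\<And>p. ?a \<le> p \<Longrightarrow> p < i \<Longrightarrow> a2 10 p = a' 12 p" "\<And>p. p < ?a \<or> i \<le> p \<Longrightarrow> a2 10 p = a' 10 p"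
        using 5 by auto
      show ?case
      proof (intro conjI impI run_wp)
        assume "i < ?b"
        then show "wp (Put 10 (Var 32) (Arr 12 (Var 32))) (\<lambda>r'' a''. (\<forall>p. ?a \<le> p \<and> p < Suc i \<longrightarrow> a'' 10 p = a' 12 p) \<and>
         (\<forall>p. p < ?a \<or> Suc i \<le> p \<longrightarrow> a'' 10 p = a' 10 p)) r2 a2"
          using v2 ab I by (auto simp: less_Suc_eq)
      qed (use v2 in auto)
    next
      case 4 then show ?case using ab by (intro less_W) simp
    next
      case 1 show ?case using h v by simp
    next
      case (6 r2 a2) then show ?case by blast
    qed (use h v ab(1) in simp_all)
  qed simp
  show ?thesis
    unfolding group_def
  proof (rule run_seq[OF s1], rule run_seq[OF s2])
    fix r1 a1 r2 a2
    assume h: "frame (Assign 32 (Var 20) ;; For 32 (Var 21) key_step) r a r1 a1"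
      "frame (Assign 32 (Var 20) ;; Assign 34 (Var 20) ;; For 32 (Var 21) (alloc_step ;; place_step)) r1 a1 r2 a2"
      and P2: "?P2 r2 a2"
    then have v: "r2 20 = ?a" "r2 21 = ?b" "a2 10 = a 10" by (auto simp: frame_def written_group)
    show "run (Assign 32 (Var 20) ;; For 32 (Var 21) (Put 10 (Var 32) (Arr 12 (Var 32)))) r2 a2
      (30 * (?b - ?a) + 12) (\<lambda>r' a'.
      grouped n ?a ?b K (a 10) (r 31) ?g (a' 10) (r' 31) (stack_task a') \<and>
      (\<forall>p. p < ?a \<or> ?b \<le> p \<longrightarrow> a' 10 p = a 10 p) \<and>
      (\<forall>k<n. a' 23 k = 0) \<and> (\<forall>q<r 31. stack_task a' q = stack_task a q))"
    proof (rule run_mono[OF s3[OF v(1,2)] order_refl])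
      fix r3 a3 assume f: "frame (Assign 32 (Var 20) ;; For 32 (Var 21) (Put 10 (Var 32) (Arr 12 (Var 32)))) r2 a2 r3 a3"
        and q: "(\<forall>p. ?a \<le> p \<and> p < ?b \<longrightarrow> a3 10 p = a2 12 p) \<and> (\<forall>p. p < ?a \<or> ?b \<le> p \<longrightarrow> a3 10 p = a2 10 p)"
      have w: "r3 31 = r2 31" "stack_task a3 = stack_task a2" "a3 23 = a2 23" using f by (auto simp: frame_def stack_task_def fun_eq_iff)
      have "grouped n ?a ?b K (a 10) (r 31) ?g (a3 10) (r2 31) (stack_task a2)"
        by (rule grouped_cong[OF conjunct1[OF P2]]) (use q in blast)
      then show "grouped n ?a ?b K (a 10) (r 31) ?g (a3 10) (r3 31) (stack_task a3) \<and>
        (\<forall>p. p < ?a \<or> ?b \<le> p \<longrightarrow> a3 10 p = a 10 p) \<and>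
        (\<forall>k<n. a3 23 k = 0) \<and> (\<forall>q<r 31. stack_task a3 q = stack_task a q)"
        using P2 q v(3) unfolding w by simp
    qed
  qed auto
qed

end

section \<open>Splitting tasks and their potential\<close>

text \<open>As \<open>f\<close> and \<open>g\<close> together determine an element, the rectangles
  formed by its two classes are disjoint subsets of \<open>S \<times> S\<close>, so the products of
  class sizes sum to at most the square of \<open>card S\<close>. The bound
  \<open>ln t \<le> t - 1\<close>, with \<open>t\<close> such a product divided by
  \<open>card S\<close>, turns this into the claim. It says that the entropy of a uniform element is
  at most the sum of the entropies of its two images.\<close>

lemma entropy_subadditive:
  fixes f :: "'a \<Rightarrow> 'b" and g :: "'a \<Rightarrow> 'c"
  assumes S: "finite S" and inj: "\<And>i j. i \<in> S \<Longrightarrow> j \<in> S \<Longrightarrow> f i = f j \<Longrightarrow> g i = g j \<Longrightarrow> i = j"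
  shows "(\<Sum>i\<in>S. log 2 (real (card {j \<in> S. f j = f i})) + log 2 (real (card {j \<in> S. g j = g i})))
    \<le> real (card S) * log 2 (real (card S))"
proof (cases "S = {}")
  case False
  let ?A = "\<lambda>i. {j \<in> S. f j = f i}" and ?B = "\<lambda>i. {j \<in> S. g j = g i}"
  define N where "N = real (card S)"
  have N: "0 < N" using S False by (simp add: N_def card_gt_0_iff)
  have pos: "0 < real (card (?A i))" "0 < real (card (?B i))" if "i \<in> S" for i
    using S that by (auto simp: card_gt_0_iff)
  have "(\<Sum>i\<in>S. card (?A i) * card (?B i)) = (\<Sum>i\<in>S. card (?A i \<times> ?B i))"
    by (simp add: card_cartesian_product)
  also have "\<dots> = card (\<Union>i\<in>S. ?A i \<times> ?B i)"
  proof (rule card_UN_disjoint[symmetric])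
    show "\<forall>i\<in>S. \<forall>j\<in>S. i \<noteq> j \<longrightarrow> (?A i \<times> ?B i) \<inter> (?A j \<times> ?B j) = {}"
    proof (intro ballI impI)
      fix i j assume ij: "i \<in> S" "j \<in> S" "i \<noteq> j"
      show "(?A i \<times> ?B i) \<inter> (?A j \<times> ?B j) = {}"
      proof (rule ccontr)
        assume "\<not> ?thesis"
        then obtain p where "p \<in> ?A i \<times> ?B i" "p \<in> ?A j \<times> ?B j" by blast
        then have "f i = f j" "g i = g j" by auto
        then show False using inj ij by blast
      qed
    qed
  qed (use S in auto)
  also have "\<dots> \<le> card (S \<times> S)" using S by (intro card_mono) auto
  finally have "real (\<Sum>i\<in>S. card (?A i) * card (?B i)) \<le> real (card S * card S)"
    by (simp only: of_nat_le_iff card_cartesian_product)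
  then have sum: "(\<Sum>i\<in>S. real (card (?A i)) * real (card (?B i))) \<le> N * N" by (simp add: N_def)
  \<comment> \<open>The term \<open>N * ln N\<close> is spread evenly, \<open>ln N\<close> for each
    of the \<open>N\<close> summands.\<close>
  have "(\<Sum>i\<in>S. ln (real (card (?A i))) + ln (real (card (?B i)))) - N * ln N =
     (\<Sum>i\<in>S. ln (real (card (?A i))) + ln (real (card (?B i))) - ln N)"
    by (simp add: sum_subtractf N_def)
  also have "\<dots> \<le> (\<Sum>i\<in>S. real (card (?A i)) * real (card (?B i)) / N - 1)"
  proof (rule sum_mono)
    fix i assume i: "i \<in> S"
    have "ln (real (card (?A i)) * real (card (?B i)) / N) \<le> real (card (?A i)) * real (card (?B i)) / N - 1"
      using pos[OF i] N by (intro ln_le_minus_one) simp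
    then show "ln (real (card (?A i))) + ln (real (card (?B i))) - ln N
        \<le> real (card (?A i)) * real (card (?B i)) / N - 1"
      using pos[OF i] N by (simp add: ln_div ln_mult)
  qed
  also have "\<dots> = (\<Sum>i\<in>S. real (card (?A i)) * real (card (?B i))) / N - N"
    by (simp add: sum_subtractf sum_divide_distrib N_def)
  also have "\<dots> \<le> 0" using sum N by (simp add: field_simps)
  finally have "(\<Sum>i\<in>S. ln (real (card (?A i))) + ln (real (card (?B i)))) \<le> N * ln N" by simp
  moreover have "(\<Sum>i\<in>S. log 2 (real (card (?A i))) + log 2 (real (card (?B i)))) =
     (\<Sum>i\<in>S. ln (real (card (?A i))) + ln (real (card (?B i)))) / ln 2"
    by (simp add: log_def sum_divide_distrib add_divide_distrib)
  moreover have "N * log 2 N = N * ln N / ln 2" by (simp add: log_def)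
  ultimately show ?thesis unfolding N_def[symmetric] by (simp add: divide_right_mono)
qed simp

lemma sum_groups_le:
  fixes g :: "'a \<Rightarrow> real"
  assumes "finite S" "finite Ks" "\<And>i. i \<in> S \<Longrightarrow> 0 \<le> g i"
  shows "(\<Sum>k\<in>Ks. \<Sum>i\<in>{i \<in> S. f i = k}. g i) \<le> (\<Sum>i\<in>S. g i)"
proof -
  have "(\<Sum>k\<in>Ks. \<Sum>i\<in>{i \<in> S. f i = k}. g i) = (\<Sum>i\<in>(\<Union>k\<in>Ks. {i \<in> S. f i = k}). g i)"
    by (rule sum.UNION_disjoint[symmetric]) (use assms in auto)
  also have "\<dots> \<le> (\<Sum>i\<in>S. g i)" using assms by (intro sum_mono2) auto
  finally show ?thesis .
qed

text \<open>For \<open>s \<ge> 1\<close> this is one plus the logarithm of \<open>s\<close> rounded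
  up: the number of levels when an interval of length \<open>s\<close> is halved repeatedly and the
  larger half is followed.\<close>

definition depth :: "nat \<Rightarrow> nat" where
  "depth s = (if s \<le> 1 then 1 else floor_log (s - 1) + 2)"

lemma depth_rec: "2 \<le> s \<Longrightarrow> depth s = Suc (depth ((s + 1) div 2))"
proof (cases "s = 2")
  case False
  assume "2 \<le> s"
  then have s: "2 \<le> s - 1" "\<not> (s + 1) div 2 \<le> 1" "(s + 1) div 2 - 1 = (s - 1) div 2" using False by auto
  then show ?thesis using floor_log_rec[OF s(1)] by (simp add: depth_def del: floor_log_half)
qed (simp add: depth_def)

lemma depth_mono: "s \<le> t \<Longrightarrow> depth s \<le> depth t"
  by (auto simp: depth_def intro!: floor_log_le_iff)

lemma depth_le: "depth s \<le> floor_log s + 2"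
  by (auto simp: depth_def intro!: floor_log_le_iff)

section \<open>Sets of windows and their splitting\<close>

locale windows =
  fixes x :: "nat \<Rightarrow> nat" and m n :: nat and wt :: "nat \<Rightarrow> nat" and reps :: "nat set"
  assumes m: "0 < m" "m < n" and fin: "finite reps"
    and bound: "\<And>i. i \<in> reps \<Longrightarrow> i + m \<le> n"
    and distinct: "\<And>i j. i \<in> reps \<Longrightarrow> j \<in> reps \<Longrightarrow> (\<And>k. k < m \<Longrightarrow> x (i + k) = x (j + k)) \<Longrightarrow> i = j"
begin

definition agree :: "nat \<Rightarrow> nat \<Rightarrow> nat \<Rightarrow> nat \<Rightarrow> bool" where
  "agree i j p q \<longleftrightarrow> (\<forall>k. p \<le> k \<and> k < q \<longrightarrow> x (i + k) = x (j + k))"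

text \<open>Only the place of the mismatch is restricted to the interval; agreement is required in
  the whole window, so pairs found by different tasks cannot be counted twice.\<close>

definition one_mismatch :: "nat \<Rightarrow> nat \<Rightarrow> nat \<Rightarrow> nat \<Rightarrow> bool" where
  "one_mismatch p q i j \<longleftrightarrow> (\<exists>k. p \<le> k \<and> k < q \<and> x (i + k) \<noteq> x (j + k) \<and> (\<forall>k'<m. k' \<noteq> k \<longrightarrow> x (i + k') = x (j + k')))"

definition contribution :: "nat set \<Rightarrow> nat \<Rightarrow> nat \<Rightarrow> nat \<Rightarrow> nat" where
  "contribution S p q i = (\<Sum>j\<in>{j \<in> S. one_mismatch p q i j}. wt j)"

abbreviation mid :: "nat \<Rightarrow> nat \<Rightarrow> nat" where
  "mid l r \<equiv> (l + r) div 2"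

text \<open>Phase \<open>0\<close> looks for the mismatch anywhere in the interval and groups by the
  first block of the right half. In phase \<open>1\<close> that block is known to agree and the
  mismatch is sought in the left half. Phase \<open>2\<close> is the same set again with the
  mismatch in the right half, grouped by the first block of the left half, and phase
  \<open>3\<close> follows that grouping.\<close>

definition mismatch_from :: "nat \<Rightarrow> nat \<Rightarrow> nat \<Rightarrow> nat" where
  "mismatch_from l r h = (if h = 0 \<or> h = 1 then l else mid l r)"

definition mismatch_to :: "nat \<Rightarrow> nat \<Rightarrow> nat \<Rightarrow> nat" where
  "mismatch_to l r h = (if h = 1 then mid l r else r)"

text \<open>Block length and offset of the key used for splitting a task in phase \<open>h\<close>: the half in which
  no mismatch may occur is covered by two overlapping blocks whose length is a power of two.\<close>

definition key_level :: "nat \<Rightarrow> nat \<Rightarrow> nat \<Rightarrow> nat" where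
  "key_level l r h = floor_log (if h = 0 \<or> h = 1 then r - mid l r else mid l r - l)"

definition key_offset :: "nat \<Rightarrow> nat \<Rightarrow> nat \<Rightarrow> nat" where
  "key_offset l r h = (if h = 0 then mid l r else if h = 1 then r - 2 ^ key_level l r h
     else if h = 2 then l else mid l r - 2 ^ key_level l r h)"

text \<open>After phase \<open>1\<close> or \<open>3\<close> a whole half agrees, so the groups
  become plain tasks on the other half; after phase \<open>0\<close> or \<open>2\<close> the
  interval is unchanged. The step from phase \<open>0\<close> to phase \<open>2\<close> concerns the
  ungrouped set and is made by pushing it again.\<close>

definition next_left :: "nat \<Rightarrow> nat \<Rightarrow> nat \<Rightarrow> nat" where
  "next_left l r h = (if h = 3 then mid l r else l)"

definition next_right :: "nat \<Rightarrow> nat \<Rightarrow> nat \<Rightarrow> nat" where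
  "next_right l r h = (if h = 1 then mid l r else r)"

definition next_phase :: "nat \<Rightarrow> nat" where
  "next_phase h = (if h = 0 then 1 else if h = 2 then 3 else 0)"

definition task_ok :: "nat set \<Rightarrow> nat \<Rightarrow> nat \<Rightarrow> nat \<Rightarrow> bool" where
  "task_ok S l r h \<longleftrightarrow> S \<subseteq> reps \<and> 2 \<le> card S \<and> l < r \<and> r \<le> m \<and> h \<le> 3 \<and> (h \<noteq> 0 \<longrightarrow> l + 2 \<le> r) \<and>
     (\<forall>i\<in>S. \<forall>j\<in>S. agree i j 0 l \<and> agree i j r m \<and> (h = 1 \<longrightarrow> agree i j (mid l r) (mid l r + 2 ^ key_level l r h)) \<and>
        (h = 3 \<longrightarrow> agree i j l (l + 2 ^ key_level l r h)))"

definition key :: "nat \<Rightarrow> nat \<Rightarrow> nat \<Rightarrow> nat \<Rightarrow> nat" where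
  "key l r h i = block_name n x (key_level l r h) (i + key_offset l r h)"

lemma fl_le: "0 < s \<Longrightarrow> 2 ^ floor_log s \<le> s" and fl_gt: "s < 2 * 2 ^ floor_log s"
  using floor_log_exp2_le floor_log_exp2_gt by auto

text \<open>A power of two with \<open>P \<le> s < 2 * P\<close> makes the blocks at the two ends of
  a half of length \<open>s\<close> meet or overlap.\<close>

lemma key_cover:
  assumes "l + 2 \<le> r"
  shows "h = 1 \<Longrightarrow> key_offset l r h + 2 ^ key_level l r h = r \<and> mid l r \<le> key_offset l r h \<and> key_offset l r h \<le> mid l r + 2 ^ key_level l r h"
    and "h = 3 \<Longrightarrow> key_offset l r h + 2 ^ key_level l r h = mid l r \<and> l \<le> key_offset l r h \<and> key_offset l r h \<le> l + 2 ^ key_level l r h"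
proof -
  define P where "P = (2::nat) ^ floor_log (r - mid l r)"
  define P' where "P' = (2::nat) ^ floor_log (mid l r - l)"
  have P: "P \<le> r - mid l r" "r - mid l r < 2 * P" "P' \<le> mid l r - l" "mid l r - l < 2 * P'"
    unfolding P_def P'_def using assms by (intro fl_le fl_gt; linarith)+
  show "h = 1 \<Longrightarrow> key_offset l r h + 2 ^ key_level l r h = r \<and> mid l r \<le> key_offset l r h \<and> key_offset l r h \<le> mid l r + 2 ^ key_level l r h"
  proof -
    assume "h = 1"
    then have "key_offset l r h = r - P" "2 ^ key_level l r h = P" by (simp_all add: key_offset_def key_level_def P_def)
    then show ?thesis using P(1,2) assms by linarith
  qed
  show "h = 3 \<Longrightarrow> key_offset l r h + 2 ^ key_level l r h = mid l r \<and> l \<le> key_offset l r h \<and> key_offset l r h \<le> l + 2 ^ key_level l r h"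
  proof -
    assume "h = 3"
    then have "key_offset l r h = mid l r - P'" "2 ^ key_level l r h = P'" by (simp_all add: key_offset_def key_level_def P'_def)
    then show ?thesis using P(3,4) assms by linarith
  qed
qed

lemma key_range:
  assumes "l + 2 \<le> r" "r \<le> m" "h \<le> 3"
  shows "key_offset l r h + 2 ^ key_level l r h \<le> m" "2 ^ key_level l r h \<le> m"
    "h = 0 \<or> h = 1 \<Longrightarrow> mid l r \<le> key_offset l r h \<and> key_offset l r h + 2 ^ key_level l r h \<le> r"
    "h = 2 \<or> h = 3 \<Longrightarrow> l \<le> key_offset l r h \<and> key_offset l r h + 2 ^ key_level l r h \<le> mid l r"
proof -
  have 1: "2 ^ floor_log (r - mid l r) \<le> r - mid l r" using assms by (intro fl_le) linarith
  have 2: "2 ^ floor_log (mid l r - l) \<le> mid l r - l" using assms by (intro fl_le) linarith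
  have s: "mid l r \<le> r" "l \<le> mid l r" using assms by linarith+
  have h0: "mid l r \<le> key_offset l r 0 \<and> key_offset l r 0 + 2 ^ key_level l r 0 \<le> r"
    using 1 s by (simp add: key_offset_def key_level_def)
  have h2: "l \<le> key_offset l r 2 \<and> key_offset l r 2 + 2 ^ key_level l r 2 \<le> mid l r"
    using 2 s by (simp add: key_offset_def key_level_def)
  show 3: "h = 0 \<or> h = 1 \<Longrightarrow> mid l r \<le> key_offset l r h \<and> key_offset l r h + 2 ^ key_level l r h \<le> r"
    using h0 key_cover(1)[OF assms(1), of h] by auto
  show 4: "h = 2 \<or> h = 3 \<Longrightarrow> l \<le> key_offset l r h \<and> key_offset l r h + 2 ^ key_level l r h \<le> mid l r"
    using h2 key_cover(2)[OF assms(1), of h] by auto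
  have h: "(h = 0 \<or> h = 1) \<or> (h = 2 \<or> h = 3)" using assms(3) by linarith
  show "key_offset l r h + 2 ^ key_level l r h \<le> m" using 3 4 h s assms(2) by fastforce
  then show "2 ^ key_level l r h \<le> m" by linarith
qed

text \<open>Key blocks lie inside the window and windows of \<open>reps\<close> end by
  \<open>n\<close>, so the circular reading in \<open>nm_eq_iff\<close> never wraps.\<close>

lemma key_eq_iff:
  assumes "l + 2 \<le> r" "r \<le> m" "h \<le> 3" "i \<in> reps" "j \<in> reps"
  shows "key l r h i = key l r h j \<longleftrightarrow> agree i j (key_offset l r h) (key_offset l r h + 2 ^ key_level l r h)"
proof -
  let ?o = "key_offset l r h" and ?k = "2 ^ key_level l r h"
  note kr = key_range(1)[OF assms(1-3)]
  have b: "i + ?o + ?k \<le> n" "j + ?o + ?k \<le> n" using bound[OF assms(4)] bound[OF assms(5)] kr by linarith+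
  have k0: "0 < (2::nat) ^ key_level l r h" by simp
  have "i + ?o < n" "j + ?o < n" using b k0 by linarith+
  then have "key l r h i = key l r h j \<longleftrightarrow> (\<forall>t<?k. x ((i + ?o + t) mod n) = x ((j + ?o + t) mod n))"
    unfolding key_def using m by (intro nm_eq_iff) auto
  also have "\<dots> \<longleftrightarrow> (\<forall>t<?k. x (i + ?o + t) = x (j + ?o + t))" using b by auto
  also have "\<dots> \<longleftrightarrow> agree i j ?o (?o + ?k)"
  proof
    assume h: "\<forall>t<?k. x (i + ?o + t) = x (j + ?o + t)"
    show "agree i j ?o (?o + ?k)" unfolding agree_def
    proof (intro allI impI)
      fix q assume "?o \<le> q \<and> q < ?o + ?k"
      then show "x (i + q) = x (j + q)" using h[rule_format, of "q - ?o"] by (simp add: less_diff_conv2)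
    qed
  qed (auto simp: agree_def add.assoc)
  finally show ?thesis .
qed

lemma agree_Un: "agree i j p q \<Longrightarrow> agree i j p' r \<Longrightarrow> p' \<le> q \<Longrightarrow> agree i j p r"
  unfolding agree_def by (meson le_trans not_less)

lemma agree_mono: "agree i j p q \<Longrightarrow> p \<le> p' \<Longrightarrow> q' \<le> q \<Longrightarrow> agree i j p' q'"
  unfolding agree_def by (meson le_trans less_le_trans)

lemma agree_refl [simp]: "agree i i p q"
  by (simp add: agree_def)

lemma one_agree: "one_mismatch p q i j \<Longrightarrow> q' \<le> m \<Longrightarrow> q' \<le> p \<or> q \<le> p' \<Longrightarrow> agree i j p' q'"
  unfolding one_mismatch_def agree_def by (metis leD le_trans less_le_trans)

text \<open>In the odd phases the block known from the previous grouping and the block of the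
  present key together cover the half, which extends the agreement to all of it.\<close>

lemma group_ok:
  assumes ok: "task_ok S l r h" and lr: "l + 2 \<le> r" and S': "S' = {i \<in> S. key l r h i = k}" "2 \<le> card S'"
  shows "task_ok S' (next_left l r h) (next_right l r h) (next_phase h)"
proof -
  have o: "S \<subseteq> reps" "r \<le> m" "h \<le> 3"
    "\<And>i j. i \<in> S \<Longrightarrow> j \<in> S \<Longrightarrow> agree i j 0 l" "\<And>i j. i \<in> S \<Longrightarrow> j \<in> S \<Longrightarrow> agree i j r m"
    "\<And>i j. i \<in> S \<Longrightarrow> j \<in> S \<Longrightarrow> h = 1 \<Longrightarrow> agree i j (mid l r) (mid l r + 2 ^ key_level l r h)"
    "\<And>i j. i \<in> S \<Longrightarrow> j \<in> S \<Longrightarrow> h = 3 \<Longrightarrow> agree i j l (l + 2 ^ key_level l r h)"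
    using ok by (auto simp: task_ok_def)
  have ag: "agree i j (key_offset l r h) (key_offset l r h + 2 ^ key_level l r h)" if "i \<in> S'" "j \<in> S'" for i j
    using key_eq_iff[OF lr o(2,3), of i j] that S' o(1) by auto
  have mm: "l < mid l r" "mid l r < r" using lr by linarith+
  have S'S: "S' \<subseteq> S" using S' by auto
  consider "h = 0" | "h = 1" | "h = 2" | "h = 3" using o(3) by linarith
  then show ?thesis
  proof cases
    case 1
    then show ?thesis using ok S' S'S ag lr mm unfolding task_ok_def
      by (auto simp: next_left_def next_right_def next_phase_def key_offset_def key_level_def)
  next
    case 2
    have "agree i j (mid l r) m" if "i \<in> S'" "j \<in> S'" for i j
    proof (rule agree_Un[OF _ o(5)])
      show "agree i j (mid l r) r"
      proof (rule agree_Un)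
        show "agree i j (mid l r) (mid l r + 2 ^ key_level l r h)" using o(6) that S'S 2 by blast
        show "agree i j (key_offset l r h) r" "key_offset l r h \<le> mid l r + 2 ^ key_level l r h"
          using ag[OF that] key_cover(1)[OF lr 2] by simp_all
      qed
    qed (use that S'S in auto)
    then show ?thesis using ok S' S'S lr mm 2 unfolding task_ok_def
      by (auto simp: next_left_def next_right_def next_phase_def)
  next
    case 3
    then show ?thesis using ok S' S'S ag lr mm unfolding task_ok_def
      by (auto simp: next_left_def next_right_def next_phase_def key_offset_def key_level_def)
  next
    case 4
    have "agree i j 0 (mid l r)" if "i \<in> S'" "j \<in> S'" for i j
    proof (rule agree_Un[OF o(4)])
      show "agree i j l (mid l r)"
      proof (rule agree_Un)
        show "agree i j l (l + 2 ^ key_level l r h)" using o(7) that S'S 4 by blast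
        show "agree i j (key_offset l r h) (mid l r)" "key_offset l r h \<le> l + 2 ^ key_level l r h"
          using ag[OF that] key_cover(2)[OF lr 4] by simp_all
      qed
    qed (use that S'S in auto)
    then show ?thesis using ok S' S'S lr mm 4 unfolding task_ok_def
      by (auto simp: next_left_def next_right_def next_phase_def)
  qed
qed

lemma second_ok: "task_ok S l r 0 \<Longrightarrow> l + 2 \<le> r \<Longrightarrow> task_ok S l r 2"
  by (auto simp: task_ok_def)

lemma one_split:
  assumes "p \<le> s" "s \<le> q"
  shows "one_mismatch p q i j \<longleftrightarrow> one_mismatch p s i j \<or> one_mismatch s q i j"
proof -
  have "p \<le> k \<and> k < q \<longleftrightarrow> (p \<le> k \<and> k < s) \<or> (s \<le> k \<and> k < q)" for k using assms by linarith
  then show ?thesis unfolding one_mismatch_def by blast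
qed

lemma one_disjoint:
  assumes "one_mismatch p s i j" "one_mismatch s q i j" "s \<le> m"
  shows False
proof -
  obtain k where k: "k < s" "x (i + k) \<noteq> x (j + k)" using assms(1) by (auto simp: one_mismatch_def)
  obtain k' where k': "s \<le> k'" "\<forall>t<m. t \<noteq> k' \<longrightarrow> x (i + t) = x (j + t)" using assms(2) by (auto simp: one_mismatch_def)
  show False using k k' assms(3) by auto
qed

text \<open>The key block is disjoint from the interval where the mismatch is sought. A partner of
  \<open>i\<close> therefore agrees with it on the key block and ends up in the same group. In phase
  \<open>0\<close> the interval is cut in the middle, and the right part is left to phase
  \<open>2\<close>.\<close>

lemma contr_group:
  assumes ok: "task_ok S l r h" and lr: "l + 2 \<le> r" and i: "i \<in> S"
  defines "p \<equiv> mismatch_from (next_left l r h) (next_right l r h) (next_phase h)" and "q \<equiv> mismatch_to (next_left l r h) (next_right l r h) (next_phase h)"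
  shows "contribution {j \<in> S. key l r h j = key l r h i} p q i = contribution S p q i"
    and "contribution S (mismatch_from l r h) (mismatch_to l r h) i = contribution S p q i + (if h = 0 then contribution S (mismatch_from l r 2) (mismatch_to l r 2) i else 0)"
proof -
  have o: "S \<subseteq> reps" "r \<le> m" "h \<le> 3" using ok by (auto simp: task_ok_def)
  have mm: "l < mid l r" "mid l r < r" using lr by linarith+
  note kr = key_range[OF lr o(2,3)]
  consider "h = 0" | "h = 1" | "h = 2" | "h = 3" using o(3) by linarith
  then have disj: "key_offset l r h + 2 ^ key_level l r h \<le> p \<or> q \<le> key_offset l r h"
    by cases (use kr(3,4) in \<open>auto simp: p_def q_def next_left_def next_right_def next_phase_def mismatch_from_def mismatch_to_def\<close>)
  have "key l r h j = key l r h i" if "j \<in> S" "one_mismatch p q i j" for j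
    using one_agree[OF that(2) kr(1) disj] key_eq_iff[OF lr o(2,3), of i j] o(1) i that(1) by (metis subsetD)
  then have "{j \<in> {j \<in> S. key l r h j = key l r h i}. one_mismatch p q i j} = {j \<in> S. one_mismatch p q i j}" by auto
  then show "contribution {j \<in> S. key l r h j = key l r h i} p q i = contribution S p q i" by (simp add: contribution_def)
  show "contribution S (mismatch_from l r h) (mismatch_to l r h) i = contribution S p q i + (if h = 0 then contribution S (mismatch_from l r 2) (mismatch_to l r 2) i else 0)"
  proof (cases "h = 0")
    case True
    have "{j \<in> S. one_mismatch l r i j} = {j \<in> S. one_mismatch l (mid l r) i j} \<union> {j \<in> S. one_mismatch (mid l r) r i j}"
      using one_split[of l "mid l r" r] mm by auto
    moreover have "{j \<in> S. one_mismatch l (mid l r) i j} \<inter> {j \<in> S. one_mismatch (mid l r) r i j} = {}"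
      using one_disjoint[of l "mid l r" _ _ r] mm o(2) by auto
    moreover have "finite S" using o(1) fin finite_subset by blast
    ultimately have "contribution S l r i = contribution S l (mid l r) i + contribution S (mid l r) r i"
      unfolding contribution_def by (simp add: sum.union_disjoint)
    then show ?thesis using True by (simp add: p_def q_def next_left_def next_right_def next_phase_def mismatch_from_def mismatch_to_def)
  next
    case False
    consider "h = 1" | "h = 2" | "h = 3" using False o(3) by linarith
    then show ?thesis
      by cases (simp_all add: p_def q_def next_left_def next_right_def next_phase_def mismatch_from_def mismatch_to_def)
  qed
qed

lemma not_one_refl: "\<not> one_mismatch p q i i"
  by (simp add: one_mismatch_def)

lemma contr_single: "card S \<le> 1 \<Longrightarrow> i \<in> S \<Longrightarrow> finite S \<Longrightarrow> contribution S p q i = 0"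
proof -
  assume "card S \<le> 1" "i \<in> S" "finite S"
  then have "S = {i}" by (auto simp: card_le_Suc0_iff_eq)
  then show ?thesis by (auto simp: contribution_def not_one_refl intro!: sum.neutral)
qed

text \<open>The windows of a leaf agree everywhere except at offset \<open>l\<close>. Being distinct
  they all differ there, so every other window of the set is a partner.\<close>

lemma contr_leaf:
  assumes ok: "task_ok S l (Suc l) 0" and i: "i \<in> S"
  shows "contribution S (mismatch_from l (Suc l) 0) (mismatch_to l (Suc l) 0) i + wt i = (\<Sum>j\<in>S. wt j)"
proof -
  have o: "S \<subseteq> reps" "l < m" "\<And>i j. i \<in> S \<Longrightarrow> j \<in> S \<Longrightarrow> agree i j 0 l"
    "\<And>i j. i \<in> S \<Longrightarrow> j \<in> S \<Longrightarrow> agree i j (Suc l) m"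
    using ok by (auto simp: task_ok_def)
  have f: "finite S" using o(1) fin finite_subset by blast
  have "one_mismatch l (Suc l) i j \<longleftrightarrow> j \<noteq> i" if j: "j \<in> S" for j
  proof
    assume "j \<noteq> i"
    have other: "x (i + k) = x (j + k)" if "k < m" "k \<noteq> l" for k
      using o(3)[OF i j] o(4)[OF i j] that unfolding agree_def
      by (metis Suc_leI le0 linorder_neqE_nat)
    then have "x (i + l) \<noteq> x (j + l)" using distinct[of i j] i j o(1) \<open>j \<noteq> i\<close> by (metis subsetD)
    then show "one_mismatch l (Suc l) i j" using other unfolding one_mismatch_def by blast
  qed (use not_one_refl in auto)
  then have "{j \<in> S. one_mismatch l (Suc l) i j} = S - {i}" by auto
  then show ?thesis using sum.remove[OF f i, of wt] by (simp add: contribution_def mismatch_from_def mismatch_to_def)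
qed

section \<open>The potential of a task\<close>

definition class_size :: "nat set \<Rightarrow> nat \<Rightarrow> nat \<Rightarrow> nat \<Rightarrow> nat" where
  "class_size S p q i = card {j \<in> S. agree i j p q}"

text \<open>\<open>\<omega> N s\<close> bounds the time per element for a task with \<open>N\<close> elements and \<open>s\<close> open positions.\<close>

definition potential :: "real \<Rightarrow> (nat \<Rightarrow> nat \<Rightarrow> real) \<Rightarrow> nat set \<Rightarrow> nat \<Rightarrow> nat \<Rightarrow> nat \<Rightarrow> real" where
  "potential c \<omega> S l r h = (\<Sum>i\<in>S. if h = 0 then \<omega> (card S) (r - l)
     else if h = 1 then c + \<omega> (class_size S (mid l r) r i) (mid l r - l)
     else (if h = 2 then 2 * c else c) + \<omega> (class_size S l (mid l r) i) (r - mid l r))"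

text \<open>An element of a plain task may be grouped four times, at cost \<open>c\<close> each,
  before it reaches the plain tasks on the halves. The inequality says that the rate of the set pays
  for this and for the rates of the resulting classes.\<close>

definition valid_rate :: "real \<Rightarrow> (nat \<Rightarrow> nat \<Rightarrow> real) \<Rightarrow> bool" where
  "valid_rate c \<omega> \<longleftrightarrow> 0 \<le> c \<and> (\<forall>N s. 0 < N \<and> 0 < s \<longrightarrow> 0 \<le> \<omega> N s) \<and> (\<forall>N\<ge>2. c \<le> \<omega> N 1) \<and>
     (\<forall>S l r. task_ok S l r 0 \<and> l + 2 \<le> r \<longrightarrow>
       (\<Sum>i\<in>S. 4 * c + \<omega> (class_size S (mid l r) r i) (mid l r - l) + \<omega> (class_size S l (mid l r) i) (r - mid l r))
         \<le> (\<Sum>i\<in>S. \<omega> (card S) (r - l)))"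

lemma cls_pos: "finite S \<Longrightarrow> i \<in> S \<Longrightarrow> 0 < class_size S p q i"
  by (auto simp: class_size_def card_gt_0_iff)

lemma pot_nonneg:
  assumes "valid_rate c \<omega>" "task_ok S l r h"
  shows "0 \<le> potential c \<omega> S l r h"
proof -
  have f: "finite S" "l < r" "h \<noteq> 0 \<Longrightarrow> l + 2 \<le> r" "0 < card S"
    using assms(2) fin finite_subset by (auto simp: task_ok_def)
  have w: "0 \<le> \<omega> N s" if "0 < N" "0 < s" for N s using assms(1) that by (auto simp: valid_rate_def)
  have "0 \<le> c" using assms(1) by (auto simp: valid_rate_def)
  then show ?thesis unfolding potential_def
    by (intro sum_nonneg) (use f cls_pos[OF f(1)] in \<open>auto intro!: w add_nonneg_nonneg\<close>)
qed

lemma pot_leaf: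
  assumes "valid_rate c \<omega>" "task_ok S l (Suc l) 0"
  shows "c * real (card S) \<le> potential c \<omega> S l (Suc l) 0"
proof -
  have "c \<le> \<omega> (card S) 1" using assms by (auto simp: valid_rate_def task_ok_def)
  then show ?thesis using mult_left_mono[of c "\<omega> (card S) 1" "real (card S)"]
    by (simp add: potential_def mult.commute)
qed

text \<open>Of the \<open>4 * c\<close> per element, phase \<open>0\<close> spends \<open>c\<close>,
  passes \<open>c\<close> to phase \<open>1\<close> and \<open>2 * c\<close> to phase
  \<open>2\<close>, which in turn passes \<open>c\<close> to phase \<open>3\<close>. Potentials
  refer to classes of the whole half from the outset, so that the two-step grouping does not change
  them.\<close>

lemma pot_step:
  assumes g: "valid_rate c \<omega>" and ok: "task_ok S l r h" and lr: "l + 2 \<le> r"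
    and Ks: "finite Ks" "\<And>k. k \<in> Ks \<Longrightarrow> 2 \<le> card {i \<in> S. key l r h i = k}"
  shows "c * real (card S) + (if h = 0 then potential c \<omega> S l r 2 else 0) +
    (\<Sum>k\<in>Ks. potential c \<omega> {i \<in> S. key l r h i = k} (next_left l r h) (next_right l r h) (next_phase h)) \<le> potential c \<omega> S l r h"
proof -
  have o: "S \<subseteq> reps" "r \<le> m" "h \<le> 3"
    "\<And>i j. i \<in> S \<Longrightarrow> j \<in> S \<Longrightarrow> h = 1 \<Longrightarrow> agree i j (mid l r) (mid l r + 2 ^ key_level l r h)"
    "\<And>i j. i \<in> S \<Longrightarrow> j \<in> S \<Longrightarrow> h = 3 \<Longrightarrow> agree i j l (l + 2 ^ key_level l r h)"
    using ok by (auto simp: task_ok_def)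
  have f: "finite S" using o(1) fin finite_subset by blast
  have mm: "l < mid l r" "mid l r < r" using lr by linarith+
  have c0: "0 \<le> c" and w: "\<And>N s. 0 < N \<Longrightarrow> 0 < s \<Longrightarrow> 0 \<le> \<omega> N s" using g by (auto simp: valid_rate_def)
  note kr = key_range[OF lr o(2,3)]
  have keyag: "key l r h i = key l r h j \<longleftrightarrow> agree i j (key_offset l r h) (key_offset l r h + 2 ^ key_level l r h)"
    if "i \<in> S" "j \<in> S" for i j using key_eq_iff[OF lr o(2,3)] that o(1) by blast
  have sym: "agree i j p q \<longleftrightarrow> agree j i p q" for i j p q by (auto simp: agree_def)
  let ?G = "\<lambda>i. {j \<in> S. key l r h j = key l r h i}"
  \<comment> \<open>The share of \<open>i\<close> in the potential of the group that receives
    it.\<close>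
  let ?e = "\<lambda>i. if h = 0 then c + \<omega> (class_size S (mid l r) r i) (mid l r - l)
     else if h = 1 then \<omega> (class_size S (mid l r) r i) (mid l r - l)
     else if h = 2 then c + \<omega> (class_size S l (mid l r) i) (r - mid l r)
     else \<omega> (class_size S l (mid l r) i) (r - mid l r)"
  have h: "h = 0 \<or> h = 1 \<or> h = 2 \<or> h = 3" using o(3) by linarith
  \<comment> \<open>Agreement on the whole half implies an equal key, so the first grouping splits
    no class.\<close>
  have sub: "class_size (?G i) p q i = class_size S p q i"
    if i: "i \<in> S" and "p \<le> key_offset l r h" "key_offset l r h + 2 ^ key_level l r h \<le> q" for i p q
  proof -
    have "{j \<in> ?G i. agree i j p q} = {j \<in> S. agree i j p q}"
      using keyag[OF i] agree_mono[of i _ p q "key_offset l r h" "key_offset l r h + 2 ^ key_level l r h"] that by force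
    then show ?thesis by (simp add: class_size_def)
  qed
  \<comment> \<open>After the second block the groups are exactly the classes of the half.\<close>
  have eqc: "card (?G i) = class_size S (if h = 1 then mid l r else l) (if h = 1 then r else mid l r) i"
    if i: "i \<in> S" and h13: "h = 1 \<or> h = 3" for i
  proof -
    have "key l r h j = key l r h i \<longleftrightarrow> agree i j (if h = 1 then mid l r else l) (if h = 1 then r else mid l r)"
      if j: "j \<in> S" for j
    proof
      assume "key l r h j = key l r h i"
      then have a: "agree i j (key_offset l r h) (key_offset l r h + 2 ^ key_level l r h)" using keyag[OF i j] by simp
      show "agree i j (if h = 1 then mid l r else l) (if h = 1 then r else mid l r)"
      proof (cases "h = 1")
        case True
        have "key_offset l r h \<le> mid l r + 2 ^ key_level l r h" "key_offset l r h + 2 ^ key_level l r h = r"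
          using key_cover(1)[OF lr True] by auto
        then show ?thesis using agree_Un[OF o(4)[OF i j True], of "key_offset l r h" r] a True by simp
      next
        case False
        then have h3: "h = 3" using h13 by simp
        have "key_offset l r h \<le> l + 2 ^ key_level l r h" "key_offset l r h + 2 ^ key_level l r h = mid l r"
          using key_cover(2)[OF lr h3] by auto
        then show ?thesis using agree_Un[OF o(5)[OF i j h3], of "key_offset l r h" "mid l r"] a h3 by simp
      qed
    next
      assume "agree i j (if h = 1 then mid l r else l) (if h = 1 then r else mid l r)"
      then have "agree i j (key_offset l r h) (key_offset l r h + 2 ^ key_level l r h)"
        using kr(3,4) h13 by (auto intro: agree_mono)
      then show "key l r h j = key l r h i" using keyag[OF i j] by simp
    qed
    then have "?G i = {j \<in> S. agree i j (if h = 1 then mid l r else l) (if h = 1 then r else mid l r)}" by auto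
    then show ?thesis by (simp add: class_size_def)
  qed
  have "potential c \<omega> {i \<in> S. key l r h i = k} (next_left l r h) (next_right l r h) (next_phase h) = (\<Sum>i\<in>{i \<in> S. key l r h i = k}. ?e i)" for k
    unfolding potential_def
  proof (rule sum.cong[OF refl])
    fix i assume "i \<in> {i \<in> S. key l r h i = k}"
    then have i: "i \<in> S" and k: "{i \<in> S. key l r h i = k} = ?G i" by auto
    show "(if next_phase h = 0 then \<omega> (card {i \<in> S. key l r h i = k}) (next_right l r h - next_left l r h)
      else if next_phase h = 1 then c + \<omega> (class_size {i \<in> S. key l r h i = k} (mid (next_left l r h) (next_right l r h)) (next_right l r h) i)
             (mid (next_left l r h) (next_right l r h) - next_left l r h)
      else (if next_phase h = 2 then 2 * c else c) +
        \<omega> (class_size {i \<in> S. key l r h i = k} (next_left l r h) (mid (next_left l r h) (next_right l r h)) i)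
            (next_right l r h - mid (next_left l r h) (next_right l r h))) = ?e i"
      unfolding k using h sub[OF i] eqc[OF i] kr(3,4)
      by (elim disjE) (simp_all add: next_phase_def next_left_def next_right_def)
  qed
  then have "(\<Sum>k\<in>Ks. potential c \<omega> {i \<in> S. key l r h i = k} (next_left l r h) (next_right l r h) (next_phase h)) =
    (\<Sum>k\<in>Ks. \<Sum>i\<in>{i \<in> S. key l r h i = k}. ?e i)" by simp
  also have "\<dots> \<le> (\<Sum>i\<in>S. ?e i)"
    using f Ks(1) by (rule sum_groups_le) (use c0 w cls_pos[OF f] mm in \<open>auto intro!: add_nonneg_nonneg\<close>)
  finally have le: "(\<Sum>k\<in>Ks. potential c \<omega> {i \<in> S. key l r h i = k} (next_left l r h) (next_right l r h) (next_phase h)) \<le> (\<Sum>i\<in>S. ?e i)" .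
  show ?thesis
  proof (cases "h = 0")
    case True
    have "c * real (card S) + potential c \<omega> S l r 2 + (\<Sum>i\<in>S. ?e i) =
      (\<Sum>i\<in>S. 4 * c + \<omega> (class_size S (mid l r) r i) (mid l r - l) + \<omega> (class_size S l (mid l r) i) (r - mid l r))"
      unfolding potential_def using True by (simp add: sum.distrib)
    also have "\<dots> \<le> potential c \<omega> S l r h"
      using g ok lr True by (auto simp: valid_rate_def potential_def)
    finally show ?thesis using le True by simp
  next
    case False
    have "c * real (card S) + (\<Sum>i\<in>S. ?e i) = potential c \<omega> S l r h"
      unfolding potential_def using False h by (elim disjE) (simp_all add: sum.distrib)
    then show ?thesis using le False by simp
  qed
qed

text \<open>A binary tree with \<open>s\<close> leaves has \<open>2 * s - 1\<close> nodes, each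
  charged \<open>4 * c\<close>; the required inequality is even an equality.\<close>

lemma good_linear:
  assumes "0 \<le> c"
  shows "valid_rate c (\<lambda>N s. 4 * c * (2 * real s - 1))"
proof -
  have eq: "(\<Sum>i\<in>S. 4 * c + 4 * c * (2 * real (mid l r - l) - 1) + 4 * c * (2 * real (r - mid l r) - 1))
      = (\<Sum>i\<in>S. 4 * c * (2 * real (r - l) - 1))" if "l + 2 \<le> r" for S :: "nat set" and l r
  proof -
    have "real (r - l) = real (mid l r - l) + real (r - mid l r)"
      unfolding of_nat_add[symmetric] using that by (intro arg_cong[where f = real]) linarith
    then show ?thesis by (simp add: algebra_simps)
  qed
  have "(\<Sum>i\<in>S. 4 * c + 4 * c * (2 * real (mid l r - l) - 1) + 4 * c * (2 * real (r - mid l r) - 1))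
      \<le> (\<Sum>i\<in>S. 4 * c * (2 * real (r - l) - 1))" if "l + 2 \<le> r" for S :: "nat set" and l r
    by (rule eq_refl, rule eq[OF that])
  moreover have "0 \<le> 4 * c * (2 * real s - 1)" if "0 < s" for s using assms that by (intro mult_nonneg_nonneg) auto
  ultimately show ?thesis using assms unfolding valid_rate_def by (intro conjI allI impI) auto
qed

text \<open>Both halves have depth at most \<open>D\<close>, one less than the interval. By
  subadditivity of entropy their rates sum to at most \<open>D\<close> times
  \<open>4 * c * N * log 2 N\<close>, and the remaining unit of depth pays \<open>4 * c\<close> per
  element because \<open>N \<ge> 2\<close> makes the logarithm at least one.\<close>

lemma good_log:
  assumes "0 \<le> c"
  shows "valid_rate c (\<lambda>N s. 4 * c * log 2 (real N) * real (depth s))"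
proof -
  have "(\<Sum>i\<in>S. 4 * c + 4 * c * log 2 (real (class_size S (mid l r) r i)) * real (depth (mid l r - l)) +
         4 * c * log 2 (real (class_size S l (mid l r) i)) * real (depth (r - mid l r)))
      \<le> (\<Sum>i\<in>S. 4 * c * log 2 (real (card S)) * real (depth (r - l)))"
    if ok: "task_ok S l r 0" and lr: "l + 2 \<le> r" for S l r
  proof -
    have o: "S \<subseteq> reps" "r \<le> m" "2 \<le> card S" "\<And>i j. i \<in> S \<Longrightarrow> j \<in> S \<Longrightarrow> agree i j 0 l"
      "\<And>i j. i \<in> S \<Longrightarrow> j \<in> S \<Longrightarrow> agree i j r m"
      using ok by (auto simp: task_ok_def)
    have f: "finite S" using o(1) fin finite_subset by blast
    define D where "D = real (depth (r - mid l r))"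
    have half: "(r - l + 1) div 2 = r - mid l r" using lr by linarith
    have d: "real (depth (r - l)) = 1 + D" unfolding D_def using depth_rec[of "r - l"] lr half by simp
    have dm: "real (depth (mid l r - l)) \<le> D" unfolding D_def by (simp, intro depth_mono) linarith
    let ?a = "\<lambda>i. log 2 (real (class_size S (mid l r) r i))" and ?b = "\<lambda>i. log 2 (real (class_size S l (mid l r) i))"
    \<comment> \<open>Agreement becomes equality of function values, the form in which the entropy
      bound states its classes.\<close>
    let ?f = "\<lambda>p q i. map (\<lambda>k. x (i + k)) [p..<q]"
    have fe: "?f p q j = ?f p q i \<longleftrightarrow> agree i j p q" for p q i j
      by (auto simp: agree_def)
    \<comment> \<open>Windows of the task agree outside the interval; if they also agree on both
      halves, they coincide.\<close>
    have "i = j" if ij: "i \<in> S" "j \<in> S" and a: "agree j i (mid l r) r" "agree j i l (mid l r)" for i j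
    proof -
      have "agree j i l r" using agree_Un[OF a(2,1)] by simp
      then have "agree j i 0 r" using agree_Un[OF o(4)[OF ij(2,1)]] by blast
      then have "agree j i 0 m" using agree_Un o(5)[OF ij(2,1)] by blast
      then show "i = j" using distinct[of j i] ij o(1) by (auto simp: agree_def)
    qed
    then have "(\<Sum>i\<in>S. ?a i + ?b i) \<le> real (card S) * log 2 (real (card S))"
      using entropy_subadditive[OF f, of "?f (mid l r) r" "?f l (mid l r)"]
      unfolding fe class_size_def by (auto simp: agree_def)
    then have ent: "4 * c * D * (\<Sum>i\<in>S. ?a i + ?b i) \<le> 4 * c * D * (real (card S) * log 2 (real (card S)))"
      using assms by (intro mult_left_mono) (auto simp: D_def)
    have "log 2 2 \<le> log 2 (real (card S))" using o(3) by (subst log_le_cancel_iff) auto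
    then have L: "1 \<le> log 2 (real (card S))" by simp
    have "(\<Sum>i\<in>S. 4 * c + 4 * c * ?a i * real (depth (mid l r - l)) + 4 * c * ?b i * D)
      \<le> (\<Sum>i\<in>S. 4 * c * log 2 (real (card S)) + 4 * c * D * (?a i + ?b i))"
    proof (rule sum_mono)
      fix i assume "i \<in> S"
      then have "0 \<le> ?a i" using cls_pos[OF f, of i "mid l r" r] by simp
      then have "c * ?a i * real (depth (mid l r - l)) \<le> c * ?a i * D"
        using dm assms by (intro mult_left_mono) auto
      moreover have "c \<le> c * log 2 (real (card S))" using L assms mult_left_mono[of 1 _ c] by simp
      ultimately show "4 * c + 4 * c * ?a i * real (depth (mid l r - l)) + 4 * c * ?b i * D
        \<le> 4 * c * log 2 (real (card S)) + 4 * c * D * (?a i + ?b i)"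
        by (simp add: algebra_simps)
    qed
    also have "\<dots> = 4 * c * (real (card S) * log 2 (real (card S))) + 4 * c * D * (\<Sum>i\<in>S. ?a i + ?b i)"
      by (simp only: sum.distrib sum_constant sum_distrib_left[symmetric]) (simp add: algebra_simps)
    also have "\<dots> \<le> 4 * c * (real (card S) * log 2 (real (card S))) + 4 * c * D * (real (card S) * log 2 (real (card S)))"
      using ent by simp
    also have "\<dots> = (\<Sum>i\<in>S. 4 * c * log 2 (real (card S)) * real (depth (r - l)))"
      by (simp add: d algebra_simps)
    finally show ?thesis by (simp add: D_def)
  qed
  moreover have "c \<le> 4 * c * log 2 (real N) * real (depth 1)" if "2 \<le> N" for N
  proof -
    have "log 2 2 \<le> log 2 (real N)" using that by (subst log_le_cancel_iff) auto
    then have "c * 1 \<le> c * (4 * log 2 (real N))" using assms by (intro mult_left_mono) auto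
    then show ?thesis by (simp add: depth_def)
  qed
  ultimately show ?thesis using assms unfolding valid_rate_def by (auto intro!: mult_nonneg_nonneg)
qed

end

lemma sum_lessThan_add:
  fixes f :: "nat \<Rightarrow> 'a :: comm_monoid_add"
  shows "(\<Sum>q<p + k. f q) = (\<Sum>q<p. f q) + (\<Sum>t<k. f (p + t))"
  by (induction k) (simp_all add: add.assoc)

section \<open>The stack of pending tasks\<close>

context windows
begin

text \<open>The amount that a pending task still has to add to the result of \<open>i\<close>;
  \<open>tasks_inv\<close> balances it against what has been accumulated.\<close>

definition task_value :: "(nat \<Rightarrow> nat) \<Rightarrow> nat \<Rightarrow> task \<Rightarrow> nat" where
  "task_value P i = (\<lambda>(u, v, l, r, h). if i \<in> P ` {u..<v} then contribution (P ` {u..<v}) (mismatch_from l r h) (mismatch_to l r h) i else 0)"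

definition task_pot :: "real \<Rightarrow> (nat \<Rightarrow> nat \<Rightarrow> real) \<Rightarrow> (nat \<Rightarrow> nat) \<Rightarrow> task \<Rightarrow> real" where
  "task_pot c \<omega> P = (\<lambda>(u, v, l, r, h). potential c \<omega> (P ` {u..<v}) l r h)"

text \<open>The last inequality bounds the stack through the sum of index, set size and interval
  length. The continuation pushed in phase \<open>0\<close> lifts the groups above it by one, which
  the odd phases are granted as an extra unit; the halving of the interval that follows repays
  it.\<close>

definition task_inv :: "(nat \<Rightarrow> nat) \<Rightarrow> nat \<Rightarrow> nat \<Rightarrow> task \<Rightarrow> bool" where
  "task_inv P D q = (\<lambda>(u, v, l, r, h). u + 2 \<le> v \<and> v \<le> D \<and> task_ok (P ` {u..<v}) l r h \<and>
     q + (v - u) + (r - l) \<le> 2 * n + (if h = 1 \<or> h = 3 then 1 else 0))"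

definition laminar :: "task \<Rightarrow> task \<Rightarrow> bool" where
  "laminar = (\<lambda>(u, v, _) (u', v', _). v' \<le> u \<or> v \<le> u' \<or> (u \<le> u' \<and> v' \<le> v))"

text \<open>The stack \<open>tk\<close> of height \<open>sp\<close> describes pending subsets of the array \<open>P\<close> of representatives;
  a task may be permuted in place since those below it are disjoint from it or contain it.\<close>

definition tasks_inv :: "(nat \<Rightarrow> nat) \<Rightarrow> nat \<Rightarrow> nat \<Rightarrow> (nat \<Rightarrow> task) \<Rightarrow> (nat \<Rightarrow> nat) \<Rightarrow> bool" where
  "tasks_inv P D sp tk acc \<longleftrightarrow> inj_on P {..<D} \<and> P ` {..<D} = reps \<and> (\<forall>q<sp. task_inv P D q (tk q)) \<and>
     (\<forall>q<sp. \<forall>q'<q. laminar (tk q') (tk q)) \<and>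
     (\<forall>i\<in>reps. acc i + (\<Sum>q<sp. task_value P i (tk q)) = contribution reps 0 m i)"

lemma tinv_leaf:
  assumes I: "tasks_inv P D (Suc s) tk acc" and t: "tk s = (u, v, l, Suc l, 0)"
    and acc: "\<And>i. i \<in> P ` {u..<v} \<Longrightarrow> acc' i + wt i = acc i + (\<Sum>j\<in>P ` {u..<v}. wt j)"
      "\<And>i. i \<in> reps \<Longrightarrow> i \<notin> P ` {u..<v} \<Longrightarrow> acc' i = acc i"
  shows "tasks_inv P D s tk acc'"
proof -
  have ok: "task_ok (P ` {u..<v}) l (Suc l) 0" using I t by (auto simp: tasks_inv_def task_inv_def)
  have "acc' i + (\<Sum>q<s. task_value P i (tk q)) = contribution reps 0 m i" if i: "i \<in> reps" for i
  proof -
    have *: "acc i + ((\<Sum>q<s. task_value P i (tk q)) + task_value P i (tk s)) = contribution reps 0 m i"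
      using I i by (simp add: tasks_inv_def)
    have "acc' i = acc i + task_value P i (tk s)"
    proof (cases "i \<in> P ` {u..<v}")
      case True
      then show ?thesis using acc(1)[OF True] contr_leaf[OF ok True] by (simp add: task_value_def t)
    qed (use acc(2) i t in \<open>auto simp: task_value_def\<close>)
    then show ?thesis using * by simp
  qed
  then show ?thesis using I by (auto simp: tasks_inv_def)
qed

text \<open>The ranges of the remaining tasks are disjoint from the permuted one or contain it, so
  their sets are unchanged. Results are preserved by \<open>contr_group\<close>, where a dropped
  group of one window contributes nothing, and potentials by \<open>pot_step\<close>.\<close>

lemma tinv_split:
  assumes I: "tasks_inv P D (Suc s) tk acc" and t: "tk s = (u, v, l, r, h)" and lr: "l + 2 \<le> r"
    and gd: "valid_rate c \<omega>"
    and tk': "\<And>q. q < s \<Longrightarrow> tk' q = tk q" "h = 0 \<Longrightarrow> tk' s = (u, v, l, r, 2)"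
    and s0: "s0 = (if h = 0 then s + 1 else s)"
    and G: "grouped n u v (\<lambda>p. key l r h (P p)) P s0 (next_left l r h, next_right l r h, next_phase h) P' sp' tk'"
    and P': "\<And>p. p < u \<or> v \<le> p \<Longrightarrow> P' p = P p"
  shows "tasks_inv P' D sp' tk' acc"
    and "(\<Sum>q<sp'. task_pot c \<omega> P' (tk' q)) + c * real (v - u) \<le> (\<Sum>q<Suc s. task_pot c \<omega> P (tk q))"
proof -
  let ?S = "P ` {u..<v}" and ?g = "(next_left l r h, next_right l r h, next_phase h)"
  let ?k = "key l r h"
  obtain ks U V where im: "P' ` {u..<v} = ?S" and ks: "distinct ks" "set ks = {k. 2 \<le> key_count (\<lambda>p. ?k (P p)) u v k}"
     "sp' = s0 + length ks"
    and new: "\<And>t. t < length ks \<Longrightarrow> tk' (s0 + t) = (U t, V t, ?g) \<and> u \<le> U t \<and> U t + 2 \<le> V t \<and> V t \<le> v \<and>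
        t \<le> U t - u \<and> P' ` {U t..<V t} = P ` {q \<in> {u..<v}. ?k (P q) = ks ! t} \<and> (\<forall>t'<t. V t' \<le> U t)"
    using G unfolding grouped_def by blast
  have inj: "inj_on P {..<D}" and rP: "P ` {..<D} = reps" and tokq: "\<And>q. q < Suc s \<Longrightarrow> task_inv P D q (tk q)"
    and lamq: "\<And>q q'. q < Suc s \<Longrightarrow> q' < q \<Longrightarrow> laminar (tk q') (tk q)"
    and accq: "\<And>i. i \<in> reps \<Longrightarrow> acc i + (\<Sum>q<Suc s. task_value P i (tk q)) = contribution reps 0 m i"
    using I unfolding tasks_inv_def by blast+
  have T: "u + 2 \<le> v" "v \<le> D" and ok: "task_ok ?S l r h"
    and sz: "s + (v - u) + (r - l) \<le> 2 * n + (if h = 1 \<or> h = 3 then 1 else 0)"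
    using tokq[of s] t by (auto simp: task_inv_def)
  have o: "?S \<subseteq> reps" "r \<le> m" "h \<le> 3" using ok by (auto simp: task_ok_def)
  have fS: "finite ?S" by simp
  have injS: "inj_on P {u..<v}" using inj by (rule inj_on_subset) (use T in auto)
  have cS: "card ?S = v - u" using card_image[OF injS] by simp
  have grp: "P ` {q \<in> {u..<v}. ?k (P q) = k} = {i \<in> ?S. ?k i = k}" for k by auto
  have key_count: "key_count (\<lambda>p. ?k (P p)) u v k = card {i \<in> ?S. ?k i = k}" for k
  proof -
    have "card {i \<in> ?S. ?k i = k} = card {q \<in> {u..<v}. ?k (P q) = k}"
      unfolding grp[symmetric] by (rule card_image) (rule inj_on_subset[OF injS], auto)
    also have "{q \<in> {u..<v}. ?k (P q) = k} = {q. u \<le> q \<and> q < v \<and> ?k (P q) = k}" by auto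
    finally show ?thesis by (simp add: key_count_def)
  qed
  have newt: "tk' (s0 + t) = (U t, V t, ?g)" if "t < length ks" for t using new[OF that] by simp
  have newset: "P' ` {U t..<V t} = {i \<in> ?S. ?k i = ks ! t}" "2 \<le> card {i \<in> ?S. ?k i = ks ! t}"
    if "t < length ks" for t
    using new[OF that] nth_mem[OF that] ks(2) by (auto simp: grp key_count[symmetric])
  \<comment> \<open>Only ranges that cut the permuted one could notice the permutation.\<close>
  have split: "P' ` {p..<q} = P ` {p..<q}" if pq: "q \<le> u \<or> v \<le> p \<or> (p \<le> u \<and> v \<le> q)" for p q
  proof -
    consider "q \<le> u \<or> v \<le> p" | "p \<le> u" "v \<le> q" using pq by blast
    then show ?thesis
    proof cases
      case 1 then show ?thesis using P' by (intro image_cong) auto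
    next
      case 2
      then have e: "{p..<q} = {p..<u} \<union> {u..<v} \<union> {v..<q}" using T by auto
      have "P' ` {p..<u} = P ` {p..<u}" "P' ` {v..<q} = P ` {v..<q}" using P' by (auto intro!: image_cong)
      then show ?thesis unfolding e image_Un using im by simp
    qed
  qed
  have old: "P' ` {u'..<v'} = P ` {u'..<v'}" if "q < s" "tk q = (u', v', g)" for q u' v' g
  proof (rule split)
    show "v' \<le> u \<or> v \<le> u' \<or> (u' \<le> u \<and> v \<le> v')"
      using lamq[of s q] that t by (auto simp: laminar_def)
  qed
  have rP': "P' ` {..<D} = reps" using split[of D 0] T rP by (simp add: atLeast0LessThan)
  have "card (P' ` {..<D}) = card {..<D}" using rP rP' card_image[OF inj] by simp
  then have inj': "inj_on P' {..<D}" by (intro eq_card_imp_inj_on) auto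
  have q_cases: "q < s \<or> (h = 0 \<and> q = s) \<or> (\<exists>t<length ks. q = s0 + t)" if "q < sp'" for q
  proof -
    have "q < s0 \<or> (\<exists>t<length ks. q = s0 + t)"
      using that ks(3) by (metis add_diff_inverse_nat nat_add_left_cancel_less)
    then show ?thesis using s0 by (auto split: if_splits)
  qed
  have tok': "task_inv P' D q (tk' q)" if q: "q < sp'" for q
    using q_cases[OF q]
  proof (elim disjE exE conjE)
    assume qs: "q < s"
    obtain u' v' g where g: "tk q = (u', v', g)" by (metis prod_cases3)
    show ?thesis using tokq[of q] qs old[OF qs g] g tk'(1)[OF qs] by (auto simp: task_inv_def)
  next
    assume h: "h = 0" and q: "q = s"
    show ?thesis using T second_ok[of ?S l r] ok lr sz h im tk'(2) q by (auto simp: task_inv_def)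
  next
    fix t assume t: "t < length ks" "q = s0 + t"
    note nt = new[OF t(1)]
    have ok': "task_ok (P' ` {U t..<V t}) (next_left l r h) (next_right l r h) (next_phase h)"
      using group_ok[OF ok lr newset(1)[OF t(1)]] newset[OF t(1)] by simp
    \<comment> \<open>Each of the \<open>t\<close> groups below is matched by a position left of
      this group, so stack height plus group size does not grow.\<close>
    have a: "t + (V t - U t) \<le> v - u" using nt by linarith
    have le: "(if h = 1 \<or> h = 3 then 1 else 0) \<le> (1::nat)" by simp
    consider "h = 0" | "h = 1" | "h = 2" | "h = 3" using o(3) by linarith
    then have "q + (V t - U t) + (next_right l r h - next_left l r h) \<le> 2 * n + (if next_phase h = 1 \<or> next_phase h = 3 then 1 else 0)"
    proof cases
      case 1
      then have "q = s + 1 + t" using t s0 by simp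
      then show ?thesis using a sz 1 by (simp add: next_right_def next_left_def next_phase_def)
    next
      case 2
      then have "q = s + t" using t s0 by simp
      moreover have "mid l r - l + 1 \<le> r - l" using lr by linarith
      ultimately have "q + (V t - U t) + (mid l r - l) \<le> 2 * n"
        using a sz le by linarith
      then show ?thesis using 2 by (simp add: next_right_def next_left_def next_phase_def)
    next
      case 3
      then have "q = s + t" using t s0 by simp
      then show ?thesis using a sz 3 by (simp add: next_right_def next_left_def next_phase_def)
    next
      case 4
      then have "q = s + t" using t s0 by simp
      moreover have "r - mid l r + 1 \<le> r - l" using lr by linarith
      ultimately have "q + (V t - U t) + (r - mid l r) \<le> 2 * n"
        using a sz le by linarith
      then show ?thesis using 4 by (simp add: next_right_def next_left_def next_phase_def)
    qed
    then show ?thesis using nt T ok' t by (auto simp: task_inv_def)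
  qed
  have lam': "laminar (tk' q') (tk' q)" if q: "q < sp'" "q' < q" for q q'
  proof -
    have in_uv: "\<exists>u1 v1 g1. tk' p = (u1, v1, g1) \<and> u \<le> u1 \<and> v1 \<le> v" if "p < sp'" "\<not> p < s" for p
      using q_cases[OF that(1)] that(2) tk'(2) new by fastforce
    show ?thesis
    proof (cases "q < s")
      case True then show ?thesis using lamq[of q q'] q tk'(1) by simp
    next
      case False
      obtain u1 v1 g1 where 1: "tk' q = (u1, v1, g1)" "u \<le> u1" "v1 \<le> v" using in_uv[OF q(1) False] by blast
      show ?thesis
      proof (cases "q' < s")
        case True
        obtain u2 v2 g2 where 2: "tk q' = (u2, v2, g2)" by (metis prod_cases3)
        have "laminar (tk q') (tk s)" using lamq[of s q'] True by simp
        then show ?thesis using 1 2 t tk'(1)[OF True] by (auto simp: laminar_def)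
      next
        case q's: False
        show ?thesis
        proof (cases "h = 0 \<and> q' = s")
          case True then show ?thesis using tk'(2) 1 by (auto simp: laminar_def)
        next
          case False
          then obtain t' where t': "t' < length ks" "q' = s0 + t'" using q_cases[of q'] q q's by auto
          then obtain t where t: "t < length ks" "q = s0 + t" using q_cases[of q] q s0 by (auto split: if_splits)
          have "t' < t" using t t' q by simp
          then show ?thesis using new[OF t(1)] new[OF t'(1)] t t' by (auto simp: laminar_def)
        qed
      qed
    qed
  qed
  have sum_split: "(\<Sum>q<sp'. F (tk' q)) = (\<Sum>q<s. F (tk' q)) + (if h = 0 then F (tk' s) else 0) +
      (\<Sum>t<length ks. F (tk' (s0 + t)))" for F :: "task \<Rightarrow> 'b :: comm_monoid_add"
  proof -
    have "(\<Sum>q<s0 + length ks. F (tk' q)) = (\<Sum>q<s0. F (tk' q)) + (\<Sum>t<length ks. F (tk' (s0 + t)))"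
      by (rule sum_lessThan_add)
    then show ?thesis using ks(3) s0 by auto
  qed
  have ks_sum: "(\<Sum>t<length ks. F (ks ! t)) = (\<Sum>k\<in>set ks. F k)" for F :: "nat \<Rightarrow> 'b :: comm_monoid_add"
    using sum.reindex_bij_betw[OF bij_betw_nth[OF ks(1) refl refl]] .
  have "acc i + (\<Sum>q<sp'. task_value P' i (tk' q)) = contribution reps 0 m i" if i: "i \<in> reps" for i
  proof -
    have "(\<Sum>q<s. task_value P' i (tk' q)) = (\<Sum>q<s. task_value P i (tk q))"
    proof (rule sum.cong[OF refl])
      fix q assume "q \<in> {..<s}"
      then have qs: "q < s" by simp
      obtain u' v' l' r' h' where g: "tk q = (u', v', l', r', h')" by (metis prod_cases5)
      show "task_value P' i (tk' q) = task_value P i (tk q)" using old[OF qs g] g tk'(1)[OF qs] by (simp add: task_value_def)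
    qed
    moreover have "(if h = 0 then task_value P' i (tk' s) else 0) + (\<Sum>t<length ks. task_value P' i (tk' (s0 + t))) =
        task_value P i (tk s)"
    proof (cases "i \<in> ?S")
      case False
      have "task_value P' i (tk' (s0 + t)) = 0" if "t < length ks" for t
      proof -
        have "i \<notin> P' ` {U t..<V t}" unfolding newset(1)[OF that] using False by blast
        then show ?thesis by (simp add: task_value_def newt[OF that])
      qed
      then show ?thesis using False tk'(2) im t by (simp add: task_value_def)
    next
      case True
      let ?p = "mismatch_from (next_left l r h) (next_right l r h) (next_phase h)" and ?q = "mismatch_to (next_left l r h) (next_right l r h) (next_phase h)"
      let ?G = "\<lambda>k. {j \<in> ?S. ?k j = k}"
      have "(\<Sum>t<length ks. task_value P' i (tk' (s0 + t))) = (\<Sum>t<length ks. if ?k i = ks ! t then contribution (?G (ks ! t)) ?p ?q i else 0)"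
        by (rule sum.cong) (use True in \<open>auto simp: task_value_def newt newset(1)\<close>)
      also have "\<dots> = (\<Sum>k\<in>set ks. if ?k i = k then contribution (?G k) ?p ?q i else 0)"
        by (rule ks_sum[of "\<lambda>k. if ?k i = k then contribution (?G k) ?p ?q i else 0"])
      also have "\<dots> = (if ?k i \<in> set ks then contribution (?G (?k i)) ?p ?q i else 0)" by simp
      also have "\<dots> = contribution (?G (?k i)) ?p ?q i"
      proof (cases "?k i \<in> set ks")
        case False
        then have "card (?G (?k i)) \<le> 1" using ks(2) key_count[of "?k i"] by simp
        then have "contribution (?G (?k i)) ?p ?q i = 0" by (rule contr_single) (use True in auto)
        then show ?thesis using False by simp
      qed simp
      also have "\<dots> = contribution ?S ?p ?q i" by (rule contr_group(1)[OF ok lr True])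
      finally show ?thesis using contr_group(2)[OF ok lr True] True tk'(2) im t
        by (auto simp: task_value_def)
    qed
    ultimately show ?thesis using accq[OF i] sum_split[of "task_value P' i"] by simp
  qed
  then show "tasks_inv P' D sp' tk' acc" unfolding tasks_inv_def using inj' rP' tok' lam' by blast
  have "(\<Sum>q<s. task_pot c \<omega> P' (tk' q)) = (\<Sum>q<s. task_pot c \<omega> P (tk q))"
  proof (rule sum.cong[OF refl])
    fix q assume "q \<in> {..<s}"
    then have qs: "q < s" by simp
    obtain u' v' l' r' h' where g: "tk q = (u', v', l', r', h')" by (metis prod_cases5)
    show "task_pot c \<omega> P' (tk' q) = task_pot c \<omega> P (tk q)" using old[OF qs g] g tk'(1)[OF qs] by (simp add: task_pot_def)
  qed
  moreover have "(\<Sum>t<length ks. task_pot c \<omega> P' (tk' (s0 + t))) =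
     (\<Sum>k\<in>set ks. potential c \<omega> {i \<in> ?S. ?k i = k} (next_left l r h) (next_right l r h) (next_phase h))"
  proof -
    have "(\<Sum>t<length ks. task_pot c \<omega> P' (tk' (s0 + t))) =
      (\<Sum>t<length ks. potential c \<omega> {i \<in> ?S. ?k i = ks ! t} (next_left l r h) (next_right l r h) (next_phase h))"
      by (rule sum.cong) (auto simp: task_pot_def newt newset(1))
    then show ?thesis using ks_sum[of "\<lambda>k. potential c \<omega> {i \<in> ?S. ?k i = k} (next_left l r h) (next_right l r h) (next_phase h)"] by simp
  qed
  moreover have "c * real (v - u) + (if h = 0 then potential c \<omega> ?S l r 2 else 0) +
    (\<Sum>k\<in>set ks. potential c \<omega> {i \<in> ?S. ?k i = k} (next_left l r h) (next_right l r h) (next_phase h)) \<le> potential c \<omega> ?S l r h"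
    unfolding cS[symmetric]
  proof (rule pot_step[OF gd ok lr])
    fix k assume "k \<in> set ks"
    then show "2 \<le> card {i \<in> ?S. ?k i = k}" using ks(2) key_count[of k] by simp
  qed simp
  ultimately show "(\<Sum>q<sp'. task_pot c \<omega> P' (tk' q)) + c * real (v - u) \<le> (\<Sum>q<Suc s. task_pot c \<omega> P (tk q))"
    using sum_split[of "task_pot c \<omega> P'"] tk'(2) im t by (auto simp: task_pot_def)
qed

lemma tpot_nonneg:
  assumes "tasks_inv P D sp tk acc" "valid_rate c \<omega>" "q < sp"
  shows "0 \<le> task_pot c \<omega> P (tk q)"
proof -
  obtain u v l r h where t: "tk q = (u, v, l, r, h)" by (metis prod_cases5)
  then have "task_ok (P ` {u..<v}) l r h" using assms by (auto simp: tasks_inv_def task_inv_def)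
  from pot_nonneg[OF assms(2) this] show ?thesis by (simp add: task_pot_def t)
qed

end

section \<open>The search for pairs at distance one\<close>

text \<open>Registers: 31 holds the height of the stack, 20 to 24 the current task, 26 and 27 the level and
  offset of its keys, 28 to 30 the interval and phase of the tasks it pushes. Arrays: 10 holds the
  representatives, permuted in place by the grouping, 6 the names of the windows, 14 and 16 the
  weights and the results, indexed by names, 17 to 21 the stack, 23 the counters of the grouping.\<close>

definition pop_step :: com where
  "pop_step = Assign 31 (Bin Sub (Var 31) (Cnst 1)) ;; Assign 20 (Arr 17 (Var 31)) ;;
   Assign 21 (Arr 18 (Var 31)) ;; Assign 22 (Arr 19 (Var 31)) ;; Assign 23 (Arr 20 (Var 31)) ;;
   Assign 24 (Arr 21 (Var 31))"

definition leaf_sum :: com where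
  "leaf_sum = Assign 38 (Cnst 0) ;; Assign 32 (Var 20) ;;
   For 32 (Var 21) (Assign 38 (Bin Add (Var 38) (Arr 14 (Arr 6 (Arr 10 (Var 32))))))"

definition leaf_add :: com where
  "leaf_add = Assign 32 (Var 20) ;;
   For 32 (Var 21) (Assign 33 (Arr 6 (Arr 10 (Var 32))) ;;
     Put 16 (Var 33) (Bin Sub (Bin Add (Arr 16 (Var 33)) (Var 38)) (Arr 14 (Var 33))))"

text \<open>In phase \<open>0\<close> the popped task is pushed again as phase \<open>2\<close>
  before the groups are. It lies below them and is resumed after them, when its range may be
  permuted but still holds the same set.\<close>

definition setup_step :: com where
  "setup_step = Assign 25 (Bin Quot (Bin Add (Var 22) (Var 23)) (Cnst 2)) ;;
   Cond (Lt (Var 24) (Cnst 2)) (Assign 26 (Arr 9 (Bin Sub (Var 23) (Var 25))))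
     (Assign 26 (Arr 9 (Bin Sub (Var 25) (Var 22)))) ;;
   Assign 28 (Var 22) ;; Assign 29 (Var 23) ;; Assign 30 (Cnst 0) ;;
   Cond (Equ (Var 24) (Cnst 0))
     (Assign 27 (Var 25) ;; Assign 30 (Cnst 1) ;;
      Put 17 (Var 31) (Var 20) ;; Put 18 (Var 31) (Var 21) ;; Put 19 (Var 31) (Var 22) ;;
      Put 20 (Var 31) (Var 23) ;; Put 21 (Var 31) (Cnst 2) ;; Assign 31 (Bin Add (Var 31) (Cnst 1)))
     (Cond (Equ (Var 24) (Cnst 1))
       (Assign 27 (Bin Sub (Var 23) (Bin Shift_Left (Cnst 1) (Var 26))) ;; Assign 29 (Var 25))
       (Cond (Equ (Var 24) (Cnst 2)) (Assign 27 (Var 22) ;; Assign 30 (Cnst 3))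
         (Assign 27 (Bin Sub (Var 25) (Bin Shift_Left (Cnst 1) (Var 26))) ;; Assign 28 (Var 25))))"

definition process :: com where
  "process = pop_step ;; Cond (Equ (Bin Sub (Var 23) (Var 22)) (Cnst 1))
     (leaf_sum ;; leaf_add) (setup_step ;; group)"

definition worklist :: com where
  "worklist = While (Lt (Cnst 0) (Var 31)) process"

lemma wv_pop: "written_vars pop_step = {20, 21, 22, 23, 24, 31}" and wa_pop: "written_arrs pop_step = {}"
  by (auto simp: pop_step_def)

lemma wv_leaf: "written_vars leaf_sum = {32, 38}" "written_vars leaf_add = {32, 33}"
  and wa_leaf: "written_arrs leaf_sum = {}" "written_arrs leaf_add = {16}"
  by (auto simp: leaf_sum_def leaf_add_def)

lemma wv_setup: "written_vars setup_step = {25, 26, 27, 28, 29, 30, 31}"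
  and wa_setup: "written_arrs setup_step = {17, 18, 19, 20, 21}"
  by (auto simp: setup_step_def)

lemmas written_process = wv_pop wa_pop wv_leaf wa_leaf wv_setup wa_setup written_group

section \<open>Correctness and cost of the search\<close>

locale dfs = wram w n + windows x m n wt reps for w n x m wt reps +
  assumes wt_le: "(\<Sum>i\<in>reps. wt i) \<le> n"
begin

abbreviation F :: "nat \<Rightarrow> nat" where "F \<equiv> window_name n x m"

definition search_inv :: "nat \<Rightarrow> regs \<Rightarrow> arrs \<Rightarrow> bool" where
  "search_inv D r a \<longleftrightarrow> names_inv x m r a \<and> r 2 = floor_log m \<and> (\<forall>i<n. a 6 i = F i) \<and> (\<forall>i\<in>reps. a 14 (F i) = wt i) \<and>
     (\<forall>k<n. a 23 k = 0) \<and> D \<le> n \<and> tasks_inv (a 10) D (r 31) (stack_task a) (\<lambda>i. a 16 (F i))"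

lemma rep_less: "i \<in> reps \<Longrightarrow> i < n"
  using bound[of i] m by linarith

lemma F_less: "i \<in> reps \<Longrightarrow> F i < n"
  using full_less[OF n0] rep_less by blast

text \<open>Weights and results stored under window names therefore do not collide.\<close>

lemma F_inj: "i \<in> reps \<Longrightarrow> j \<in> reps \<Longrightarrow> F i = F j \<Longrightarrow> i = j"
proof (rule distinct)
  fix k assume "i \<in> reps" "j \<in> reps" "F i = F j" "k < m"
  then show "x (i + k) = x (j + k)"
    using full_eq_iff[OF n0 rep_less rep_less m(1), of i j x] bound[of i] bound[of j] by auto
qed

lemma contr_le: "contribution S p q i \<le> n" if "S \<subseteq> reps"
proof -
  have "contribution S p q i \<le> (\<Sum>i\<in>reps. wt i)"
    unfolding contribution_def using that fin by (intro sum_mono2) auto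
  then show ?thesis using wt_le by simp
qed

lemma sum_wt_le: "S \<subseteq> reps \<Longrightarrow> (\<Sum>i\<in>S. wt i) \<le> n"
  using sum_mono2[OF fin, of S wt] wt_le by simp

lemma run_leaf_sum:
  assumes P: "inj_on (a 10) {r 20..<r 21}" "a 10 ` {r 20..<r 21} \<subseteq> reps" and uv: "r 20 \<le> r 21" "r 21 \<le> n"
    and c: "\<forall>i<n. a 6 i = F i" "\<forall>i\<in>reps. a 14 (F i) = wt i"
  shows "run leaf_sum r a (50 * (r 21 - r 20) + 20) (\<lambda>r' a'. r' 38 = (\<Sum>i\<in>a 10 ` {r 20..<r 21}. wt i))"
proof -
  let ?P = "a 10" and ?u = "r 20" and ?v = "r 21"
  have Pr: "?P p \<in> reps" if "?u \<le> p" "p < ?v" for p using P(2) that by auto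
  show ?thesis
    unfolding leaf_sum_def
    apply (rule run_le)
     apply (rule run_seq'[OF run_set0])
     apply (rule run_seq'[OF run_wp[where Q = "\<lambda>r' a'. r' 32 = ?u \<and> r' 20 = ?u \<and> r' 21 = ?v \<and> r' 38 = 0 \<and> a' = a" and t = 2]])
       prefer 3
       apply (rule run_For[where hi = ?v and s = 40 and t = "50 * (?v - ?u) + 10" and
          I = "\<lambda>i r' a'. r' 38 = (\<Sum>i\<in>?P ` {?u..<i}. wt i)"])
             prefer 5
  proof goal_cases
    case (1 r1 a1 r2 a2 i r3 a3)
    then have v: "r3 32 = i" "r3 21 = ?v" "a3 = a" "?u \<le> i" "i \<le> ?v" by (auto simp: frame_def)
    show ?case
    proof (intro conjI impI run_wp)
      assume i: "i < ?v"
      have rp: "?P i \<in> reps" using Pr v i by simp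
      have s: "{?u..<Suc i} = insert i {?u..<i}" using v by auto
      have ni: "?P i \<notin> ?P ` {?u..<i}"
      proof
        assume "?P i \<in> ?P ` {?u..<i}"
        then obtain p where "?u \<le> p" "p < i" "?P p = ?P i" by auto
        then show False using inj_onD[OF P(1), of p i] i v by auto
      qed
      have sum: "(\<Sum>i\<in>?P ` {?u..<Suc i}. wt i) = (\<Sum>i\<in>?P ` {?u..<i}. wt i) + wt (?P i)"
        unfolding s using ni by simp
      have "(\<Sum>i\<in>?P ` {?u..<Suc i}. wt i) \<le> n" using Pr i by (intro sum_wt_le) auto
      then have b: "(\<Sum>i\<in>?P ` {?u..<i}. wt i) + wt (?P i) < 2 ^ w" unfolding sum by (intro less_W) simp
      have b2: "i < 8 * n" "?P i < 8 * n" "F (?P i) < 8 * n" "?P i < n"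
        using rep_less[OF rp] F_less[OF rp] i uv by linarith+
      show "wp (Assign 38 (Bin Add (Var 38) (Arr 14 (Arr 6 (Arr 10 (Var 32))))))
         (\<lambda>r'' a''. (r''(32 := Suc i)) 38 = (\<Sum>i\<in>?P ` {?u..<Suc i}. wt i)) r3 a3"
        using 1 v b b2 c rp by (simp add: sum)
    qed (use v in auto)
  next
    case 5 then show ?case using uv by (intro less_W) simp
  qed (use uv in \<open>auto simp: frame_def\<close>)
qed

text \<open>The equation has \<open>wt i\<close> on the left to avoid subtraction. The machine adds
  the total before subtracting, which cannot underflow as the total includes \<open>wt i\<close>;
  the bound on array 16 excludes overflow.\<close>

lemma run_leaf_add:
  assumes P: "inj_on (a 10) {r 20..<r 21}" "a 10 ` {r 20..<r 21} \<subseteq> reps" and uv: "r 20 \<le> r 21" "r 21 \<le> n"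
    and c: "\<forall>i<n. a 6 i = F i" "\<forall>i\<in>reps. a 14 (F i) = wt i"
    and acc: "\<forall>i\<in>reps. a 16 (F i) \<le> n" "r 38 = (\<Sum>i\<in>a 10 ` {r 20..<r 21}. wt i)"
  shows "run leaf_add r a (70 * (r 21 - r 20) + 20) (\<lambda>r' a'.
    (\<forall>i\<in>a 10 ` {r 20..<r 21}. a' 16 (F i) + wt i = a 16 (F i) + (\<Sum>i\<in>a 10 ` {r 20..<r 21}. wt i)) \<and>
    (\<forall>i\<in>reps. i \<notin> a 10 ` {r 20..<r 21} \<longrightarrow> a' 16 (F i) = a 16 (F i)))"
proof -
  let ?P = "a 10" and ?u = "r 20" and ?v = "r 21"
  let ?T = "\<Sum>i\<in>?P ` {?u..<?v}. wt i"
  let ?I = "\<lambda>i (r'::regs) (a'::arrs). (\<forall>j\<in>?P ` {?u..<i}. a' 16 (F j) + wt j = a 16 (F j) + ?T) \<and>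
     (\<forall>j\<in>reps. j \<notin> ?P ` {?u..<i} \<longrightarrow> a' 16 (F j) = a 16 (F j))"
  have Pr: "?P p \<in> reps" if "?u \<le> p" "p < ?v" for p using P(2) that by auto
  have Tn: "?T \<le> n" using P(2) by (rule sum_wt_le)
  show ?thesis
    unfolding leaf_add_def
    apply (rule run_le)
     apply (rule run_seq'[OF run_wp[where Q = "\<lambda>r' a'. r' 32 = ?u \<and> r' 20 = ?u \<and> r' 21 = ?v \<and> a' = a" and t = 2]])
       prefer 3
       apply (rule run_For[where hi = ?v and s = 60 and t = "70 * (?v - ?u) + 10" and I = ?I])
             prefer 5
  proof goal_cases
    case (1 r1 a1 i r3 a3)
    then have v: "r3 32 = i" "r3 21 = ?v" "r3 38 = ?T" "a3 6 = a 6" "a3 10 = ?P" "a3 14 = a 14" "?u \<le> i" "i \<le> ?v"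
      using acc by (auto simp: frame_def)
    have I: "?I i r3 a3" using 1 by simp
    show ?case
    proof (intro conjI impI run_wp)
      assume i: "i < ?v"
      have rp: "?P i \<in> reps" using Pr v i by simp
      have s: "{?u..<Suc i} = insert i {?u..<i}" using v by auto
      have ni: "?P i \<notin> ?P ` {?u..<i}"
      proof
        assume "?P i \<in> ?P ` {?u..<i}"
        then obtain p where "?u \<le> p" "p < i" "?P p = ?P i" by auto
        then show False using inj_onD[OF P(1), of p i] i v by auto
      qed
      have a16: "a3 16 (F (?P i)) = a 16 (F (?P i))" using I rp ni by blast
      have "wt (?P i) \<le> ?T" using i v by (intro member_le_sum) auto
      moreover have "a 16 (F (?P i)) \<le> n" using acc(1) rp by blast
      ultimately have b: "wt (?P i) \<le> a 16 (F (?P i)) + ?T" "a 16 (F (?P i)) + ?T < 2 ^ w"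
          "a 16 (F (?P i)) + ?T - wt (?P i) < 2 ^ w"
        using Tn n2 by (linarith, (intro less_W, linarith)+)
      have b2: "i < 8 * n" "?P i < 8 * n" "F (?P i) < 8 * n" "?P i < n"
        using rep_less[OF rp] F_less[OF rp] i uv by linarith+
      have ne: "F j \<noteq> F (?P i)" if "j \<in> reps" "j \<noteq> ?P i" for j using F_inj[OF that(1) rp] that(2) by blast
      let ?X = "(a3 16)(F (?P i) := a 16 (F (?P i)) + ?T - wt (?P i))"
      have f1: "?X (F j) + wt j = a 16 (F j) + ?T" if "j \<in> ?P ` {?u..<Suc i}" for j
      proof (cases "j = ?P i")
        case False
        then have "j \<in> ?P ` {?u..<i}" using that unfolding s by auto
        then have "j \<in> reps" "a3 16 (F j) + wt j = a 16 (F j) + ?T" using Pr i I by auto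
        then show ?thesis using ne[of j] False by simp
      qed (use b in simp)
      have f2: "?X (F j) = a 16 (F j)" if "j \<in> reps" "j \<notin> ?P ` {?u..<Suc i}" for j
      proof -
        have "j \<noteq> ?P i" "j \<notin> ?P ` {?u..<i}" using that unfolding s by auto
        then show ?thesis using I that ne[of j] by simp
      qed
      have fI: "?I (Suc i) r' (a'(16 := ?X))" for r' a' using f1 f2 by simp
      show "wp (Assign 33 (Arr 6 (Arr 10 (Var 32))) ;;
          Put 16 (Var 33) (Bin Sub (Bin Add (Arr 16 (Var 33)) (Var 38)) (Arr 14 (Var 33))))
         (\<lambda>r'' a''. ?I (Suc i) (r''(32 := Suc i)) a'') r3 a3"
        using b b2 c rp fI[of a3] by (simp add: v a16)
    qed (use v in auto)
  next
    case 5 then show ?case using uv by (intro less_W) simp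
  qed (use uv in \<open>auto simp: frame_def\<close>)
qed

lemma run_setup:
  assumes v: "r 20 = u" "r 21 = v" "r 22 = l" "r 23 = q" "r 24 = h" "r 31 = s"
    and lq: "l + 2 \<le> q" "q \<le> m" "h \<le> 3" and s: "s \<le> 3 * n" and a9: "\<forall>v\<le>n. a 9 v = floor_log v"
  shows "run setup_step r a 150 (\<lambda>r' a'. r' 26 = key_level l q h \<and> r' 27 = key_offset l q h \<and> r' 28 = next_left l q h \<and>
    r' 29 = next_right l q h \<and> r' 30 = next_phase h \<and> r' 31 = (if h = 0 then s + 1 else s) \<and>
    (\<forall>p<s. stack_task a' p = stack_task a p) \<and> (h = 0 \<longrightarrow> stack_task a' s = (u, v, l, q, 2)))"
proof (rule run_wp)
  have qn: "q \<le> n" using lq m by linarith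
  have m1: "(l + q) div 2 \<le> q" "l \<le> (l + q) div 2" using lq by linarith+
  have fl: "floor_log t \<le> n" if "t \<le> n" for t
    using that by (metis bit_floor_log bit_imp_le floor_log_zero le_trans less_exp less_or_eq_imp_le not_gr_zero)
  have b: "l + q < 2 ^ w" "(l + q) div 2 < 2 ^ w" "q < 2 ^ w" "l < 2 ^ w" "s < 8 * n" "Suc s < 2 ^ w"
     "q - (l + q) div 2 < 2 ^ w" "q - (l + q) div 2 < 8 * n" "(l + q) div 2 - l < 2 ^ w" "(l + q) div 2 - l < 8 * n"
     "0 < (2::nat) ^ w" "Suc 0 < (2::nat) ^ w" "2 < (2::nat) ^ w" "3 < (2::nat) ^ w"
    using lq qn m1 s n2 by (linarith | (intro less_W; linarith))+
  have f: "a 9 (q - (l + q) div 2) = floor_log (q - (l + q) div 2)" "a 9 ((l + q) div 2 - l) = floor_log ((l + q) div 2 - l)"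
    using a9 qn m1 by auto
  have k1: "2 ^ floor_log (q - (l + q) div 2) \<le> q" "2 ^ floor_log (q - (l + q) div 2) < (2::nat) ^ w"
     "q - 2 ^ floor_log (q - (l + q) div 2) < (2::nat) ^ w"
    using fl_le[of "q - (l + q) div 2"] lq qn m1 n2 by (linarith, (intro less_W, linarith)+)
  have k2: "2 ^ floor_log ((l + q) div 2 - l) \<le> (l + q) div 2" "2 ^ floor_log ((l + q) div 2 - l) < (2::nat) ^ w"
     "(l + q) div 2 - 2 ^ floor_log ((l + q) div 2 - l) < (2::nat) ^ w"
    using fl_le[of "(l + q) div 2 - l"] lq qn m1 n2 by (linarith, (intro less_W, linarith)+)
  have fw: "floor_log (q - (l + q) div 2) < 2 ^ w" "floor_log ((l + q) div 2 - l) < 2 ^ w"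
    using fl[of "q - (l + q) div 2"] fl[of "(l + q) div 2 - l"] qn m1 by (intro less_W; linarith)+
  show "wp setup_step (\<lambda>r' a'. r' 26 = key_level l q h \<and> r' 27 = key_offset l q h \<and> r' 28 = next_left l q h \<and>
    r' 29 = next_right l q h \<and> r' 30 = next_phase h \<and> r' 31 = (if h = 0 then s + 1 else s) \<and>
    (\<forall>p<s. stack_task a' p = stack_task a p) \<and> (h = 0 \<longrightarrow> stack_task a' s = (u, v, l, q, 2))) r a"
  proof -
    consider "h = 0" | "h = 1" | "h = 2" | "h = 3" using lq by linarith
    then show ?thesis
      by cases (use b f k1 k2 fw m1 in \<open>simp_all add: setup_step_def v key_level_def key_offset_def next_left_def next_right_def next_phase_def stack_task_def\<close>)
  qed
qed (simp add: setup_step_def)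

lemma run_pop:
  assumes "r 31 = Suc s" "s < 8 * n" "s < 2 ^ w" "stack_task a s = (u, v, l, q, h)"
  shows "run pop_step r a 34 (\<lambda>r' a'. r' 31 = s \<and> r' 20 = u \<and> r' 21 = v \<and> r' 22 = l \<and> r' 23 = q \<and>
    r' 24 = h \<and> a' = a)"
  using assms const_small[of 1] by (intro run_wp) (auto simp: pop_step_def stack_task_def)

lemma inv_tinv: "search_inv D r a \<Longrightarrow> tasks_inv (a 10) D (r 31) (stack_task a) (\<lambda>i. a 16 (F i))"
  by (simp add: search_inv_def)

lemma inv_cong:
  assumes "search_inv D r a" "\<And>v. v \<in> {0, 2, 3, 4, 5, 7} \<Longrightarrow> r' v = r v" "\<And>k. k \<in> {6, 7, 8, 9, 14, 15} \<Longrightarrow> a' k = a k"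
    "\<forall>k<n. a' 23 k = 0" "tasks_inv (a' 10) D (r' 31) (stack_task a') (\<lambda>i. a' 16 (F i))"
  shows "search_inv D r' a'"
proof -
  have "names_inv x m r' a'" by (rule dinv_cong[of x m r a]) (use assms(1-3) in \<open>auto simp: search_inv_def\<close>)
  moreover have "r' 2 = r 2" "a' 6 = a 6" "a' 14 = a 14" using assms(2,3) by simp_all
  ultimately show ?thesis using assms(1,4,5) by (simp add: search_inv_def)
qed

lemma run_process:
  assumes I: "search_inv D r a" and sp: "0 < r 31" and gd: "valid_rate 500 \<omega>"
  shows "\<exists>T. run process r a T (\<lambda>r' a'. search_inv D r' a' \<and>
    (\<Sum>q<r' 31. task_pot 500 \<omega> (a' 10) (stack_task a' q)) + real (T + 4) \<le> (\<Sum>q<r 31. task_pot 500 \<omega> (a 10) (stack_task a q)))"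
proof -
  obtain s where s: "r 31 = Suc s" using sp by (cases "r 31") auto
  obtain u v l q h where t: "stack_task a s = (u, v, l, q, h)" by (metis prod_cases5)
  note ti = inv_tinv[OF I]
  have D: "D \<le> n" using I by (simp add: search_inv_def)
  have tk: "task_inv (a 10) D s (u, v, l, q, h)" using ti s t by (auto simp: tasks_inv_def)
  have uv: "u + 2 \<le> v" "v \<le> D" and ok: "task_ok (a 10 ` {u..<v}) l q h"
    and sz: "s + (v - u) + (q - l) \<le> 2 * n + (if h = 1 \<or> h = 3 then 1 else 0)"
    using tk by (auto simp: task_inv_def)
  have lq: "l < q" "q \<le> m" "h \<le> 3" "h \<noteq> 0 \<Longrightarrow> l + 2 \<le> q" "a 10 ` {u..<v} \<subseteq> reps" using ok by (auto simp: task_ok_def)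
  \<comment> \<open>The interval is nonempty, and its length absorbs the extra unit of the odd
    phases.\<close>
  have "(if h = 1 \<or> h = 3 then 1 else 0) \<le> (1::nat)" by simp
  then have ss: "s + (v - u) \<le> 2 * n" using sz lq(1) by linarith
  have sb: "s < 8 * n" "s < 2 ^ w" using ss n2 by (linarith, intro less_W, linarith)
  have injD: "inj_on (a 10) {..<D}" and rD: "a 10 ` {..<D} = reps" using ti by (auto simp: tasks_inv_def)
  have inj: "inj_on (a 10) {u..<v}" using injD by (rule inj_on_subset) (use uv in auto)
  have card: "card (a 10 ` {u..<v}) = v - u" using card_image[OF inj] by simp
  let ?Pot = "\<lambda>r' a'. \<Sum>q<r' 31. task_pot 500 \<omega> (a' 10) (stack_task a' q)"
  let ?Q = "\<lambda>r' a'. search_inv D r' a' \<and> ?Pot r' a' + 500 * real (v - u) \<le> ?Pot r a"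
  have main: "run (Cond (Equ (Bin Sub (Var 23) (Var 22)) (Cnst 1)) (leaf_sum ;; leaf_add) (setup_step ;; group))
      r1 a1 (300 * (v - u) + 206) ?Q"
    if f: "frame pop_step r a r1 a1" and p: "r1 31 = s \<and> r1 20 = u \<and> r1 21 = v \<and> r1 22 = l \<and> r1 23 = q \<and> r1 24 = h \<and> a1 = a"
    for r1 a1
  proof -
    have r1: "r1 31 = s" "r1 20 = u" "r1 21 = v" "r1 22 = l" "r1 23 = q" "r1 24 = h" "a1 = a" using p by auto
    have keep: "r1 k = r k" if "k \<in> {0, 2, 3, 4, 5, 7}" for k using f that by (auto simp: frame_def written_process)
    have d1: "names_inv x m r1 a" by (rule dinv_cong[of x m r a]) (use I keep in \<open>auto simp: search_inv_def\<close>)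
    show ?thesis
    proof (rule run_cond[where t = "300 * (v - u) + 200"])
      have "q - l < 2 ^ w" using lq m by (intro less_W) linarith
      then show "ok_bexp r1 a1 (Equ (Bin Sub (Var 23) (Var 22)) (Cnst 1))"
        using r1 lq const_small[of 1] by simp
    next
      assume "eval_bexp r1 a1 (Equ (Bin Sub (Var 23) (Var 22)) (Cnst 1))"
      then have ql: "q = Suc l" using r1 lq(1) by simp
      then have h: "h = 0" using lq(4) by force
      have ok0: "task_ok (a 10 ` {u..<v}) l (Suc l) 0" using ok ql h by simp
      \<comment> \<open>By the invariant an intermediate result never exceeds the final one, which
        is at most the total weight.\<close>
      have accb: "\<forall>i\<in>reps. a 16 (F i) \<le> n"
      proof
        fix i assume "i \<in> reps"
        then have "a 16 (F i) + (\<Sum>q<r 31. task_value (a 10) i (stack_task a q)) = contribution reps 0 m i"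
          using ti unfolding tasks_inv_def by blast
        then show "a 16 (F i) \<le> n" using contr_le[OF order_refl, of 0 m i] by linarith
      qed
      have cc: "\<forall>i<n. a 6 i = F i" "\<forall>i\<in>reps. a 14 (F i) = wt i" using I by (auto simp: search_inv_def)
      show "run (leaf_sum ;; leaf_add) r1 a1 (300 * (v - u) + 200) ?Q"
      proof (rule run_seq)
        show "run leaf_sum r1 a1 (50 * (v - u) + 20) (\<lambda>r' a'. r' 38 = (\<Sum>i\<in>a 10 ` {u..<v}. wt i))"
          using run_leaf_sum[of a r1] inj lq(5) uv D cc r1 by simp
        fix r2 a2 assume f2: "frame leaf_sum r1 a1 r2 a2" and T: "r2 38 = (\<Sum>i\<in>a 10 ` {u..<v}. wt i)"
        have r2: "r2 20 = u" "r2 21 = v" "r2 31 = s" "a2 = a" using f2 r1 by (auto simp: frame_def written_process)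
        have "run leaf_add r2 a (70 * (r2 21 - r2 20) + 20) (\<lambda>r' a'.
          (\<forall>i\<in>a 10 ` {r2 20..<r2 21}. a' 16 (F i) + wt i = a 16 (F i) + (\<Sum>i\<in>a 10 ` {r2 20..<r2 21}. wt i)) \<and>
          (\<forall>i\<in>reps. i \<notin> a 10 ` {r2 20..<r2 21} \<longrightarrow> a' 16 (F i) = a 16 (F i)))"
          by (rule run_leaf_add) (use inj lq(5) uv D cc r2 accb T in simp_all)
        note R = this[unfolded r2(1,2)]
        show "run leaf_add r2 a2 (70 * (v - u) + 20) ?Q"
          unfolding r2(4)
        proof (rule run_mono[OF R order_refl])
          fix r3 a3 assume f3: "frame leaf_add r2 a r3 a3"
            and acc: "(\<forall>i\<in>a 10 ` {u..<v}. a3 16 (F i) + wt i = a 16 (F i) + (\<Sum>i\<in>a 10 ` {u..<v}. wt i)) \<and>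
              (\<forall>i\<in>reps. i \<notin> a 10 ` {u..<v} \<longrightarrow> a3 16 (F i) = a 16 (F i))"
          have r3: "r3 31 = s" "a3 10 = a 10" "stack_task a3 = stack_task a" "a3 23 = a 23"
            using f3 r2 by (auto simp: frame_def written_process stack_task_def fun_eq_iff)
          have "tasks_inv (a 10) D s (stack_task a) (\<lambda>i. a3 16 (F i))"
          proof (rule tinv_leaf[OF ti[unfolded s]])
            show "stack_task a s = (u, v, l, Suc l, 0)" using t ql h by simp
          qed (use acc in auto)
          then have "search_inv D r3 a3"
          proof (intro inv_cong[OF I])
            show "r3 k = r k" if "k \<in> {0, 2, 3, 4, 5, 7}" for k
              using f3 f2 keep[OF that] that by (auto simp: frame_def written_process)
            show "a3 k = a k" if "k \<in> {6, 7, 8, 9, 14, 15}" for k using f3 that by (auto simp: frame_def written_process)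
            show "\<forall>k<n. a3 23 k = 0" using I r3 by (simp add: search_inv_def)
          qed (simp add: r3)
          moreover have "500 * real (v - u) \<le> task_pot 500 \<omega> (a 10) (stack_task a s)"
            using pot_leaf[OF gd ok0] card t ql h by (simp add: task_pot_def)
          ultimately show "?Q r3 a3" using r3 s by simp
        qed
      qed simp
    next
      assume "\<not> eval_bexp r1 a1 (Equ (Bin Sub (Var 23) (Var 22)) (Cnst 1))"
      then have lq2: "l + 2 \<le> q" using r1 lq(1) by simp
      have a9: "\<forall>v\<le>n. a 9 v = floor_log v" using d1 by (simp add: names_inv_def)
      have s3: "s \<le> 3 * n" using ss by linarith
      show "run (setup_step ;; group) r1 a1 (300 * (v - u) + 200) ?Q"
        unfolding r1(7)
      proof (rule run_seq[OF run_setup[of r1 u v l q h s a, OF r1(2-6,1) lq2 lq(2,3) s3 a9]])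
        fix r2 a2 assume f2: "frame setup_step r1 a r2 a2"
          and Q: "r2 26 = key_level l q h \<and> r2 27 = key_offset l q h \<and> r2 28 = next_left l q h \<and> r2 29 = next_right l q h \<and> r2 30 = next_phase h \<and>
             r2 31 = (if h = 0 then s + 1 else s) \<and>
            (\<forall>p<s. stack_task a2 p = stack_task a p) \<and> (h = 0 \<longrightarrow> stack_task a2 s = (u, v, l, q, 2))"
        have r2: "r2 20 = u" "r2 21 = v" "a2 10 = a 10" "a2 23 = a 23" "r2 2 = r 2"
          using f2 r1 keep by (auto simp: frame_def written_process)
        have d2: "names_inv x m r2 a2" by (rule dinv_cong[OF d1]) (use f2 in \<open>auto simp: frame_def written_process\<close>)
        note kr = key_range[OF lq2 lq(2,3)]
        have kJ: "key_level l q h \<le> r 2"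
          using kr(2) I floor_log_mono floor_log_power unfolding search_inv_def by (metis monoD)
        let ?s0 = "if h = 0 then s + 1 else s"
        have "?s0 \<le> s + 1" by simp
        then have s0: "?s0 + (v - u) \<le> 4 * n" using ss n2 by linarith
        have off: "a 10 p + key_offset l q h < n" if "u \<le> p" "p < v" for p
        proof -
          have "a 10 p \<in> reps" using lq(5) that by auto
          moreover have "0 < (2::nat) ^ key_level l q h" by simp
          ultimately show ?thesis using kr(1) bound[of "a 10 p"] by linarith
        qed
        have z: "\<forall>k<n. a 23 k = 0" using I by (simp add: search_inv_def)
        have R: "run group r2 a2 (300 * (r2 21 - r2 20) + 50) (\<lambda>r' a'.
          grouped n (r2 20) (r2 21) (\<lambda>p. block_name n x (r2 26) (a2 10 p + r2 27)) (a2 10) (r2 31) (r2 28, r2 29, r2 30)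
            (a' 10) (r' 31) (stack_task a') \<and>
          (\<forall>p. p < r2 20 \<or> r2 21 \<le> p \<longrightarrow> a' 10 p = a2 10 p) \<and>
          (\<forall>k<n. a' 23 k = 0) \<and> (\<forall>q<r2 31. stack_task a' q = stack_task a2 q))"
          by (rule run_group[OF d2 m(2)]) (use Q r2 kJ uv D off z s0 in \<open>simp_all\<close>)
        show "run group r2 a2 (300 * (v - u) + 50) ?Q"
          using R unfolding r2(1,2)
        proof (rule run_mono[OF _ order_refl], goal_cases)
          case (1 r3 a3)
          let ?K = "\<lambda>p. key l q h (a 10 p)"
          have Ke: "(\<lambda>p. block_name n x (r2 26) (a2 10 p + r2 27)) = ?K" using Q r2 by (simp add: key_def)
          have G: "grouped n u v ?K (a 10) ?s0 (next_left l q h, next_right l q h, next_phase h) (a3 10) (r3 31) (stack_task a3)"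
            using 1(2) Q r2 unfolding Ke by simp
          have P3: "\<And>p. p < u \<or> v \<le> p \<Longrightarrow> a3 10 p = a 10 p" and z3: "\<forall>k<n. a3 23 k = 0"
            and old: "\<And>p. p < ?s0 \<Longrightarrow> stack_task a3 p = stack_task a2 p"
            using 1(2) Q r2 by auto
          have t1: "stack_task a3 p = stack_task a p" if "p < s" for p using old[of p] Q that by simp
          have t2: "stack_task a3 s = (u, v, l, q, 2)" if "h = 0" using old[of s] Q that by simp
          have a16: "a3 16 = a 16" using 1(1) f2 by (auto simp: frame_def written_process)
          note sp = tinv_split[OF ti[unfolded s] t lq2 gd t1 t2 refl G P3]
          have "search_inv D r3 a3"
          proof (rule inv_cong[OF I])
            show "r3 k = r k" if "k \<in> {0, 2, 3, 4, 5, 7}" for k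
              using 1(1) f2 keep[OF that] that by (auto simp: frame_def written_process)
            show "a3 k = a k" if "k \<in> {6, 7, 8, 9, 14, 15}" for k
              using 1(1) f2 that by (auto simp: frame_def written_process)
          qed (use z3 sp(1) a16 in simp_all)
          then show ?case using sp(2) s by simp
        qed
      qed simp
    qed simp
  qed
  \<comment> \<open>The fixed costs are \<open>34\<close> for popping and \<open>206\<close> for
    branching and setup. A task has at least two windows, so these \<open>240\<close> steps fit into
    \<open>120 * (v - u)\<close>; the constant 500 of the potential also covers the loop
    test.\<close>
  have "run process r a (420 * (v - u)) ?Q"
    unfolding process_def
    by (rule run_seq[OF run_pop[of r s a u v l q h, OF s sb t] main]) (use uv in auto)
  then have "run process r a (420 * (v - u)) (\<lambda>r' a'. search_inv D r' a' \<and> ?Pot r' a' + real (420 * (v - u) + 4) \<le> ?Pot r a)"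
  proof (rule run_mono[OF _ order_refl])
    fix r' a' assume Q: "?Q r' a'"
    have "real (420 * (v - u) + 4) \<le> real (500 * (v - u))"
      unfolding of_nat_le_iff using uv(1) by linarith
    then have "real (420 * (v - u) + 4) \<le> 500 * real (v - u)" by (simp only: of_nat_mult of_nat_numeral)
    then have "?Pot r' a' + real (420 * (v - u) + 4) \<le> ?Pot r a" using conjunct2[OF Q] by linarith
    then show "search_inv D r' a' \<and> ?Pot r' a' + real (420 * (v - u) + 4) \<le> ?Pot r a" using Q by blast
  qed
  then show ?thesis by blast
qed

lemma run_worklist:
  assumes I: "search_inv D r a" and gd: "valid_rate 500 \<omega>"
    and T: "(\<Sum>q<r 31. task_pot 500 \<omega> (a 10) (stack_task a q)) + 4 \<le> real T"
  shows "run worklist r a T (\<lambda>r' a'. search_inv D r' a' \<and> (\<forall>i\<in>reps. a' 16 (F i) = contribution reps 0 m i))"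
  unfolding worklist_def
proof (rule run_while[where I = "search_inv D" and \<Psi> = "\<lambda>r a. \<Sum>q<r 31. task_pot 500 \<omega> (a 10) (stack_task a q)"])
  fix r' a' assume I': "search_inv D r' a'"
  have "0 \<le> (\<Sum>q<r' 31. task_pot 500 \<omega> (a' 10) (stack_task a' q))"
    by (intro sum_nonneg) (use tpot_nonneg[OF inv_tinv[OF I'] gd] in auto)
  then show "ok_bexp r' a' (Lt (Cnst 0) (Var 31)) \<and> 0 \<le> (\<Sum>q<r' 31. task_pot 500 \<omega> (a' 10) (stack_task a' q)) \<and>
     (eval_bexp r' a' (Lt (Cnst 0) (Var 31)) \<longrightarrow> (\<exists>s. run process r' a' s (\<lambda>r'' a''. search_inv D r'' a'' \<and>
        (\<Sum>q<r'' 31. task_pot 500 \<omega> (a'' 10) (stack_task a'' q)) + real (s + bexp_size (Lt (Cnst 0) (Var 31)) + 2)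
        \<le> (\<Sum>q<r' 31. task_pot 500 \<omega> (a' 10) (stack_task a' q)))))"
    using run_process[OF I' _ gd] const_small[of 0] by (simp add: numeral_eq_Suc)
next
  fix r' a' assume "search_inv D r' a'" "\<not> eval_bexp r' a' (Lt (Cnst 0) (Var 31))"
  then show "search_inv D r' a' \<and> (\<forall>i\<in>reps. a' 16 (F i) = contribution reps 0 m i)" by (simp add: search_inv_def tasks_inv_def)
qed (use I T in auto)

end

section \<open>The complete program\<close>

text \<open>A counter still at zero shows that the window is the first with its name. Register 6
  counts the representatives, and the counters end up as their weights.\<close>

definition collect :: com where
  "collect = Assign 11 (Cnst 0) ;; Assign 6 (Cnst 0) ;;
   Assign 12 (Bin Add (Bin Sub (Var 0) (Var 7)) (Cnst 1)) ;;
   For 11 (Var 12)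
     (Assign 13 (Arr 6 (Var 11)) ;;
      Cond (Equ (Arr 14 (Var 13)) (Cnst 0))
        (Put 10 (Var 6) (Var 11) ;; Assign 6 (Bin Add (Var 6) (Cnst 1))) Skip ;;
      Put 14 (Var 13) (Bin Add (Arr 14 (Var 13)) (Cnst 1)))"

definition push_all :: com where
  "push_all = Assign 31 (Cnst 0) ;; Cond (Lt (Cnst 1) (Var 6))
     (Put 17 (Cnst 0) (Cnst 0) ;; Put 18 (Cnst 0) (Var 6) ;; Put 19 (Cnst 0) (Cnst 0) ;;
      Put 20 (Cnst 0) (Var 7) ;; Put 21 (Cnst 0) (Cnst 0) ;; Assign 31 (Cnst 1)) Skip"

definition emit :: com where
  "emit = Assign 11 (Cnst 0) ;; For 11 (Var 12) (Put 22 (Var 11) (Arr 16 (Arr 6 (Var 11))))"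

definition main :: "nat \<Rightarrow> com" where
  "main \<sigma> = preprocess \<sigma> ;; collect ;; push_all ;; worklist ;; emit"

lemma wv_collect: "written_vars collect = {6, 11, 12, 13}" and wa_collect: "written_arrs collect = {10, 14}"
  by (auto simp: collect_def)

lemma wv_push: "written_vars push_all = {31}" and wa_push: "written_arrs push_all = {17, 18, 19, 20, 21}"
  by (auto simp: push_all_def)

lemma wv_worklist: "written_vars worklist = {20, 21, 22, 23, 24, 25, 26, 27, 28, 29, 30, 31, 32, 33, 34, 35, 36, 37, 38}"
  and wa_worklist: "written_arrs worklist = {10, 11, 12, 13, 16, 17, 18, 19, 20, 21, 23}"
  by (auto simp: worklist_def process_def written_process)

lemma wv_prep: "written_vars (preprocess \<sigma>) = {2, 3, 4, 5, 7, 10, 11, 12, 13, 14, 15}"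
  and wa_prep: "written_arrs (preprocess \<sigma>) = {2, 3, 4, 5, 6, 7, 8, 9, 15}"
  by (auto simp: preprocess_def written_preprocess)

lemmas written_main = wv_collect wa_collect wv_push wa_push wv_worklist wa_worklist wv_prep wa_prep

lemma wfc_main: "wf_com (main \<sigma>)"
  by (simp add: main_def preprocess_def letter_names_def msb_table_def doubling_def double_step_def record_level_def
      pairname_def collect_def push_all_def worklist_def process_def pop_step_def leaf_sum_def
      leaf_add_def setup_step_def group_def key_step_def alloc_step_def place_step_def emit_def For_def)

section \<open>Representatives of classes of equal windows\<close>

definition firsts :: "(nat \<Rightarrow> nat) \<Rightarrow> nat \<Rightarrow> nat set" where
  "firsts f k = {i. i < k \<and> (\<forall>j<i. f j \<noteq> f i)}"

lemma firsts_Suc: "firsts f (Suc k) = (if \<forall>j<k. f j \<noteq> f k then insert k (firsts f k) else firsts f k)"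
  by (auto simp: firsts_def less_Suc_eq)

lemma firsts_ex: "i < k \<Longrightarrow> \<exists>j\<in>firsts f k. f j = f i"
proof (induction i rule: less_induct)
  case (less i)
  show ?case
  proof (cases "\<forall>j<i. f j \<noteq> f i")
    case False
    then obtain j where "j < i" "f j = f i" by auto
    then show ?thesis using less.IH[of j] less.prems by auto
  qed (use less.prems in \<open>auto simp: firsts_def\<close>)
qed

lemma firsts_inj: "i \<in> firsts f k \<Longrightarrow> j \<in> firsts f k \<Longrightarrow> f i = f j \<Longrightarrow> i = j"
  by (auto simp: firsts_def) (metis linorder_neqE_nat)

lemma finite_firsts [simp]: "finite (firsts f k)"
  by (simp add: firsts_def)

text \<open>The classes of \<open>f\<close> partition the positions satisfying \<open>Q\<close>, and
  each has exactly one first element, so weighted representatives count all positions.\<close>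

lemma sum_firsts:
  assumes "\<And>i j. i < k \<Longrightarrow> j < k \<Longrightarrow> f i = f j \<Longrightarrow> Q i \<longleftrightarrow> Q j"
  shows "(\<Sum>i\<in>{i \<in> firsts f k. Q i}. card {t. t < k \<and> f t = f i}) = card {t. t < k \<and> Q t}"
proof -
  have "(\<Sum>i\<in>{i \<in> firsts f k. Q i}. card {t. t < k \<and> f t = f i}) =
     card (\<Union>i\<in>{i \<in> firsts f k. Q i}. {t. t < k \<and> f t = f i})"
    by (rule card_UN_disjoint[symmetric]) (use firsts_inj[of _ f k] in \<open>auto\<close>)
  also have "(\<Union>i\<in>{i \<in> firsts f k. Q i}. {t. t < k \<and> f t = f i}) = {t. t < k \<and> Q t}"
  proof (intro equalityI subsetI)
    fix t assume "t \<in> (\<Union>i\<in>{i \<in> firsts f k. Q i}. {t. t < k \<and> f t = f i})"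
    then obtain i where "i < k" "Q i" "t < k" "f t = f i" by (auto simp: firsts_def)
    then show "t \<in> {t. t < k \<and> Q t}" using assms by blast
  next
    fix t assume t: "t \<in> {t. t < k \<and> Q t}"
    then obtain i where i: "i \<in> firsts f k" "f i = f t" using firsts_ex[of t k f] by auto
    then have "i < k" by (simp add: firsts_def)
    then show "t \<in> (\<Union>i\<in>{i \<in> firsts f k. Q i}. {t. t < k \<and> f t = f i})" using assms[of i t] i t by auto
  qed
  finally show ?thesis .
qed

context wram
begin

lemma run_collect:
  assumes r: "r 0 = n" "r 7 = m" "0 < m" "m < n" and a: "\<forall>i<n. a 6 i = f i" "\<forall>i<n. f i < n" "\<forall>i. a 14 i = 0"
  defines "N \<equiv> n - m + 1"
  shows "run collect r a (100 * n) (\<lambda>r' a'. r' 12 = N \<and> (\<forall>k<n. a' 14 k = card {j. j < N \<and> f j = k}) \<and>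
    r' 6 \<le> N \<and> inj_on (a' 10) {..<r' 6} \<and> a' 10 ` {..<r' 6} = firsts f N)"
proof -
  have N: "N \<le> n" using r by (simp add: N_def)
  let ?I = "\<lambda>i (r'::regs) (a'::arrs). (\<forall>k<n. a' 14 k = card {j. j < i \<and> f j = k}) \<and> r' 6 \<le> i \<and>
     inj_on (a' 10) {..<r' 6} \<and> a' 10 ` {..<r' 6} = firsts f i"
  let ?J = "\<lambda>r' a'. r' 11 = 0 \<and> r' 6 = 0 \<and> r' 12 = N \<and> a' = a"
  show ?thesis
    unfolding collect_def
    apply (rule run_le)
     apply (rule run_seq'[OF run_set0])
     apply (rule run_seq'[OF run_set0])
     apply (rule run_seq'[OF run_wp[where Q = ?J and t = 10]])
       prefer 3
       apply (rule run_For'[where hi = N and s = 50 and I = ?I])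
            prefer 5
  proof goal_cases
    case (1 r1 a1 r2 a2 r3 a3 i r4 a4)
    then have v: "r4 11 = i" "r4 12 = N" "a4 6 = a 6" "i \<le> N" by (auto simp: frame_def)
    have I: "?I i r4 a4" using 1 by simp
    have I1: "a4 14 k = card {j. j < i \<and> f j = k}" if "k < n" for k using I that by blast
    have I2: "r4 6 \<le> i" "inj_on (a4 10) {..<r4 6}" "a4 10 ` {..<r4 6} = firsts f i" using I by blast+
    show ?case
    proof (intro conjI impI run_wp)
      assume i: "i < N"
      have fi: "f i < n" "a 6 i = f i" using a i N by auto
      have "card {j. j < i \<and> f j = f i} \<le> card {..<i}" by (intro card_mono) auto
      then have b: "i < 8 * n" "f i < 8 * n" "r4 6 < 8 * n" "Suc (r4 6) < 2 ^ w"
         "Suc (card {j. j < i \<and> f j = f i}) < 2 ^ w" "0 < (2::nat) ^ w" "Suc 0 < (2::nat) ^ w"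
        using i N fi I2(1) n2 by (linarith | (intro less_W; simp))+
      have c0: "card {j. j < i \<and> f j = f i} = 0 \<longleftrightarrow> (\<forall>j<i. f j \<noteq> f i)" by auto
      show "wp (Assign 13 (Arr 6 (Var 11)) ;;
        Cond (Equ (Arr 14 (Var 13)) (Cnst 0))
          (Put 10 (Var 6) (Var 11) ;; Assign 6 (Bin Add (Var 6) (Cnst 1))) Skip ;;
        Put 14 (Var 13) (Bin Add (Arr 14 (Var 13)) (Cnst 1)))
         (\<lambda>r'' a''. ?I (Suc i) (r''(11 := Suc i)) a'') r4 a4"
      proof (cases "\<forall>j<i. f j \<noteq> f i")
        case True
        have P: "inj_on ((a4 10)(r4 6 := i)) {..<Suc (r4 6)}" "((a4 10)(r4 6 := i)) ` {..<Suc (r4 6)} = firsts f (Suc i)"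
        proof -
          have e: "((a4 10)(r4 6 := i)) ` {..<r4 6} = firsts f i" using I2(3) by (auto intro!: image_cong)
          have "firsts f (Suc i) = insert i (firsts f i)" using True by (simp add: firsts_Suc)
          then show "((a4 10)(r4 6 := i)) ` {..<Suc (r4 6)} = firsts f (Suc i)"
            unfolding lessThan_Suc image_insert e by simp
          have "inj_on ((a4 10)(r4 6 := i)) {..<r4 6}" using I2(2) by (simp add: inj_on_def)
          then show "inj_on ((a4 10)(r4 6 := i)) {..<Suc (r4 6)}"
            unfolding lessThan_Suc using e by (simp add: inj_on_insert firsts_def)
        qed
        show ?thesis using True b fi I1 I2 c0 P by (simp add: v card_less_Suc_filter)
      next
        case False
        then have "firsts f (Suc i) = firsts f i" unfolding firsts_Suc by (rule if_not_P)
        then show ?thesis using b fi I1 I2 by (simp add: v card_less_Suc_filter) (use False in blast)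
      qed
    qed (use v in auto)
  next
    case 5 then show ?case using N by (intro less_W) simp
  next
    case 6 then show ?case by (auto simp: frame_def)
  next
    case (2 r1 a1 r2 a2 r3 a3)
    then show ?case using a by (auto simp: firsts_def)
  next
    case (7 r1 a1 r2 a2)
    then have "r2 0 = n" "r2 7 = m" "r2 11 = 0" "r2 6 = 0" "a2 = a" using r by (auto simp: frame_def)
    then show ?case using r less_W[of "n - m"] less_W[of "Suc (n - m)"] const_small[of 1] n2 by (simp add: N_def)
  next
    case 9 show ?case using N n2 by simp
  qed auto
qed

end

text \<open>The rate occurs only in the analysis and may be chosen separately for every instance;
  taking the better of the two rates produces the minimum.\<close>

lemma (in windows) pot_all_bound:
  assumes "card reps \<le> n"
  obtains \<omega> where "valid_rate 500 \<omega>" "potential 500 \<omega> reps 0 m 0 \<le>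
    min (4000 * (real m * real n)) (2000 * (real n * log 2 (real n)) * (real (floor_log m) + 2))"
proof -
  have n1: "1 \<le> real n" "1 \<le> real m" using m by simp_all
  let ?\<omega>1 = "\<lambda>N s. 4 * 500 * (2 * real s - 1)" and ?\<omega>2 = "\<lambda>N s. 4 * 500 * log 2 (real N) * real (depth s)"
  have 1: "valid_rate 500 ?\<omega>1" "valid_rate 500 ?\<omega>2" using good_linear[of 500] good_log[of 500] by auto
  have c: "real (card reps) \<le> real n" using assms by simp
  have "potential 500 ?\<omega>1 reps 0 m 0 = real (card reps) * (2000 * (2 * real m - 1))" by (simp add: potential_def)
  also have "\<dots> \<le> real n * (4000 * real m)" by (rule mult_mono) (use c n1 in auto)
  finally have p1: "potential 500 ?\<omega>1 reps 0 m 0 \<le> 4000 * (real m * real n)" by (simp add: mult_ac)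
  have "potential 500 ?\<omega>2 reps 0 m 0 = real (card reps) * log 2 (real (card reps)) * (2000 * real (depth m))"
    by (simp add: potential_def)
  also have "\<dots> \<le> (real n * log 2 (real n)) * (2000 * (real (floor_log m) + 2))"
  proof (rule mult_mono)
    show "real (card reps) * log 2 (real (card reps)) \<le> real n * log 2 (real n)"
    proof (cases "card reps = 0")
      case False
      then have "log 2 (real (card reps)) \<le> log 2 (real n)" "0 \<le> log 2 (real (card reps))" using c by simp_all
      then show ?thesis using c by (intro mult_mono) auto
    qed (use n1(1) in simp)
    have "real (depth m) \<le> real (floor_log m + 2)" unfolding of_nat_le_iff by (rule depth_le)
    then show "2000 * real (depth m) \<le> 2000 * (real (floor_log m) + 2)" by simp
    show "0 \<le> real n * log 2 (real n)" using n1(1) by simp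
  qed simp
  finally have p2: "potential 500 ?\<omega>2 reps 0 m 0 \<le> 2000 * (real n * log 2 (real n)) * (real (floor_log m) + 2)"
    by (simp add: mult_ac)
  show ?thesis
  proof (cases "4000 * (real m * real n) \<le> 2000 * (real n * log 2 (real n)) * (real (floor_log m) + 2)")
    case True then show ?thesis using that[OF 1(1)] p1 by simp
  next
    case False then show ?thesis using that[OF 1(2)] p2 by simp
  qed
qed

text \<open>The first summand pays for the preprocessing, the ceiling for the search, and the rest
  for collecting, pushing and output.\<close>

definition time_bound :: "nat \<Rightarrow> nat \<Rightarrow> nat \<Rightarrow> nat" where
  "time_bound \<sigma> n m = (1000 + 100 * \<sigma>) * n * (floor_log m + 1) + 300 * n +
     nat \<lceil>min (4000 * (real m * real n)) (2000 * (real n * log 2 (real n)) * (real (floor_log m) + 2))\<rceil> + 100"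

context wram
begin

lemma run_main:
  assumes r: "r 0 = n" "r 1 = m" "0 < m" "m < n" and x: "\<forall>i<n. x i < \<sigma>" "\<sigma> < 2 ^ w"
    and a: "a 0 = x" "\<forall>k>0. \<forall>i. a k i = 0"
  shows "run (main \<sigma>) r a (time_bound \<sigma> n m) (\<lambda>r' a'. \<forall>i<n - m + 1. a' 22 i =
    card {j. j < n - m + 1 \<and> (\<exists>!k. k < m \<and> x (i + k) \<noteq> x (j + k))})"
proof -
  define f where "f = window_name n x m"
  define N where "N = n - m + 1"
  define wt where "wt i = card {t. t < N \<and> f t = f i}" for i
  define reps where "reps = firsts f N"
  have N: "N \<le> n" and Nm: "\<And>i. i < N \<Longrightarrow> i + m \<le> n" "\<And>i. i < N \<Longrightarrow> i < n"
    using r by (auto simp: N_def)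
  have fn: "f i < n" if "i < n" for i using full_less[OF n0 that] by (simp add: f_def)
  have feq: "f i = f j \<longleftrightarrow> (\<forall>k<m. x (i + k) = x (j + k))" if "i < N" "j < N" for i j
  proof -
    have "f i = f j \<longleftrightarrow> (\<forall>k<m. x ((i + k) mod n) = x ((j + k) mod n))"
      unfolding f_def using full_eq_iff[OF n0 Nm(2)[OF that(1)] Nm(2)[OF that(2)] r(3)] .
    then show ?thesis using Nm(1)[OF that(1)] Nm(1)[OF that(2)] by auto
  qed
  have rN: "i < N" if "i \<in> reps" for i using that by (simp add: reps_def firsts_def)
  have wins: "windows x m n reps"
  proof
    show "i = j" if "i \<in> reps" "j \<in> reps" "\<And>k. k < m \<Longrightarrow> x (i + k) = x (j + k)" for i j
      using firsts_inj[of i f N j] that feq[OF rN rN, of i j] by (simp add: reps_def)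
  qed (use r rN Nm in \<open>auto simp: reps_def\<close>)
  have sumwt: "(\<Sum>i\<in>reps. wt i) = N"
    using sum_firsts[of N f "\<lambda>_. True"] by (simp add: reps_def wt_def)
  interpret dfs w n x m wt reps
  proof (intro dfs.intro dfs_axioms.intro)
    show "wram w n" by unfold_locales
    show "windows x m n reps" by (rule wins)
    show "(\<Sum>i\<in>reps. wt i) \<le> n" using sumwt N by simp
  qed
  have cr: "card reps \<le> n"
    using card_mono[of "{..<N}" reps] rN N by (auto simp: subset_iff)
  obtain \<omega> where gd: "valid_rate 500 \<omega>" and pb: "potential 500 \<omega> reps 0 m 0 \<le>
    min (4000 * (real m * real n)) (2000 * (real n * log 2 (real n)) * (real (floor_log m) + 2))"
    using pot_all_bound[OF cr] .
  define X where "X = nat \<lceil>min (4000 * (real m * real n)) (2000 * (real n * log 2 (real n)) * (real (floor_log m) + 2))\<rceil>"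
  define TW where "TW = X + 4"
  have tb: "time_bound \<sigma> n m = (1000 + 100 * \<sigma>) * n * (floor_log m + 1) + 300 * n + X + 100"
    by (simp only: time_bound_def X_def)
  have pTW: "potential 500 \<omega> reps 0 m 0 + 4 \<le> real TW"
    using order_trans[OF pb real_nat_ceiling_ge] by (simp add: TW_def X_def)
  have ff: "F = f" by (simp add: f_def)
  \<comment> \<open>The result of a representative is correct for every window \<open>i'\<close>
    with the same name.\<close>
  have val: "contribution reps 0 m i = card {j. j < N \<and> (\<exists>!k. k < m \<and> x (i' + k) \<noteq> x (j + k))}"
    if "i \<in> reps" "i' < N" "f i = f i'" for i i'
  proof -
    have w: "x (i + k) = x (i' + k)" if "k < m" for k
      using feq[OF rN[OF \<open>i \<in> reps\<close>] \<open>i' < N\<close>] \<open>f i = f i'\<close> that by blast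
    have o: "one_mismatch 0 m i j \<longleftrightarrow> (\<exists>!k. k < m \<and> x (i' + k) \<noteq> x (j + k))" for j
    proof -
      have "one_mismatch 0 m i j \<longleftrightarrow> (\<exists>!k. k < m \<and> x (i + k) \<noteq> x (j + k))"
        unfolding one_mismatch_def Ex1_def by (simp, blast)
      moreover have "(k < m \<and> x (i + k) \<noteq> x (j + k)) = (k < m \<and> x (i' + k) \<noteq> x (j + k))" for k
        using w by auto
      ultimately show ?thesis by simp
    qed
    have "contribution reps 0 m i = (\<Sum>j\<in>{j \<in> firsts f N. one_mismatch 0 m i j}. card {t. t < N \<and> f t = f j})"
      by (simp add: contribution_def reps_def wt_def)
    also have "\<dots> = card {j. j < N \<and> one_mismatch 0 m i j}"
    proof (rule sum_firsts)
      fix j j' assume "j < N" "j' < N" "f j = f j'"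
      then have "\<forall>k<m. x (j + k) = x (j' + k)" using feq by blast
      then have "(k < m \<and> x (i' + k) \<noteq> x (j + k)) = (k < m \<and> x (i' + k) \<noteq> x (j' + k))" for k by auto
      then show "one_mismatch 0 m i j \<longleftrightarrow> one_mismatch 0 m i j'" unfolding o by simp
    qed
    finally show ?thesis by (simp add: o)
  qed
  show ?thesis
    unfolding main_def
  proof (rule run_seq)
    show "run (preprocess \<sigma>) r a ((1000 + 100 * \<sigma>) * n * (floor_log m + 1)) (\<lambda>r' a'. names_inv x m r' a' \<and>
      r' 2 = floor_log m \<and> (\<forall>i<n. a' 6 i = f i))"
      using run_prep[of r m a \<sigma>] assms by (simp add: f_def)
    fix r1 a1 assume f1: "frame (preprocess \<sigma>) r a r1 a1" and p1: "names_inv x m r1 a1 \<and> r1 2 = floor_log m \<and> (\<forall>i<n. a1 6 i = f i)"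
    have z1: "a1 k i = 0" if "k \<in> {10, 11, 12, 13, 14, 16, 17, 18, 19, 20, 21, 22, 23}" for k i
      using f1 that a by (auto simp: frame_def written_main)
    have v1: "r1 0 = n" "r1 7 = m" using p1 by (auto simp: names_inv_def)
    show "run (collect ;; push_all ;; worklist ;; emit) r1 a1 (100 * n + (60 + (TW + (100 * n + 10)))) (\<lambda>r' a'. \<forall>i<n - m + 1. a' 22 i =
      card {j. j < n - m + 1 \<and> (\<exists>!k. k < m \<and> x (i + k) \<noteq> x (j + k))})"
    proof (rule run_seq)
      show "run collect r1 a1 (100 * n) (\<lambda>r' a'. r' 12 = N \<and> (\<forall>k<n. a' 14 k = card {j. j < N \<and> f j = k}) \<and>
        r' 6 \<le> N \<and> inj_on (a' 10) {..<r' 6} \<and> a' 10 ` {..<r' 6} = reps)"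
        unfolding N_def reps_def
        by (rule run_collect) (use v1 r p1 z1[of 14] fn in auto)
      fix r2 a2 assume f2: "frame collect r1 a1 r2 a2" and p2: "r2 12 = N \<and> (\<forall>k<n. a2 14 k = card {j. j < N \<and> f j = k}) \<and>
        r2 6 \<le> N \<and> inj_on (a2 10) {..<r2 6} \<and> a2 10 ` {..<r2 6} = reps"
      have v2: "r2 7 = m" "r2 2 = floor_log m" "a2 6 = a1 6" "a2 16 = a1 16" "a2 23 = a1 23" "r2 0 = n"
        using f2 v1 p1 by (auto simp: frame_def written_main)
      let ?D = "r2 6"
      have cD: "card reps = ?D" using p2 card_image[of "a2 10" "{..<?D}"] by simp
      have DN: "?D \<le> N" "N + m = n + 1" using p2 r by (auto simp: N_def)
      let ?P = "\<lambda>r' a'. r' 31 = (if 1 < ?D then 1 else 0) \<and> (1 < ?D \<longrightarrow> stack_task a' 0 = (0, ?D, 0, m, 0))"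
      show "run (push_all ;; worklist ;; emit) r2 a2 (60 + (TW + (100 * n + 10))) (\<lambda>r' a'. \<forall>i<n - m + 1. a' 22 i =
        card {j. j < n - m + 1 \<and> (\<exists>!k. k < m \<and> x (i + k) \<noteq> x (j + k))})"
      proof (rule run_seq)
        show "run push_all r2 a2 60 ?P"
          using W_bounds(1,2) n2 v2 r by (intro run_wp) (auto simp: push_all_def stack_task_def)
        fix r3 a3 assume f3: "frame push_all r2 a2 r3 a3" and p3: "?P r3 a3"
        have v3: "a3 10 = a2 10" "a3 6 = a1 6" "a3 14 = a2 14" "a3 16 = a1 16" "a3 23 = a1 23" "r3 12 = N" "r3 0 = n"
          using f3 v2 p2 by (auto simp: frame_def written_main)
        have ti: "tasks_inv (a3 10) ?D (r3 31) (stack_task a3) (\<lambda>i. a3 16 (F i))"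
        proof (cases "1 < ?D")
          case True
          have e: "a3 10 ` {0..<?D} = reps" using p2 v3 by (simp add: atLeast0LessThan)
          have "task_ok reps 0 m 0" using True cD m by (auto simp: task_ok_def agree_def)
          moreover have "?D + m \<le> 2 * n" using DN r by linarith
          ultimately show ?thesis using True p2 p3 e z1[of 16] unfolding tasks_inv_def v3(1,4)
            by (auto simp: task_inv_def task_value_def mismatch_from_def mismatch_to_def v3)
        next
          case False
          then have "contribution reps 0 m i = 0" if "i \<in> reps" for i
            using contr_single[of reps i 0 m] that cD fin by simp
          then show ?thesis using False p2 p3 z1[of 16] unfolding tasks_inv_def v3(1,4) by simp
        qed
        have d3: "names_inv x m r3 a3"
          by (rule dinv_cong[of x m r1 a1]) (use p1 f2 f3 in \<open>auto simp: frame_def written_main\<close>)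
        have "r3 2 = floor_log m" using f3 v2 by (simp add: frame_def written_main)
        moreover have "a3 14 (F i) = wt i" if "i \<in> reps" for i
        proof -
          have "f i < n" using fn Nm(2) rN that by blast
          then show ?thesis using p2 v3(3) ff by (simp add: wt_def)
        qed
        moreover have "a3 6 i = F i" if "i < n" for i using p1 v3(2) ff that by simp
        moreover have "a3 23 k = 0" for k using z1[of 23] v3(5) by simp
        moreover have "?D \<le> n" using DN N by linarith
        ultimately have I3: "search_inv ?D r3 a3"
          unfolding search_inv_def using d3 ti by blast
        have pot3: "(\<Sum>q<r3 31. task_pot 500 \<omega> (a3 10) (stack_task a3 q)) + 4 \<le> real TW"
        proof (cases "1 < ?D")
          case True
          have e: "a3 10 ` {0..<?D} = reps" using p2 v3 by (simp add: atLeast0LessThan)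
          show ?thesis using True p3 e pTW by (simp add: task_pot_def)
        next
          case False
          then show ?thesis using p3 by (simp add: TW_def)
        qed
        show "run (worklist ;; emit) r3 a3 (TW + (100 * n + 10)) (\<lambda>r' a'. \<forall>i<n - m + 1. a' 22 i =
          card {j. j < n - m + 1 \<and> (\<exists>!k. k < m \<and> x (i + k) \<noteq> x (j + k))})"
        proof (rule run_seq[OF run_worklist[OF I3 gd pot3]])
          fix r4 a4 assume f4: "frame worklist r3 a3 r4 a4" and p4: "search_inv ?D r4 a4 \<and> (\<forall>i\<in>reps. a4 16 (F i) = contribution reps 0 m i)"
          have v4: "r4 12 = N" "a4 6 = a1 6" using f4 v3 by (auto simp: frame_def written_main)
          have val4: "a4 16 (f i) = card {j. j < N \<and> (\<exists>!k. k < m \<and> x (i + k) \<noteq> x (j + k))}" if i: "i < N" for i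
          proof -
            obtain i0 where i0: "i0 \<in> reps" "f i0 = f i" using firsts_ex[OF i, of f] by (auto simp: reps_def)
            then show ?thesis using val[OF i0(1) i i0(2)] p4 ff by metis
          qed
          define c where "c i = card {j. j < N \<and> (\<exists>!k. k < m \<and> x (i + k) \<noteq> x (j + k))}" for i
          note val4 = val4[folded c_def]
          show "run emit r4 a4 (100 * n + 10) (\<lambda>r' a'. \<forall>i<n - m + 1. a' 22 i =
            card {j. j < n - m + 1 \<and> (\<exists>!k. k < m \<and> x (i + k) \<noteq> x (j + k))})"
            unfolding emit_def N_def[symmetric] c_def[symmetric]
          proof (rule run_seq[OF run_set0])
            fix r5 a5 assume f5: "frame (Assign 11 (Cnst 0)) r4 a4 r5 a5" and p5: "r5 11 = 0 \<and> a5 = a4"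
            show "run (For 11 (Var 12) (Put 22 (Var 11) (Arr 16 (Arr 6 (Var 11))))) r5 a5 (50 * N + 10)
              (\<lambda>r' a'. \<forall>i<N. a' 22 i = c i)"
            proof (rule run_For[where hi = N and s = 40 and I = "\<lambda>i r' a'. \<forall>j<i. a' 22 j = c j"], goal_cases)
              case (5 i r6 a6)
              then have v: "r6 11 = i" "r6 12 = N" "a6 16 = a4 16" "a6 6 = a1 6" "i \<le> N"
                using f5 p5 v4 by (auto simp: frame_def)
              show ?case
              proof (intro conjI impI run_wp)
                assume i: "i < N"
                have "a1 6 i = f i" "f i < 8 * n" "i < 8 * n" using p1 fn[OF Nm(2)[OF i]] Nm(2)[OF i] by auto
                moreover have "\<forall>j<i. a6 22 j = c j" using 5 by simp
                ultimately show "wp (Put 22 (Var 11) (Arr 16 (Arr 6 (Var 11))))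
                    (\<lambda>r'' a''. \<forall>j<Suc i. a'' 22 j = c j) r6 a6"
                  using val4[OF i] by (simp add: v All_less_Suc)
              qed (use v in auto)
            next
              case 4 then show ?case using N by (intro less_W) simp
            qed (use p5 in auto)
          qed (use N n2 in simp)
        qed simp
      qed simp
    qed simp
  qed (simp add: tb TW_def)
qed

end

text \<open>The output is array 22, which starts at address \<open>8 * 22 * n\<close>, that is
  \<open>176 * n\<close>. Register 0 holds \<open>n\<close> up to this point and is turned into that
  address at the very end.\<close>

definition program :: "nat \<Rightarrow> instr list" where
  "program \<sigma> = compile (main \<sigma>) 0 @ [Const 64 176, Op Mul 0 0 64, Halt]"

lemma card_1_iff_ex1: "card {k. P k} = 1 \<longleftrightarrow> (\<exists>!k. P k)"
proof
  assume "card {k. P k} = 1"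
  then obtain a where "{k. P k} = {a}" by (rule card_1_singletonE)
  then show "\<exists>!k. P k" by (metis mem_Collect_eq singleton_iff)
next
  assume "\<exists>!k. P k"
  then obtain a where "P a" "\<And>k. P k \<Longrightarrow> k = a" by blast
  then have "{k. P k} = {a}" by blast
  then show "card {k. P k} = 1" by simp
qed

lemma hamming_distance_factor:
  assumes "i + m \<le> length x" "j + m \<le> length x"
  shows "hamming_distance (factor x i m) (factor x j m) = 1 \<longleftrightarrow> (\<exists>!k. k < m \<and> x ! (i + k) \<noteq> x ! (j + k))"
proof -
  have "{k. k < length (factor x i m) \<and> factor x i m ! k \<noteq> factor x j m ! k} =
    {k. k < m \<and> x ! (i + k) \<noteq> x ! (j + k)}"
    using assms by (auto simp: factor_def)
  then show ?thesis unfolding hamming_distance_def by (simp only: card_1_iff_ex1)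
qed

lemma letter_rank_less:
  assumes "finite A" "a \<in> A"
  shows "letter_rank A a < card A"
  unfolding letter_rank_def using assms by (intro psubset_card_mono) auto

lemma letter_rank_inj:
  assumes "finite A" "a \<in> A" "b \<in> A" "letter_rank A a = letter_rank A b"
  shows "a = b"
proof -
  have *: "letter_rank A a < letter_rank A b" if "a < b" "a \<in> A" for a b
    unfolding letter_rank_def using assms(1) that by (intro psubset_card_mono) auto
  show ?thesis using *[of a b] *[of b a] assms by (cases a b rule: linorder_cases) auto
qed

text \<open>In the bound on the word length, \<open>192\<close> makes all memory addressable, and
  \<open>card A\<close> lets the loop bound over the letters and the input ranks fit into a
  word.\<close>

lemma program_correct:
  fixes x :: "'a::linorder list"
  assumes A: "finite A" "set x \<subseteq> A" and m: "1 \<le> m" "m < length x" and w: "(192 + card A) * length x \<le> 2 ^ w"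
  shows "computes_within w (program (card A)) [length x, m] (map (letter_rank A) x) (one_mappability x m)
    (time_bound (card A) (length x) m + 2) (192 * length x)"
proof -
  define n where "n = length x"
  define \<sigma> where "\<sigma> = card A"
  have n: "2 \<le> n" "m < n" using m by (auto simp: n_def)
  have w': "192 * n + \<sigma> * n \<le> 2 ^ w" using w by (simp add: n_def \<sigma>_def distrib_right)
  have "\<sigma> * 1 \<le> \<sigma> * n" using n by (intro mult_left_mono) auto
  then have sw: "\<sigma> < 2 ^ w" using w' n by linarith
  interpret wram w n by unfold_locales (use n w' in linarith)+
  let ?xs = "map (letter_rank A) x"
  define r where "r = (\<lambda>r. if r < length [n, m] then [n, m] ! r else 0)"
  define a where "a k i = (if k = 0 \<and> i < n then ?xs ! i else 0)" for k i :: nat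
  define M where "M = ?xs @ replicate (192 * n - n) 0"
  have lM: "length M = 192 * n" by (simp add: M_def n_def)
  have init: "initial_config [length x, m] ?xs (192 * length x) = (0, r, M)"
    unfolding initial_config_def r_def M_def n_def by simp
  have xs: "?xs ! i < \<sigma>" "x ! i \<in> A" if "i < n" for i
    using letter_rank_less[OF A(1)] A(2) that by (auto simp: n_def \<sigma>_def subset_iff)
  have rl: "represents r a r M"
    unfolding represents_def
  proof (intro conjI allI impI)
    fix k i :: nat assume k: "k < 24" "i < 8 * n"
    have b: "8 * k * n + i < 192 * n" using addr_less[OF k] .
    show "M ! (8 * k * n + i) = a k i"
    proof (cases "k = 0")
      case True
      then show ?thesis using b by (simp add: M_def a_def nth_append n_def)
    next
      case False
      then have "1 * n \<le> 8 * k * n" by (intro mult_right_mono) auto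
      then have "\<not> 8 * k * n + i < n" by linarith
      then show ?thesis using b False by (simp add: M_def a_def nth_append n_def)
    qed
  qed (simp_all add: r_def lM)
  have "run (main \<sigma>) r a (time_bound \<sigma> n m) (\<lambda>r' a'. \<forall>i<n - m + 1. a' 22 i =
    card {j. j < n - m + 1 \<and> (\<exists>!k. k < m \<and> a 0 (i + k) \<noteq> a 0 (j + k))})"
    by (rule run_main) (use m n xs sw in \<open>auto simp: r_def a_def n_def\<close>)
  then obtain t r' a' where t: "t \<le> time_bound \<sigma> n m" and e: "exec (main \<sigma>) r a t r' a'"
    and out: "\<And>i. i < n - m + 1 \<Longrightarrow> a' 22 i =
      card {j. j < n - m + 1 \<and> (\<exists>!k. k < m \<and> a 0 (i + k) \<noteq> a 0 (j + k))}"
    unfolding run_def by blast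
  let ?P = "program \<sigma>"
  have code: "code_at ?P 0 (compile (main \<sigma>) 0 @ [Const 64 176, Op Mul 0 0 64, Halt])"
    by (simp add: program_def code_at_def)
  then have c: "code_at ?P 0 (compile (main \<sigma>) 0)"
    "code_at ?P (com_size (main \<sigma>)) [Const 64 176, Op Mul 0 0 64, Halt]" by simp_all
  from comp_correct[OF e c(1) rl wfc_main] obtain R1 M1 t1 where
    1: "t1 \<le> t" "steps w ?P (0, r, M) t1 (com_size (main \<sigma>), R1, M1)" "represents r' a' R1 M1" by auto
  let ?p = "com_size (main \<sigma>)"
  have R0: "R1 0 = n" using 1(3) by (auto simp: represents_def)
  have b: "(176::nat) < 2 ^ w" "n * 176 < 2 ^ w" using const_small[of 176] big n by (simp, linarith)
  let ?R2 = "R1(64 := 176)" and ?R3 = "R1(64 := 176, 0 := n * 176)"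
  have 2: "steps w ?P (?p, R1, M1) 1 (?p + 1, ?R2, M1)"
    using c(2) b by (intro steps_1) (auto simp: take_bit_eq_mod)
  have 3: "steps w ?P (?p + 1, ?R2, M1) 1 (?p + 2, ?R3, M1)"
    using c(2) b R0 by (intro steps_1) (auto simp: take_bit_eq_mod)
  from steps_trans[OF steps_trans[OF 1(2) 2] 3]
  have st: "(step w ?P ^^ (t1 + 1 + 1)) (initial_config [length x, m] ?xs (192 * length x)) (?p + 2, ?R3, M1)"
    unfolding steps_def init .
  have halt: "halted ?P (?p + 2, ?R3, M1)" using c(2) by (simp add: halted_def)
  have mismatch_from: "length (one_mappability x m) = n - m + 1" by (simp add: one_mappability_def n_def)
  have lM1: "length M1 = 192 * n" using 1(3) by (simp add: represents_def)
  have fit: "n * 176 + (n - m + 1) \<le> length M1" using lM1 n by linarith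
  have "take (n - m + 1) (drop (n * 176) M1) = one_mappability x m"
  proof (rule nth_equalityI)
    show "length (take (n - m + 1) (drop (n * 176) M1)) = length (one_mappability x m)" using fit mismatch_from by simp
    fix i assume "i < length (take (n - m + 1) (drop (n * 176) M1))"
    then have i: "i < n - m + 1" by simp
    then have i8: "i < 8 * n" using n by linarith
    have "take (n - m + 1) (drop (n * 176) M1) ! i = M1 ! (8 * 22 * n + i)" using i fit by (simp add: mult.commute)
    also have "\<dots> = a' 22 i" 
    proof -
      have "\<forall>k<24. \<forall>i<8 * n. M1 ! (8 * k * n + i) = a' k i" using 1(3) by (simp add: represents_def)
      from this[rule_format, of 22 i] i8 show ?thesis by simp
    qed
    also have "\<dots> = card {j. j < n - m + 1 \<and> (\<exists>!k. k < m \<and> a 0 (i + k) \<noteq> a 0 (j + k))}" using out[OF i] .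
    also have "{j. j < n - m + 1 \<and> (\<exists>!k. k < m \<and> a 0 (i + k) \<noteq> a 0 (j + k))} =
      {j. j \<le> length x - m \<and> hamming_distance (factor x i m) (factor x j m) = 1}"
    proof (rule Collect_cong)
      fix j
      show "(j < n - m + 1 \<and> (\<exists>!k. k < m \<and> a 0 (i + k) \<noteq> a 0 (j + k))) \<longleftrightarrow>
        (j \<le> length x - m \<and> hamming_distance (factor x i m) (factor x j m) = 1)"
      proof (cases "j \<le> length x - m")
        case True
        then have ij: "i + m \<le> n" "j + m \<le> n" using i n by (auto simp: n_def)
        have "a 0 (i + k) = a 0 (j + k) \<longleftrightarrow> x ! (i + k) = x ! (j + k)" if "k < m" for k
        proof -
          have l: "i + k < n" "j + k < n" using ij that by linarith+
          then show ?thesis using letter_rank_inj[OF A(1) xs(2)[OF l(1)] xs(2)[OF l(2)]]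
            by (auto simp: a_def n_def)
        qed
        then have "(k < m \<and> a 0 (i + k) \<noteq> a 0 (j + k)) \<longleftrightarrow> (k < m \<and> x ! (i + k) \<noteq> x ! (j + k))" for k by blast
        then show ?thesis using hamming_distance_factor[of i m x j] ij True by (simp add: n_def less_Suc_eq_le)
      qed (simp add: n_def)
    qed
    also have "card \<dots> = one_mappability x m ! i"
      using i by (simp add: one_mappability_def n_def del: upt_Suc)
    finally show "take (n - m + 1) (drop (n * 176) M1) ! i = one_mappability x m ! i" .
  qed
  moreover have "length ?xs \<le> 192 * n" by (simp add: n_def)
  moreover have "a < 2 ^ w" if "a \<in> set [length x, m] \<union> set ?xs" for a
  proof -
    have "a \<le> n \<or> a < \<sigma>" using that n A letter_rank_less[OF A(1)] by (auto simp: n_def \<sigma>_def)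
    then show ?thesis using sw less_W[of a] by auto
  qed
  moreover have "\<exists>k pc R M'. k \<le> time_bound \<sigma> n m + 2 \<and>
     (step w ?P ^^ k) (initial_config [length x, m] ?xs (192 * length x)) (pc, R, M') \<and> halted ?P (pc, R, M') \<and>
     R 0 + length (one_mappability x m) \<le> length M' \<and>
     take (length (one_mappability x m)) (drop (R 0) M') = one_mappability x m"
  proof (rule exI[of _ "t1 + 1 + 1"], rule exI[of _ "?p + 2"], rule exI[of _ ?R3], rule exI[of _ M1], intro conjI)
    show "t1 + 1 + 1 \<le> time_bound \<sigma> n m + 2" using t 1(1) by simp
    show "?R3 0 + length (one_mappability x m) \<le> length M1" using fit mismatch_from by simp
    show "take (length (one_mappability x m)) (drop (?R3 0) M1) = one_mappability x m"
      using calculation(1) mismatch_from by simp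
  qed (fact st halt)+
  ultimately show ?thesis
    unfolding computes_within_def n_def[symmetric] \<sigma>_def[symmetric] using big by blast
qed

text \<open>Preprocessing costs \<open>n\<close> times \<open>L + 1\<close>, which lies below both
  bounds because \<open>2 ^ L \<le> m < n\<close> gives \<open>L + 1 \<le> m\<close> and
  \<open>L \<le> log 2 n\<close>. As \<open>n \<ge> 2\<close> makes the logarithm at least one,
  lower powers of it and the linear terms are absorbed.\<close>

lemma time_bound_le:
  assumes "1 \<le> m" "m < n"
  shows "real (time_bound \<sigma> n m + 2) \<le>
    (10000 + 200 * real \<sigma>) * min (real m * real n) (real n * (log 2 (real n))\<^sup>2)"
proof -
  define L where "L = floor_log m"
  define y where "y = log 2 (real n)"
  define c where "c = 1000 + 100 * real \<sigma>"
  have n: "2 \<le> real n" "1 \<le> real m" "real m \<le> real n" using assms by auto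
  have "log 2 2 \<le> y" unfolding y_def using n by (subst log_le_cancel_iff) auto
  then have l1: "1 \<le> y" by simp
  have L2: "2 ^ L \<le> m" unfolding L_def using assms by (intro floor_log_exp2_le) simp
  have Lm: "real L + 1 \<le> real m"
  proof -
    have "real (L + 1) \<le> real m" unfolding of_nat_le_iff using less_exp[of L] L2 by linarith
    then show ?thesis by simp
  qed
  have "real (2 ^ L) \<le> real n" using L2 assms by (simp only: of_nat_le_iff)
  then have "2 powr real L \<le> real n" by (simp add: powr_realpow)
  then have Ll: "real L \<le> y" unfolding y_def using n by (subst le_log_iff) auto
  have l2: "y \<le> y\<^sup>2" using l1 by (simp add: power2_eq_square)
  have "real (nat \<lceil>min (4000 * (real m * real n)) (2000 * (real n * log 2 (real n)) * (real (floor_log m) + 2))\<rceil>)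
    \<le> min (4000 * (real m * real n)) (2000 * (real n * log 2 (real n)) * (real (floor_log m) + 2)) + 1"
  proof -
    have "0 \<le> min (4000 * (real m * real n)) (2000 * (real n * log 2 (real n)) * (real (floor_log m) + 2))"
      using n l1 by (simp add: y_def[symmetric])
    then show ?thesis by linarith
  qed
  then have T: "real (time_bound \<sigma> n m + 2) \<le> c * (real n * (real L + 1)) + 300 * real n +
    min (4000 * (real m * real n)) (2000 * (real n * y) * (real L + 2)) + 103"
    unfolding time_bound_def L_def[symmetric] y_def[symmetric] c_def by (simp add: algebra_simps)
  have c0: "0 \<le> c" by (simp add: c_def)
  define Z where "Z = c * (real n * (real L + 1))"
  define M where "M = min (4000 * (real m * real n)) (2000 * (real n * y) * (real L + 2))"
  have T: "real (time_bound \<sigma> n m + 2) \<le> Z + 300 * real n + M + 103" using T unfolding Z_def M_def .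
  \<comment> \<open>The constant splits into \<open>2 * c\<close> for the preprocessing,
    \<open>6000\<close> for the search and \<open>2000\<close> for \<open>300 * n + 103\<close>,
    where \<open>n \<ge> 2\<close>.\<close>
  have fin: "real (time_bound \<sigma> n m + 2) \<le> (10000 + 200 * real \<sigma>) * X"
    if "Z \<le> 2 * (c * X)" "M \<le> 6000 * X" "real n \<le> X" for X
  proof -
    have "(10000 + 200 * real \<sigma>) * X = 2 * (c * X) + 8000 * X" by (simp add: c_def algebra_simps)
    then show ?thesis using T that n by linarith
  qed
  have A: "real (time_bound \<sigma> n m + 2) \<le> (10000 + 200 * real \<sigma>) * (real m * real n)"
  proof (rule fin)
    have "real n * (real L + 1) \<le> real n * real m" using Lm by (intro mult_left_mono) auto
    then have "Z \<le> c * (real m * real n)" unfolding Z_def using c0 by (simp add: mult_left_mono mult.commute)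
    moreover have "0 \<le> c * (real m * real n)" using c0 by simp
    ultimately show "Z \<le> 2 * (c * (real m * real n))" by linarith
    have "1 * real n \<le> real m * real n" using n by (intro mult_right_mono) auto
    then show n_le: "real n \<le> real m * real n" by simp
    have "M \<le> 4000 * (real m * real n)" unfolding M_def by simp
    then show "M \<le> 6000 * (real m * real n)" using n_le n by linarith
  qed
  have B: "real (time_bound \<sigma> n m + 2) \<le> (10000 + 200 * real \<sigma>) * (real n * y\<^sup>2)"
  proof (rule fin)
    have "real L + 1 \<le> 2 * y\<^sup>2" using Ll l1 l2 by linarith
    then have "Z \<le> c * (real n * (2 * y\<^sup>2))" unfolding Z_def using c0 by (intro mult_left_mono) auto
    then show "Z \<le> 2 * (c * (real n * y\<^sup>2))" by simp
    have "real n * 1 \<le> real n * y\<^sup>2" using l1 l2 by (intro mult_left_mono) auto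
    then show "real n \<le> real n * y\<^sup>2" by simp
    have "M \<le> 2000 * (real n * y) * (real L + 2)" unfolding M_def by simp
    also have "\<dots> \<le> 2000 * (real n * y) * (3 * y)"
      using Ll l1 n by (intro mult_left_mono) auto
    finally show "M \<le> 6000 * (real n * y\<^sup>2)" by (simp add: power2_eq_square mult_ac)
  qed
  show ?thesis using A B unfolding y_def by (simp add: min_def)
qed

theorem theorem3:
  fixes A :: "'a::linorder set"
  assumes "finite A"
  shows "\<exists>P T S. solves_one_mappability A P T S \<and>
    (\<lambda>(n, m). real (T n m)) \<in>
      O[admissible](\<lambda>(n, m). min (real m * real n) (real n * (log 2 (real n))\<^sup>2)) \<and>
    (\<lambda>(n, m). real (S n m)) \<in> O[admissible](\<lambda>(n, m). real n)"
proof (intro exI conjI)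
  show "solves_one_mappability A (program (card A)) (\<lambda>n m. time_bound (card A) n m + 2) (\<lambda>n m. 192 * n)"
    unfolding solves_one_mappability_def using program_correct[OF assms]
    by (intro exI[of _ "192 + card A"]) blast
  show "(\<lambda>(n, m). real (time_bound (card A) n m + 2)) \<in>
      O[admissible](\<lambda>(n, m). min (real m * real n) (real n * (log 2 (real n))\<^sup>2))"
  proof (rule bigoI[where c = "10000 + 200 * real (card A)"])
    show "\<forall>\<^sub>F p in admissible. norm (case p of (n, m) \<Rightarrow> real (time_bound (card A) n m + 2)) \<le>
      (10000 + 200 * real (card A)) * norm (case p of (n, m) \<Rightarrow> min (real m * real n) (real n * (log 2 (real n))\<^sup>2))"
      unfolding admissible_def eventually_principal
      using time_bound_le by (auto simp del: of_nat_add)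
  qed
  show "(\<lambda>(n, m). real (192 * n)) \<in> O[admissible](\<lambda>(n, m). real n)"
    by (rule bigoI[where c = 192]) (auto simp: admissible_def eventually_principal)
qed

end
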